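(* Let $(M,0)$ be a real $\mathcal{C}^1$-smooth hypersurface germ at $0\in\mathbb{C}^2$ defined by the equation $$\rho(z_1,z_2):=\mathrm{Re}\,z_1+P(z_2)+(\mathrm{Im}\,z_1)\,Q(z_2,\mathrm{Im}\,z_1)=0,$$ where $P$ and $Q$ are real-valued functions defined near $0\in\mathbb{C}$ and near $(0,0)\in\mathbb{C}\times\mathbb{R}$ respectively, satisfying: (1) $P,Q$ are $\mathcal{C}^1$-smooth with $P(0)=Q(0,0)=0$; (2) $P(z_2)>0$ for any $z_2\neq 0$; (3) $P(z_2)$ and $P'(z_2)$ are flat at $z_2=0$. Then $\dim_{\mathbb{R}}\mathrm{hol}_0(M,0)\le 1$.
   Context: For a real $\mathcal{C}^1$-smooth hypersurface germ $(M,p)$ in $\mathbb{C}^n$, a holomorphic vector field germ $(H,p)$ is tangent to $M$ if $\mathrm{Re}\,H$ is tangent to $M$; for $M=\{\rho=0\}$ this means $(\mathrm{Re}\,H)\rho=0$ at all points of $M$ near $p$. For $n=2$, $p=0$ and $H=h_1\frac{\partial}{\partial z_1}+h_2\frac{\partial}{\partial z_2}$, this reads $\mathrm{Re}\big[h_1\rho_{z_1}+h_2\rho_{z_2}\big]=0$ on $M$ near $0$. $\mathrm{hol}_0(M,p)$ denotes the real vector space of holomorphic vector field germs $(H,p)$ vanishing at $p$ which are tangent to $M$. $P'(z)=P_z(z)=\frac{\partial P}{\partial z}(z)$ is the Wirtinger derivative. A complex-valued function $f$ defined near $0\in\mathbb{C}$ (no smoothness required) is flat at $0$ if for each $n\in\mathbb{N}$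 there exist $C,\epsilon>0$ (depending on $n$) with $|f(z)|\le C|z|^n$ for all $|z|<\epsilon$. *)

theory Defs
  imports "HOL-Analysis.Analysis"
begin

definition C1_near :: "('a::real_normed_vector \<Rightarrow> 'b::real_normed_vector) \<Rightarrow> 'a \<Rightarrow> bool"
  where "C1_near f p \<longleftrightarrow>
    (\<exists>U f'. open U \<and> p \<in> U \<and> continuous_on U f' \<and>
      (\<forall>x\<in>U. (f has_derivative blinfun_apply (f' x)) (at x)))"

text \<open>The Wirtinger derivative of a real-differentiable function of one complex variable, that is
  half of (df/dx - i df/dy); the real partial derivatives are the values of the Frechet derivative
  at 1 and \<open>\<i>\<close>.\<close>

definition wirtinger :: "(complex \<Rightarrow> complex) \<Rightarrow> complex \<Rightarrow> complex"
  where "wirtinger f z =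
    (frechet_derivative f (at z) 1 - \<i> * frechet_derivative f (at z) \<i>) / 2"

definition wirtinger1 :: "(complex \<times> complex \<Rightarrow> real) \<Rightarrow> complex \<times> complex \<Rightarrow> complex"
  where "wirtinger1 \<rho> z = wirtinger (\<lambda>w. of_real (\<rho> (w, snd z))) (fst z)"

definition wirtinger2 :: "(complex \<times> complex \<Rightarrow> real) \<Rightarrow> complex \<times> complex \<Rightarrow> complex"
  where "wirtinger2 \<rho> z = wirtinger (\<lambda>w. of_real (\<rho> (fst z, w))) (snd z)"

definition flat_at_0 :: "(complex \<Rightarrow> complex) \<Rightarrow> bool"
  where "flat_at_0 f \<longleftrightarrow>
    (\<forall>n::nat. \<exists>C>0. \<exists>\<epsilon>>0. \<forall>z. norm z < \<epsilon> \<longrightarrow> norm (f z) \<le> C * norm z ^ n)"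

text \<open>Since \<open>holomorphic_on\<close> only covers one variable, a function of two complex variables is called
  holomorphic here if its derivative exists and is complex linear at each point of an open set.\<close>

definition holomorphic2_near_0 :: "(complex \<times> complex \<Rightarrow> complex) \<Rightarrow> bool"
  where "holomorphic2_near_0 h \<longleftrightarrow>
    (\<exists>U. open U \<and> 0 \<in> U \<and>
      (\<forall>z\<in>U. \<exists>a b. (h has_derivative (\<lambda>v. a * fst v + b * snd v)) (at z)))"

definition tangent_near_0 ::
    "(complex \<times> complex \<Rightarrow> complex \<times> complex) \<Rightarrow> (complex \<times> complex \<Rightarrow> real) \<Rightarrow> bool"
  where "tangent_near_0 H \<rho> \<longleftrightarrow>
    (\<forall>\<^sub>F z in nhds 0. \<rho> z = 0 \<longrightarrow>
      Re (fst (H z) * wirtinger1 \<rho> z + snd (H z) * wirtinger2 \<rho> z) = 0)"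

text \<open>Germs at 0 of arbitrary functions, with the pointwise real vector space structure.\<close>

quotient_type (overloaded) ('a, 'b) germ0 = "'a::{topological_space,zero} \<Rightarrow> 'b"
  / "\<lambda>f g. \<forall>\<^sub>F x in nhds 0. f x = g x"
  morphisms rep_germ0 germ0_of
  by (rule equivpI)
    (auto simp: reflp_def symp_def transp_def elim: eventually_mono eventually_elim2)

instantiation germ0 :: ("{topological_space,zero}", real_vector) real_vector
begin

lift_definition zero_germ0 :: "('a, 'b) germ0" is "\<lambda>_. 0" .

lift_definition plus_germ0 :: "('a, 'b) germ0 \<Rightarrow> ('a, 'b) germ0 \<Rightarrow> ('a, 'b) germ0"
  is "\<lambda>f g x. f x + g x"
  by (auto elim: eventually_elim2)

lift_definition minus_germ0 :: "('a, 'b) germ0 \<Rightarrow> ('a, 'b) germ0 \<Rightarrow> ('a, 'b) germ0"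
  is "\<lambda>f g x. f x - g x"
  by (auto elim: eventually_elim2)

lift_definition uminus_germ0 :: "('a, 'b) germ0 \<Rightarrow> ('a, 'b) germ0"
  is "\<lambda>f x. - f x"
  by (auto elim: eventually_mono)

lift_definition scaleR_germ0 :: "real \<Rightarrow> ('a, 'b) germ0 \<Rightarrow> ('a, 'b) germ0"
  is "\<lambda>c f x. c *\<^sub>R f x"
  by (auto elim: eventually_mono)

instance
  by standard (transfer; simp add: algebra_simps)+

end

definition hol0 ::
    "(complex \<times> complex \<Rightarrow> real) \<Rightarrow> (complex \<times> complex, complex \<times> complex) germ0 set"
  where "hol0 \<rho> = {germ0_of H | H.
    holomorphic2_near_0 (\<lambda>z. fst (H z)) \<and> holomorphic2_near_0 (\<lambda>z. snd (H z)) \<and>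
    H 0 = 0 \<and> tangent_near_0 H \<rho>}"

lemma holomorphic2_near_0_add:
  assumes "holomorphic2_near_0 f" "holomorphic2_near_0 g"
  shows "holomorphic2_near_0 (\<lambda>z. f z + g z)"
proof -
  obtain U where U: "open U" "0 \<in> U"
    "\<forall>z\<in>U. \<exists>a b. (f has_derivative (\<lambda>v. a * fst v + b * snd v)) (at z)"
    using assms(1) unfolding holomorphic2_near_0_def by blast
  obtain V where V: "open V" "0 \<in> V"
    "\<forall>z\<in>V. \<exists>a b. (g has_derivative (\<lambda>v. a * fst v + b * snd v)) (at z)"
    using assms(2) unfolding holomorphic2_near_0_def by blast
  have "\<exists>a b. ((\<lambda>z. f z + g z) has_derivative (\<lambda>v. a * fst v + b * snd v)) (at z)"
    if z: "z \<in> U \<inter> V" for z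
  proof -
    obtain a b where ab: "(f has_derivative (\<lambda>v. a * fst v + b * snd v)) (at z)"
      using U z by blast
    obtain c d where cd: "(g has_derivative (\<lambda>v. c * fst v + d * snd v)) (at z)"
      using V z by blast
    have "((\<lambda>z. f z + g z) has_derivative (\<lambda>v. (a + c) * fst v + (b + d) * snd v)) (at z)"
      by (rule has_derivative_eq_rhs[OF has_derivative_add[OF ab cd]]) (auto simp: algebra_simps)
    then show ?thesis by blast
  qed
  moreover have "open (U \<inter> V)" "0 \<in> U \<inter> V" using U V by auto
  ultimately show ?thesis unfolding holomorphic2_near_0_def by blast
qed

lemma holomorphic2_near_0_scaleR:
  assumes "holomorphic2_near_0 f"
  shows "holomorphic2_near_0 (\<lambda>z. c *\<^sub>R f z)"
proof -
  obtain U where U: "open U" "0 \<in> U"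
    "\<forall>z\<in>U. \<exists>a b. (f has_derivative (\<lambda>v. a * fst v + b * snd v)) (at z)"
    using assms unfolding holomorphic2_near_0_def by blast
  have "\<exists>a b. ((\<lambda>z. c *\<^sub>R f z) has_derivative (\<lambda>v. a * fst v + b * snd v)) (at z)"
    if z: "z \<in> U" for z
  proof -
    obtain a b where ab: "(f has_derivative (\<lambda>v. a * fst v + b * snd v)) (at z)"
      using U z by blast
    have "((\<lambda>z. c *\<^sub>R f z) has_derivative (\<lambda>v. (c *\<^sub>R a) * fst v + (c *\<^sub>R b) * snd v)) (at z)"
      by (rule has_derivative_eq_rhs[OF has_derivative_scaleR_right[OF ab]])
        (auto simp: algebra_simps)
    then show ?thesis by blast
  qed
  then show ?thesis using U unfolding holomorphic2_near_0_def by blast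
qed

lemma holomorphic2_near_0_cong:
  assumes "holomorphic2_near_0 f" and "\<forall>\<^sub>F z in nhds 0. f z = g z"
  shows "holomorphic2_near_0 g"
proof -
  obtain U where U: "open U" "0 \<in> U"
    "\<forall>z\<in>U. \<exists>a b. (f has_derivative (\<lambda>v. a * fst v + b * snd v)) (at z)"
    using assms(1) unfolding holomorphic2_near_0_def by blast
  obtain V where V: "open V" "0 \<in> V" "\<forall>z\<in>V. f z = g z"
    using assms(2) unfolding eventually_nhds by blast
  have "\<exists>a b. (g has_derivative (\<lambda>v. a * fst v + b * snd v)) (at z)" if z: "z \<in> U \<inter> V" for z
  proof -
    obtain a b where ab: "(f has_derivative (\<lambda>v. a * fst v + b * snd v)) (at z)"
      using U z by blast
    have "(g has_derivative (\<lambda>v. a * fst v + b * snd v)) (at z)"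
      by (rule has_derivative_transform_within_open[OF ab, of V]) (use V z in auto)
    then show ?thesis by blast
  qed
  moreover have "open (U \<inter> V)" "0 \<in> U \<inter> V" using U V by auto
  ultimately show ?thesis unfolding holomorphic2_near_0_def by blast
qed

lemma germ0_of_in_hol0_iff:
  "germ0_of H \<in> hol0 \<rho> \<longleftrightarrow>
    holomorphic2_near_0 (\<lambda>z. fst (H z)) \<and> holomorphic2_near_0 (\<lambda>z. snd (H z)) \<and>
    H 0 = 0 \<and> tangent_near_0 H \<rho>"
proof
  assume "germ0_of H \<in> hol0 \<rho>"
  then obtain K where K: "germ0_of H = germ0_of K"
    "holomorphic2_near_0 (\<lambda>z. fst (K z))" "holomorphic2_near_0 (\<lambda>z. snd (K z))"
    "K 0 = 0" "tangent_near_0 K \<rho>"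
    unfolding hol0_def by blast
  have ev: "\<forall>\<^sub>F z in nhds 0. K z = H z"
    using K(1) unfolding germ0.abs_eq_iff by (auto elim: eventually_mono)
  have "holomorphic2_near_0 (\<lambda>z. fst (H z))"
    by (rule holomorphic2_near_0_cong[OF K(2)]) (use ev in \<open>auto elim: eventually_mono\<close>)
  moreover have "holomorphic2_near_0 (\<lambda>z. snd (H z))"
    by (rule holomorphic2_near_0_cong[OF K(3)]) (use ev in \<open>auto elim: eventually_mono\<close>)
  moreover have "H 0 = 0"
    using eventually_nhds_x_imp_x[OF ev] K(4) by simp
  moreover have "tangent_near_0 H \<rho>"
    using K(5) ev unfolding tangent_near_0_def by eventually_elim auto
  ultimately show "holomorphic2_near_0 (\<lambda>z. fst (H z)) \<and> holomorphic2_near_0 (\<lambda>z. snd (H z)) \<and>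
    H 0 = 0 \<and> tangent_near_0 H \<rho>" by blast
qed (auto simp: hol0_def)

lemma subspace_hol0: "subspace (hol0 \<rho>)"
proof (rule subspaceI)
  have "holomorphic2_near_0 (\<lambda>z. 0)"
    unfolding holomorphic2_near_0_def
    by (rule exI[of _ UNIV]) (auto intro!: exI[of _ 0])
  then show "0 \<in> hol0 \<rho>"
    by (simp add: zero_germ0_def germ0_of_in_hol0_iff tangent_near_0_def)
next
  fix x y assume xy: "x \<in> hol0 \<rho>" "y \<in> hol0 \<rho>"
  obtain H K where HK: "x = germ0_of H" "y = germ0_of K"
    using xy unfolding hol0_def by blast
  have "tangent_near_0 (\<lambda>z. H z + K z) \<rho>" if "tangent_near_0 H \<rho>" "tangent_near_0 K \<rho>"
    using that unfolding tangent_near_0_def by eventually_elim (simp add: algebra_simps)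
  then show "x + y \<in> hol0 \<rho>"
    using xy unfolding HK plus_germ0.abs_eq germ0_of_in_hol0_iff
    by (auto intro: holomorphic2_near_0_add)
next
  fix c x assume x: "x \<in> hol0 \<rho>"
  obtain H where H: "x = germ0_of H"
    using x unfolding hol0_def by blast
  have "tangent_near_0 (\<lambda>z. c *\<^sub>R H z) \<rho>" if "tangent_near_0 H \<rho>"
    using that unfolding tangent_near_0_def
  proof eventually_elim
    case (elim z)
    have "Re (c *\<^sub>R (fst (H z) * wirtinger1 \<rho> z + snd (H z) * wirtinger2 \<rho> z)) = 0"
      if "\<rho> z = 0" using elim that by simp
    then show ?case by (simp add: scaleR_add_right)
  qed
  then show "c *\<^sub>R x \<in> hol0 \<rho>"
    using x unfolding H scaleR_germ0.abs_eq germ0_of_in_hol0_iff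
    by (auto intro: holomorphic2_near_0_scaleR)
qed

end

theory Submission
  imports Defs "HOL-Complex_Analysis.Complex_Analysis"
begin

text \<open>
  Let \<open>H = (h1, h2)\<close> be a holomorphic vector field that vanishes at 0 and is tangent to the
  hypersurface. It suffices to show that the derivative \<open>d(H)\<close> of \<open>h2(0, z2)\<close> at 0 is imaginary, and
  that \<open>d(H) = 0\<close> forces \<open>H = 0\<close> (\<open>tangential_rigidity\<close>): then \<open>d\<close> is an injective real linear map
  into a real line.

  The tangency condition is restricted to the curves \<open>Im z1 = \<alpha> P(z)\<close>, \<open>z2 = z\<close> with a real
  parameter \<open>\<alpha>\<close>, where \<open>z1\<close> is \<open>P(z) (\<i> \<alpha> - 1)\<close> to first order. Write \<open>h1 = z1^j (a z2^k + ...)\<close> and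
  \<open>h2 = z1^m (b z2^n + ...)\<close> with nonzero \<open>a\<close> and \<open>b\<close>, where the dots are higher order terms in \<open>z2\<close>
  and multiples of \<open>z1\<close>. As \<open>P\<close> and \<open>P'\<close> are flat, the condition for \<open>\<zeta> = \<i> \<alpha> - 1\<close> is asymptotically
  \<open>Re (P^j z^k a \<zeta>^j + 2 (P' + O(P)) P^m z^n b \<zeta>^m) = 0\<close> for every real \<open>\<alpha>\<close>.

  At \<open>\<alpha> = 0\<close> this gives \<open>j \<ge> 1\<close> (\<open>leading_relation_order_zero\<close>). Suppose \<open>m \<ge> 1\<close>. On a ray, flatness
  provides points tending to 0 at which the logarithmic radial derivative of \<open>P\<close> tends to infinity.
  A limit of the normalized relation at such points makes the real part of a polynomial in \<open>\<zeta>\<close> with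
  at most two terms vanish on the line \<open>Re \<zeta> = - 1\<close>. This leaves only the case where \<open>j = m + 1\<close> and
  \<open>k < n\<close>, and then it prescribes the limit of the quotient of the two terms, hence a bounded or
  negative radial derivative when the ray is chosen suitably (\<open>no_transversal_order\<close>). If one of the
  components is identically zero, only one term is left, and the same argument shows that \<open>H = 0\<close> if
  \<open>h2 = 0\<close>, and that \<open>m = 0\<close> if \<open>h1 = 0\<close> and \<open>h2\<close> is not zero.

  So \<open>m = 0\<close>. Let \<open>B(z) = h2(0, z)\<close>, which has a zero of order \<open>n \<ge> 1\<close>, and exclude that \<open>n \<ge> 2\<close> or
  \<open>Re b \<noteq> 0\<close> (\<open>order_zero_component\<close>). At \<open>\<alpha> = 0\<close> the condition is an equation for the derivative of
  \<open>ln P\<close> along \<open>B\<close>. The field \<open>B\<close> or \<open>- B\<close> has an orbit that tends to 0. If \<open>j \<ge> 2\<close> or \<open>k \<ge> n - 1\<close>,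
  then \<open>ln P\<close> changes along it at most in proportion to \<open>ln |z|\<close>, against the flatness of \<open>P\<close>. If
  \<open>j = 1\<close>, \<open>k = 0\<close> and \<open>a\<close> is real, then \<open>P\<close> increases along an orbit of \<open>B\<close> or \<open>- B\<close> that tends to
  0. In the remaining cases \<open>j = 1\<close> and \<open>k < n - 1\<close>, and there is a direction in which \<open>b z^(n-1)\<close>
  is real and \<open>a z^k\<close> is not; two values of \<open>\<alpha>\<close> show that near it \<open>B P'\<close> is nearly imaginary and of
  constant sign. The radial derivative of \<open>P\<close> is then negative on one side of that direction
  (\<open>sector_contradiction\<close>).
\<close>

section \<open>Powers on a vertical line and directions in the plane\<close>

text \<open>A polynomial with vanishing real part on the imaginary axis satisfies
  \<open>p(x) + cnj (p (- cnj x)) = 0\<close> for all \<open>x\<close>. Evaluating this at \<open>x = 1\<close> separates the coefficients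
  in the next two lemmas.\<close>

lemma power_line_reflection:
  fixes A B :: complex and j m :: nat
  assumes "\<And>\<alpha>::real. Re (A * (\<i> * of_real \<alpha> - 1) ^ j + B * (\<i> * of_real \<alpha> - 1) ^ m) = 0"
  shows "A * (x - 1) ^ j + B * (x - 1) ^ m + (cnj A * (- 1 - x) ^ j + cnj B * (- 1 - x) ^ m) = 0"
proof -
  define q where "q = smult A ([:-1, 1:] ^ j) + smult B ([:-1, 1:] ^ m)
    + (smult (cnj A) ([:-1, -1:] ^ j) + smult (cnj B) ([:-1, -1:] ^ m))"
  have q: "poly q x = A * (x - 1) ^ j + B * (x - 1) ^ m
      + (cnj A * (- 1 - x) ^ j + cnj B * (- 1 - x) ^ m)" for x
    by (simp add: q_def poly_power)
  have "poly q (\<i> * of_real \<alpha>) = 0" for \<alpha> :: real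
  proof -
    define w where "w = A * (\<i> * of_real \<alpha> - 1) ^ j + B * (\<i> * of_real \<alpha> - 1) ^ m"
    have "cnj (\<i> * of_real \<alpha> - 1) = - 1 - \<i> * of_real \<alpha>" by simp
    then have "poly q (\<i> * of_real \<alpha>) = w + cnj w"
      unfolding q w_def complex_cnj_add complex_cnj_mult complex_cnj_power by (rule ssubst) (rule refl)
    also have "\<dots> = 0" using assms[of \<alpha>, folded w_def] by (simp only: complex_add_cnj) simp
    finally show ?thesis .
  qed
  then have "range (\<lambda>\<alpha>::real. \<i> * of_real \<alpha>) \<subseteq> {x. poly q x = 0}" by auto
  moreover have "infinite (range (\<lambda>\<alpha>::real. \<i> * of_real \<alpha> :: complex))"
    using finite_imageD[of "\<lambda>\<alpha>::real. \<i> * of_real \<alpha> :: complex" UNIV] infinite_UNIV_char_0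
    by (auto simp: inj_def)
  ultimately have "q = 0"
    using poly_roots_finite finite_subset by blast
  then show ?thesis using q[of x] by simp
qed

lemma power_line_single:
  fixes A :: complex and j :: nat
  assumes "\<And>\<alpha>::real. Re (A * (\<i> * of_real \<alpha> - 1) ^ j) = 0" and "1 \<le> j"
  shows "A = 0"
  using power_line_reflection[of A j 0 j 1] assms by (simp add: power_0_left)

lemma power_line_pair:
  fixes A B :: complex and m :: nat
  assumes "\<And>\<alpha>::real. Re (A * (\<i> * of_real \<alpha> - 1) ^ Suc m + B * (\<i> * of_real \<alpha> - 1) ^ m) = 0"
    and "1 \<le> m"
  shows "B = 2 * A"
proof -
  have "cnj A * (-2) ^ Suc m + cnj B * (-2) ^ m = 0"
    using power_line_reflection[OF assms(1), of 1] assms(2) by (simp add: power_0_left)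
  then have "(cnj B - 2 * cnj A) * (-2) ^ m = 0" by (simp add: algebra_simps)
  then have "cnj (B - 2 * A) = 0" by simp
  then show ?thesis by (simp del: complex_cnj_diff)
qed

lemma unit_direction:
  fixes w :: complex and N :: nat
  assumes "w \<noteq> 0" "0 < N"
  obtains \<theta> :: complex where "norm \<theta> = 1" "w * \<theta> ^ N = of_real (norm w)"
proof -
  obtain \<theta> where \<theta>: "\<theta> ^ N = of_real (norm w) / w"
    using assms(2) by (metis exists_complex_root gr_implies_not0)
  have "norm \<theta> ^ N = 1 ^ N"
    using arg_cong[OF \<theta>, of norm] assms by (simp add: norm_power norm_divide)
  then have "norm \<theta> = 1" using assms(2) power_eq_imp_eq_base[of "norm \<theta>" N 1] by simp
  then show ?thesis using that[of \<theta>] \<theta> assms by simp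
qed

text \<open>The directions in which \<open>b z^N\<close> is real are spaced by the angle \<open>pi / N\<close>, and two neighbouring
  ones cannot both make \<open>a z^k\<close> real when \<open>0 < k < N\<close>.\<close>

lemma nonreal_direction:
  fixes a b :: complex
  assumes "a \<noteq> 0" "b \<noteq> 0" "k < N" "k = 0 \<Longrightarrow> Im a \<noteq> 0"
  obtains \<theta> where "norm \<theta> = 1" "b * \<theta> ^ N \<in> \<real>" "Im (a * \<theta> ^ k) \<noteq> 0"
proof -
  have N: "0 < N" using assms by simp
  obtain \<theta> where \<theta>: "norm \<theta> = 1" "b * \<theta> ^ N = of_real (norm b)"
    by (rule unit_direction[OF assms(2) N])
  show ?thesis
  proof (cases "Im (a * \<theta> ^ k) = 0")
    case False
    then show ?thesis using that[of \<theta>] \<theta> by auto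
  next
    case True
    then have k: "0 < k" using assms(4) by (cases k) auto
    define c where "c = Re (a * \<theta> ^ k)"
    have ac: "a * \<theta> ^ k = of_real c" using True by (simp add: complex_eq_iff c_def)
    have "\<theta> \<noteq> 0" using \<theta>(1) by auto
    then have c: "c \<noteq> 0" using ac assms(1) by auto
    define \<theta>' where "\<theta>' = \<theta> * cis (pi / real N)"
    have "cis (pi / real N) ^ N = cis pi" using N unfolding Complex.DeMoivre by simp
    then have "b * \<theta>' ^ N = of_real (norm b) * cis pi"
      unfolding \<theta>'_def power_mult_distrib mult.assoc[symmetric] \<theta>(2) by simp
    then have 1: "b * \<theta>' ^ N \<in> \<real>" by simp
    have "a * \<theta>' ^ k = of_real c * cis (real k * (pi / real N))"
      unfolding \<theta>'_def power_mult_distrib mult.assoc[symmetric] ac Complex.DeMoivre ..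
    then have 2: "Im (a * \<theta>' ^ k) = c * sin (real k * (pi / real N))" by simp
    have "0 < real k * (pi / real N)" using k N by simp
    moreover have "real k * (pi / real N) < pi" using assms(3) N by (simp add: field_simps)
    ultimately have "0 < sin (real k * (pi / real N))" by (rule sin_gt_zero)
    then have "Im (a * \<theta>' ^ k) \<noteq> 0" using 2 c by simp
    moreover have "norm \<theta>' = 1" using \<theta>(1) by (simp add: \<theta>'_def norm_mult)
    ultimately show ?thesis using that[of \<theta>'] 1 by blast
  qed
qed

lemma sgn_ray:
  fixes \<theta> :: complex
  assumes "0 < \<rho>" "norm \<theta> = 1"
  shows "sgn (of_real \<rho> * \<theta>) = \<theta>"
  using assms by (simp add: sgn_eq norm_mult)

lemma ray_filterlim:
  fixes \<theta> :: complex
  assumes "norm \<theta> = 1"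
  shows "filterlim (\<lambda>\<rho>. of_real \<rho> * \<theta>) (at 0) (at_right 0)"
proof (rule filterlim_atI)
  have "((\<lambda>\<rho>. of_real \<rho> * \<theta>) \<longlongrightarrow> of_real 0 * \<theta>) (at_right 0)" by (intro tendsto_intros)
  then show "((\<lambda>\<rho>. of_real \<rho> * \<theta>) \<longlongrightarrow> 0) (at_right 0)" by simp
  show "\<forall>\<^sub>F \<rho> in at_right 0. of_real \<rho> * \<theta> \<noteq> 0"
    using assms by (auto simp: eventually_at_right_field intro!: exI[of _ 1])
qed

section \<open>Orbits of holomorphic vector fields tending to a zero\<close>

text \<open>An ODE \<open>s' = V(s)\<close> on a right half plane, with \<open>V\<close> holomorphic and close to a constant \<open>v\<close> of
  positive real part, has a global forward solution that stays near the solution \<open>s0 + t v\<close> for the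
  constant field. The time function, a primitive \<open>F\<close> of \<open>v / V\<close>, is injective, and the orbit is the
  preimage of \<open>s0 + t v\<close>.\<close>

lemma half_plane_flow:
  fixes V :: "complex \<Rightarrow> complex" and v s0 :: complex and R \<kappa> \<epsilon> :: real
  assumes holV: "V holomorphic_on {s. R < Re s}"
    and V0: "\<And>s. R < Re s \<Longrightarrow> V s \<noteq> 0"
    and Vv: "\<And>s. R < Re s \<Longrightarrow> norm (v / V s - 1) \<le> \<epsilon>"
    and \<kappa>: "0 < \<kappa>" "\<kappa> < Re v" and \<epsilon>: "\<epsilon> < 1" "\<epsilon> * (norm v + \<kappa>) \<le> \<kappa>"
    and s0: "R < Re s0"
  obtains s :: "real \<Rightarrow> complex"
  where "\<And>t. 0 \<le> t \<Longrightarrow> (s has_vector_derivative V (s t)) (at t)"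
    and "\<And>t. 0 \<le> t \<Longrightarrow> norm (s t - (s0 + of_real t * v)) \<le> \<kappa> * t"
proof -
  define S where "S = {s. R < Re s}"
  have S: "open S" "convex S"
    unfolding S_def by (auto simp: open_halfspace_Re_gt convex_halfspace_Re_gt)
  have "0 \<le> norm (v / V s0 - 1)" by simp
  also have "\<dots> \<le> \<epsilon>" by (rule Vv[OF s0])
  finally have \<epsilon>0: "0 \<le> \<epsilon>" .
  have v0: "v \<noteq> 0" using \<kappa> by auto
  have "(\<lambda>s. v / V s) holomorphic_on S"
    using holV V0 by (auto intro!: holomorphic_intros simp: S_def)
  then obtain G where G: "\<And>x. x \<in> S \<Longrightarrow> (G has_field_derivative v / V x) (at x within S)"
    using holomorphic_convex_primitive'[OF S(2,1)] by blast
  define F where "F s = G s - G s0 + s0" for s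
  have F0: "F s0 = s0" by (simp add: F_def)
  have F': "(F has_field_derivative v / V x) (at x)" if "x \<in> S" for x
  proof -
    have "(G has_field_derivative v / V x) (at x)"
      using G[OF that] by (simp add: at_within_open[OF that S(1)])
    then show ?thesis unfolding F_def by (auto intro!: derivative_eq_intros)
  qed
  have contr: "norm ((F x - x) - (F y - y)) \<le> \<epsilon> * norm (x - y)" if "x \<in> S" "y \<in> S" for x y
  proof (rule field_differentiable_bound[OF S(2) _ _ that(1,2)])
    show "((\<lambda>x. F x - x) has_field_derivative v / V z - 1) (at z within S)" if "z \<in> S" for z
      by (intro derivative_intros has_field_derivative_at_within[OF F'[OF that]])
    show "norm (v / V z - 1) \<le> \<epsilon>" if "z \<in> S" for z
      using Vv that by (auto simp: S_def)
  qed
  have inj: "inj_on F S"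
  proof (rule inj_onI)
    fix x y assume xy: "x \<in> S" "y \<in> S" "F x = F y"
    have "norm (x - y) \<le> \<epsilon> * norm (x - y)"
      using contr[OF xy(1,2)] xy(3) by (simp add: norm_minus_commute)
    then have "(1 - \<epsilon>) * norm (x - y) \<le> 0" by (simp add: algebra_simps)
    then show "x = y" using \<epsilon>(1) by (simp add: mult_le_0_iff)
  qed
  have holF: "F holomorphic_on S"
    using F' S(1) by (auto simp: holomorphic_on_open)
  obtain g where g: "g holomorphic_on (F ` S)"
      "\<And>z. z \<in> S \<Longrightarrow> deriv F z * deriv g (F z) = 1" "\<And>z. z \<in> S \<Longrightarrow> g (F z) = z"
    using holomorphic_has_inverse[OF holF S(1) inj] by blast
  have openFS: "open (F ` S)"
    by (rule open_mapping_thm3[OF holF S(1) inj])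
  \<comment> \<open>the equation F s = s0 + t v is solved by contraction on a disc around s0 + t v\<close>
  have surj: "\<exists>x\<in>S. F x = s0 + of_real t * v \<and> norm (x - (s0 + of_real t * v)) \<le> \<kappa> * t"
    if t: "0 \<le> t" for t
  proof -
    define u where "u = s0 + of_real t * v"
    have sub: "cball u (\<kappa> * t) \<subseteq> S"
    proof
      fix x assume "x \<in> cball u (\<kappa> * t)"
      then have "norm (u - x) \<le> \<kappa> * t" by (simp add: dist_norm)
      then have "Re (u - x) \<le> \<kappa> * t" using complex_Re_le_cmod order_trans by blast
      moreover have "\<kappa> * t \<le> Re v * t" using \<kappa> t by (intro mult_right_mono) auto
      ultimately show "x \<in> S" using s0 by (simp add: S_def u_def mult.commute)
    qed
    have "\<exists>!x\<in>cball u (\<kappa> * t). u - (F x - x) = x"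
    proof (rule Banach_fix[OF _ _ \<epsilon>0 \<epsilon>(1)])
      show "complete (cball u (\<kappa> * t))" by (simp add: complete_eq_closed)
      show "cball u (\<kappa> * t) \<noteq> {}" using \<kappa> t by (simp add: not_less)
      show "(\<lambda>x. u - (F x - x)) ` cball u (\<kappa> * t) \<subseteq> cball u (\<kappa> * t)"
      proof safe
        fix x assume x: "x \<in> cball u (\<kappa> * t)"
        have "norm (F x - x) \<le> \<epsilon> * norm (x - s0)"
          using contr[OF subsetD[OF sub x], of s0] s0 by (simp add: F0 S_def)
        also have "\<dots> \<le> \<epsilon> * (\<kappa> * t + t * norm v)"
        proof (rule mult_left_mono[OF _ \<epsilon>0])
          have "norm (x - s0) \<le> norm (x - u) + norm (u - s0)"
            using norm_triangle_ineq[of "x - u" "u - s0"] by simp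
          moreover have "norm (x - u) \<le> \<kappa> * t"
            using x by (simp add: dist_norm norm_minus_commute)
          moreover have "norm (u - s0) = t * norm v"
            using t by (simp add: u_def norm_mult)
          ultimately show "norm (x - s0) \<le> \<kappa> * t + t * norm v" by linarith
        qed
        also have "\<dots> = (\<epsilon> * (norm v + \<kappa>)) * t" by (simp add: algebra_simps)
        also have "\<dots> \<le> \<kappa> * t" using \<epsilon>(2) t by (rule mult_right_mono)
        finally show "u - (F x - x) \<in> cball u (\<kappa> * t)" by (simp add: dist_norm)
      qed
      show "dist (u - (F x - x)) (u - (F y - y)) \<le> \<epsilon> * dist x y"
        if "x \<in> cball u (\<kappa> * t)" "y \<in> cball u (\<kappa> * t)" for x y
      proof -
        have "dist (u - (F x - x)) (u - (F y - y)) = norm ((F y - y) - (F x - x))"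
          by (simp add: dist_norm algebra_simps)
        then show ?thesis
          using contr[OF subsetD[OF sub that(2)] subsetD[OF sub that(1)]]
          by (simp add: dist_norm norm_minus_commute)
      qed
    qed
    then obtain x where x: "x \<in> cball u (\<kappa> * t)" "u - (F x - x) = x" by blast
    then have "F x = u" by (simp add: algebra_simps)
    then show ?thesis
      using x(1) sub unfolding u_def by (auto simp: dist_norm norm_minus_commute intro!: bexI[of _ x])
  qed
  define s where "s t = g (s0 + of_real t * v)" for t :: real
  have s_props: "s t \<in> S" "F (s t) = s0 + of_real t * v"
      "norm (s t - (s0 + of_real t * v)) \<le> \<kappa> * t" if t: "0 \<le> t" for t
  proof -
    obtain x where "x \<in> S" "F x = s0 + of_real t * v" "norm (x - (s0 + of_real t * v)) \<le> \<kappa> * t"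
      using surj[OF t] by blast
    then show "s t \<in> S" "F (s t) = s0 + of_real t * v"
      "norm (s t - (s0 + of_real t * v)) \<le> \<kappa> * t"
      unfolding s_def using g(3)[of x] by auto
  qed
  have "(s has_vector_derivative V (s t)) (at t)" if t: "0 \<le> t" for t
  proof -
    note st = s_props[OF t]
    have dF: "deriv F (s t) = v / V (s t)"
      by (rule DERIV_imp_deriv[OF F'[OF st(1)]])
    have "deriv g (s0 + of_real t * v) = V (s t) / v"
      using g(2)[OF st(1)] st V0[of "s t"] v0 unfolding dF by (simp add: S_def field_simps)
    moreover have "s0 + of_real t * v \<in> F ` S" using st by (metis imageI)
    ultimately have "(g has_field_derivative V (s t) / v) (at (s0 + of_real t * v))"
      using holomorphic_derivI[OF g(1) openFS] by metis
    moreover have "((\<lambda>t. s0 + of_real t * v) has_vector_derivative v) (at t)"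
      by (auto intro!: derivative_eq_intros simp: has_vector_derivative_def scaleR_conv_of_real)
    ultimately have "(g \<circ> (\<lambda>t. s0 + of_real t * v) has_vector_derivative v * (V (s t) / v)) (at t)"
      by (intro field_vector_diff_chain_at)
    then show ?thesis using v0 by (simp add: s_def[abs_def] o_def)
  qed
  then show ?thesis using that s_props(3) by blast
qed


text \<open>If \<open>\<psi>\<close> solves the model equation \<open>\<psi>' = \<mu> \<psi>^n\<close> in complex time and tends to 0 as the real part
  of the time grows, then orbits of \<open>z' = z^n \<beta>(z)\<close> are obtained by the time change
  \<open>s' = \<beta>(\<psi>(s)) / \<mu>\<close>.\<close>

lemma orbit_from_model:
  fixes \<beta> \<psi> :: "complex \<Rightarrow> complex" and \<mu> :: complex and \<delta> \<kappa> \<eta> :: real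
  assumes hol: "\<beta> holomorphic_on ball 0 \<delta>" and \<delta>: "0 < \<delta>" and \<beta>0: "\<beta> 0 \<noteq> 0"
    and model: "\<And>\<eta>. 0 < \<eta> \<Longrightarrow> \<exists>R. \<forall>s. R < Re s \<longrightarrow> \<psi> s \<noteq> 0 \<and> norm (\<psi> s) < \<eta> \<and>
      (\<psi> has_field_derivative \<mu> * \<psi> s ^ n) (at s)"
    and \<mu>: "\<mu> \<noteq> 0" and \<kappa>: "0 < \<kappa>" "\<kappa> < Re (\<beta> 0 / \<mu>)" and \<eta>: "0 < \<eta>"
  obtains s :: "real \<Rightarrow> complex" and s0 :: real
  where "0 < s0"
    and "\<And>t. 0 \<le> t \<Longrightarrow> norm (s t - (of_real s0 + of_real t * (\<beta> 0 / \<mu>))) \<le> \<kappa> * t"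
    and "\<And>t. 0 \<le> t \<Longrightarrow>
      ((\<lambda>t. \<psi> (s t)) has_vector_derivative \<psi> (s t) ^ n * \<beta> (\<psi> (s t))) (at t)"
    and "\<And>t. 0 \<le> t \<Longrightarrow> \<psi> (s t) \<noteq> 0 \<and> norm (\<psi> (s t)) < \<delta> \<and> norm (\<beta> (\<psi> (s t)) - \<beta> 0) < \<eta>"
proof -
  define v where "v = \<beta> 0 / \<mu>"
  define \<epsilon> where "\<epsilon> = \<kappa> / (norm v + \<kappa>)"
  have v0: "0 < Re v" using \<kappa> by (simp add: v_def)
  then have nv: "0 < norm v" by (simp add: v_def \<mu> \<beta>0)
  have \<epsilon>: "0 < \<epsilon>" "\<epsilon> < 1" "\<epsilon> * (norm v + \<kappa>) \<le> \<kappa>"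
    using \<kappa>(1) add_pos_pos[OF nv \<kappa>(1)] nv unfolding \<epsilon>_def
    by (simp_all del: zero_less_norm_iff)
  have cont: "isCont \<beta> 0"
    using holomorphic_on_imp_continuous_on[OF hol] \<delta> continuous_on_eq_continuous_at[OF open_ball]
    by (metis centre_in_ball)
  then have lim: "(\<beta> \<longlongrightarrow> \<beta> 0) (nhds 0)" by (simp add: continuous_at tendsto_at_iff_tendsto_nhds)
  have "((\<lambda>z. \<beta> 0 / \<beta> z - 1) \<longlongrightarrow> \<beta> 0 / \<beta> 0 - 1) (nhds 0)"
    by (intro tendsto_intros lim \<beta>0)
  then have "\<forall>\<^sub>F z in nhds 0. norm (\<beta> 0 / \<beta> z - 1) < \<epsilon>"
    using \<epsilon>(1) \<beta>0 by (auto dest!: tendstoD simp: dist_norm)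
  moreover have "\<forall>\<^sub>F z in nhds 0. norm (\<beta> z - \<beta> 0) < \<eta>"
    using tendstoD[OF lim \<eta>] by (simp add: dist_norm)
  moreover have "\<forall>\<^sub>F z in nhds 0. \<beta> z \<noteq> 0"
    by (rule tendsto_imp_eventually_ne[OF lim \<beta>0])
  moreover have "\<forall>\<^sub>F z in nhds 0. norm z < \<delta>"
    using eventually_nhds_ball[OF \<delta>, of 0] by (auto simp: elim: eventually_mono)
  ultimately have "\<forall>\<^sub>F z in nhds 0. norm (\<beta> 0 / \<beta> z - 1) < \<epsilon> \<and> norm (\<beta> z - \<beta> 0) < \<eta> \<and> \<beta> z \<noteq> 0 \<and> norm z < \<delta>"
    by eventually_elim auto
  then obtain \<eta>' where \<eta>': "0 < \<eta>'" "\<And>z. norm z < \<eta>' \<Longrightarrow> norm (\<beta> 0 / \<beta> z - 1) < \<epsilon> \<and>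
      norm (\<beta> z - \<beta> 0) < \<eta> \<and> \<beta> z \<noteq> 0 \<and> norm z < \<delta>"
    by (auto simp: eventually_nhds_metric dist_norm)
  obtain R where R: "\<And>s. R < Re s \<Longrightarrow> \<psi> s \<noteq> 0 \<and> norm (\<psi> s) < \<eta>' \<and>
      (\<psi> has_field_derivative \<mu> * \<psi> s ^ n) (at s)"
    using model[OF \<eta>'(1)] by blast
  define V where "V s = \<beta> (\<psi> s) / \<mu>" for s
  define s0 where "s0 = max R 0 + 1"
  have hol\<psi>: "\<psi> holomorphic_on {s. R < Re s}"
    using R by (subst holomorphic_on_open) (auto simp: open_halfspace_Re_gt)
  have "(\<beta> \<circ> \<psi>) holomorphic_on {s. R < Re s}"
    by (rule holomorphic_on_compose_gen[OF hol\<psi> hol]) (use R \<eta>' in auto)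
  then have holV: "V holomorphic_on {s. R < Re s}"
    unfolding V_def o_def by (intro holomorphic_intros) (use \<mu> in auto)
  have quot: "v / V s = \<beta> 0 / \<beta> (\<psi> s)" if "R < Re s" for s
    using \<mu> R[OF that] \<eta>'(2) by (simp add: v_def V_def)
  obtain s where s: "\<And>t. 0 \<le> t \<Longrightarrow> (s has_vector_derivative V (s t)) (at t)"
      "\<And>t. 0 \<le> t \<Longrightarrow> norm (s t - (of_real s0 + of_real t * v)) \<le> \<kappa> * t"
  proof (rule half_plane_flow[OF holV _ _ \<kappa>(1) _ \<epsilon>(2,3)])
    show "V s \<noteq> 0" if "R < Re s" for s
      using R[OF that] \<eta>'(2) \<mu> by (simp add: V_def)
    show "norm (v / V s - 1) \<le> \<epsilon>" if "R < Re s" for s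
      using R[OF that] \<eta>'(2) quot[OF that] by (simp add: less_imp_le)
    show "\<kappa> < Re v" using \<kappa> by (simp add: v_def)
    show "R < Re (of_real s0)" by (simp add: s0_def)
  qed blast
  have Rs: "R < Re (s t)" if t: "0 \<le> t" for t
  proof -
    have "\<bar>Re (s t - (of_real s0 + of_real t * v))\<bar> \<le> \<kappa> * t"
      using s(2)[OF t] abs_Re_le_cmod order_trans by blast
    moreover have "\<kappa> * t \<le> Re v * t"
      using \<kappa> t by (intro mult_right_mono) (auto simp: v_def)
    ultimately have "s0 \<le> Re (s t)" by (simp add: mult.commute)
    then show ?thesis by (simp add: s0_def)
  qed
  show ?thesis
  proof (rule that)
    show "0 < s0" by (simp add: s0_def)
    show "norm (s t - (of_real s0 + of_real t * (\<beta> 0 / \<mu>))) \<le> \<kappa> * t" if "0 \<le> t" for t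
      using s(2)[OF that] by (simp add: v_def)
    show "((\<lambda>t. \<psi> (s t)) has_vector_derivative \<psi> (s t) ^ n * \<beta> (\<psi> (s t))) (at t)" if "0 \<le> t" for t
      using field_vector_diff_chain_at[OF s(1)[OF that], of \<psi> "\<mu> * \<psi> (s t) ^ n"] R[OF Rs[OF that]] \<mu>
      by (simp add: o_def V_def mult_ac)
    show "\<psi> (s t) \<noteq> 0 \<and> norm (\<psi> (s t)) < \<delta> \<and> norm (\<beta> (\<psi> (s t)) - \<beta> 0) < \<eta>" if "0 \<le> t" for t
      using R[OF Rs[OF that]] \<eta>'(2) by simp
  qed
qed

text \<open>An orbit of \<open>z' = z^n \<beta>(z)\<close> that converges to 0 with a definite rate of decay of its modulus:
  the last conclusion bounds the derivative of \<open>ln |\<gamma>|\<close>. For \<open>n = 1\<close> the model solution is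
  \<open>exp (- s)\<close>, for \<open>n > 1\<close> it is a multiple of \<open>s^(- 1 / (n - 1))\<close>.\<close>

lemma attracting_orbit:
  fixes \<beta> :: "complex \<Rightarrow> complex" and n :: nat and \<delta> :: real
  assumes hol: "\<beta> holomorphic_on ball 0 \<delta>" and \<delta>: "0 < \<delta>" and \<beta>0: "\<beta> 0 \<noteq> 0"
    and n: "1 \<le> n" and n1: "n = 1 \<Longrightarrow> Re (\<beta> 0) < 0"
  obtains \<gamma> :: "real \<Rightarrow> complex" and c :: real
  where "0 < c"
    and "\<And>t. 0 \<le> t \<Longrightarrow> (\<gamma> has_vector_derivative \<gamma> t ^ n * \<beta> (\<gamma> t)) (at t)"
    and "\<And>t. 0 \<le> t \<Longrightarrow> \<gamma> t \<noteq> 0 \<and> norm (\<gamma> t) < \<delta>"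
    and "(\<gamma> \<longlongrightarrow> 0) at_top"
    and "\<And>t. 0 \<le> t \<Longrightarrow> Re (\<gamma> t ^ (n - 1) * \<beta> (\<gamma> t)) \<le> - c * norm (\<gamma> t) ^ (n - 1)"
proof (cases "n = 1")
  case True
  define r where "r = - Re (\<beta> 0)"
  have r: "0 < r" using n1 True by (simp add: r_def)
  define \<psi> :: "complex \<Rightarrow> complex" where "\<psi> s = exp (- s)" for s
  obtain s s0 where s: "0 < s0"
    "\<And>t. 0 \<le> t \<Longrightarrow> norm (s t - (of_real s0 + of_real t * (\<beta> 0 / (-1)))) \<le> r/2 * t"
    "\<And>t. 0 \<le> t \<Longrightarrow>
      ((\<lambda>t. \<psi> (s t)) has_vector_derivative \<psi> (s t) ^ n * \<beta> (\<psi> (s t))) (at t)"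
    "\<And>t. 0 \<le> t \<Longrightarrow> \<psi> (s t) \<noteq> 0 \<and> norm (\<psi> (s t)) < \<delta> \<and> norm (\<beta> (\<psi> (s t)) - \<beta> 0) < r/2"
  proof (rule orbit_from_model[OF hol \<delta> \<beta>0, of \<psi> "-1" n "r/2" "r/2"])
    fix \<eta> :: real assume \<eta>: "0 < \<eta>"
    have "\<psi> s \<noteq> 0 \<and> norm (\<psi> s) < \<eta> \<and> (\<psi> has_field_derivative - 1 * \<psi> s ^ n) (at s)"
      if "- ln \<eta> < Re s" for s
    proof -
      have "exp (- Re s) < exp (ln \<eta>)" using that by (subst exp_less_cancel_iff) simp
      then show ?thesis using True \<eta> unfolding \<psi>_def
        by (auto intro!: derivative_eq_intros)
    qed
    then show "\<exists>R. \<forall>s. R < Re s \<longrightarrow> \<psi> s \<noteq> 0 \<and> norm (\<psi> s) < \<eta> \<and> (\<psi> has_field_derivative - 1 * \<psi> s ^ n) (at s)"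
      by blast
  qed (use r in \<open>auto simp: r_def\<close>)
  have lower: "r/2 * t \<le> Re (s t)" if t: "0 \<le> t" for t
  proof -
    have "\<bar>Re (s t - (of_real s0 + of_real t * (\<beta> 0 / (-1))))\<bar> \<le> r/2 * t"
      using s(2)[OF t] abs_Re_le_cmod order_trans by blast
    then have "\<bar>Re (s t) - (s0 + r * t)\<bar> \<le> r/2 * t" by (simp add: r_def mult.commute)
    then show ?thesis using s(1) by linarith
  qed
  show ?thesis
  proof (rule that[of "r/2" "\<lambda>t. \<psi> (s t)"])
    show "((\<lambda>t. \<psi> (s t)) \<longlongrightarrow> 0) at_top"
    proof (rule Lim_null_comparison)
      have "norm (\<psi> (s t)) \<le> exp (- (r/2 * t))" if "0 \<le> t" for t
        using lower[OF that] by (simp add: \<psi>_def)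
      then show "\<forall>\<^sub>F t in at_top. norm (\<psi> (s t)) \<le> exp (- (r/2 * t))"
        by (rule eventually_mono[OF eventually_ge_at_top[of 0]])
      have "LIM t at_top. r/2 * t :> at_top"
        by (rule filterlim_tendsto_pos_mult_at_top[OF tendsto_const]) (use r in \<open>auto simp: filterlim_ident\<close>)
      then show "((\<lambda>t. exp (- (r/2 * t))) \<longlongrightarrow> 0) at_top"
        by (intro filterlim_compose[OF exp_at_bot] filterlim_compose[OF filterlim_uminus_at_bot_at_top])
    qed
    show "Re (\<psi> (s t) ^ (n - 1) * \<beta> (\<psi> (s t))) \<le> - (r/2) * norm (\<psi> (s t)) ^ (n - 1)" if "0 \<le> t" for t
    proof -
      have "Re (\<beta> (\<psi> (s t)) - \<beta> 0) < r/2"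
        using s(4)[OF that] complex_Re_le_cmod[of "\<beta> (\<psi> (s t)) - \<beta> 0"] by linarith
      then show ?thesis using True by (simp add: r_def)
    qed
  qed (use s r in auto)
next
  case False
  define N where "N = n - 1"
  have N: "0 < N" "n = Suc N" using n False by (auto simp: N_def)
  define b where "b = \<beta> 0"
  have b: "b \<noteq> 0" using \<beta>0 by (simp add: b_def)
  obtain c where c: "c ^ N = - 1 / (of_nat N * b)"
    using N by (metis exists_complex_root gr_implies_not0)
  have c0: "c \<noteq> 0" using c b N by (auto simp: power_0_left)
  \<comment> \<open>the model flow z' = b z^n, written in complex time\<close>
  define \<psi> :: "complex \<Rightarrow> complex" where "\<psi> s = c * exp (- Ln s / of_nat N)" for s
  have \<psi>N: "\<psi> s ^ N = - 1 / (of_nat N * b * s)" if "s \<noteq> 0" for s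
  proof -
    have "exp (- Ln s / of_nat N) ^ N = exp (- Ln s)"
      using N by (simp add: exp_of_nat_mult[symmetric])
    then show ?thesis using that c by (simp add: \<psi>_def power_mult_distrib exp_minus field_simps)
  qed
  have n\<psi>: "norm (\<psi> s) ^ N = 1 / (real N * norm b * norm s)" if "s \<noteq> 0" for s
    using arg_cong[OF \<psi>N[OF that], of norm] by (simp add: norm_power norm_divide norm_mult)
  have small: "norm (\<psi> s) < \<eta>" if \<eta>: "0 < \<eta>" and s: "1 / (real N * norm b * \<eta> ^ N) < norm s" for \<eta> s
  proof -
    have s0: "s \<noteq> 0" using s N b \<eta> by (auto simp: field_simps)
    have "norm (\<psi> s) ^ N < \<eta> ^ N"
      using s s0 N b \<eta> unfolding n\<psi>[OF s0] by (simp add: divide_simps mult_ac)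
    then show ?thesis using \<eta> by (meson less_imp_le power_less_imp_less_base)
  qed
  obtain s s0 where s: "0 < s0"
    "\<And>t. 0 \<le> t \<Longrightarrow> norm (s t - (of_real s0 + of_real t * (\<beta> 0 / b))) \<le> 1/4 * t"
    "\<And>t. 0 \<le> t \<Longrightarrow>
      ((\<lambda>t. \<psi> (s t)) has_vector_derivative \<psi> (s t) ^ n * \<beta> (\<psi> (s t))) (at t)"
    "\<And>t. 0 \<le> t \<Longrightarrow> \<psi> (s t) \<noteq> 0 \<and> norm (\<psi> (s t)) < \<delta> \<and> norm (\<beta> (\<psi> (s t)) - \<beta> 0) < norm b/4"
  proof (rule orbit_from_model[OF hol \<delta> \<beta>0, of \<psi> b n "1/4" "norm b/4"])
    fix \<eta> :: real assume \<eta>: "0 < \<eta>"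
    have "\<psi> s \<noteq> 0 \<and> norm (\<psi> s) < \<eta> \<and> (\<psi> has_field_derivative b * \<psi> s ^ n) (at s)"
      if s: "1 / (real N * norm b * \<eta> ^ N) < Re s" for s
    proof -
      have "0 < 1 / (real N * norm b * \<eta> ^ N)" using \<eta> b N by simp
      with s have Re: "0 < Re s" by linarith
      then have sn: "s \<notin> \<real>\<^sub>\<le>\<^sub>0" "s \<noteq> 0" by (auto simp: complex_nonpos_Reals_iff)
      have "(\<psi> has_field_derivative c * (exp (- Ln s / of_nat N) * (- (1 / s) / of_nat N))) (at s)"
        unfolding \<psi>_def using sn N
        by (auto intro!: derivative_eq_intros simp: divide_inverse mult_ac)
      also have "c * (exp (- Ln s / of_nat N) * (- (1 / s) / of_nat N)) = b * (\<psi> s * \<psi> s ^ N)"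
      proof -
        have "b * (\<psi> s * \<psi> s ^ N) = \<psi> s * (- 1 / (of_nat N * s))"
          unfolding \<psi>N[OF sn(2)] using b by simp
        then show ?thesis by (simp add: \<psi>_def mult_ac)
      qed
      finally have "(\<psi> has_field_derivative b * \<psi> s ^ n) (at s)" by (simp add: N)
      moreover have "norm (\<psi> s) < \<eta>"
        by (rule small[OF \<eta> order.strict_trans2[OF s complex_Re_le_cmod]])
      ultimately show ?thesis using c0 by (simp add: \<psi>_def)
    qed
    then show "\<exists>R. \<forall>s. R < Re s \<longrightarrow> \<psi> s \<noteq> 0 \<and> norm (\<psi> s) < \<eta> \<and> (\<psi> has_field_derivative b * \<psi> s ^ n) (at s)"
      by blast
  qed (use b in \<open>auto simp: b_def\<close>)
  have s_bounds: "s0 + 3/4 * t \<le> Re (s t)" "\<bar>Im (s t)\<bar> \<le> 1/3 * Re (s t)" if t: "0 \<le> t" for t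
  proof -
    define d where "d = s t - (of_real s0 + of_real t * (\<beta> 0 / b))"
    have "\<bar>Re d\<bar> \<le> 1/4 * t" "\<bar>Im d\<bar> \<le> 1/4 * t"
      using s(2)[OF t] abs_Re_le_cmod[of d] abs_Im_le_cmod[of d] unfolding d_def by linarith+
    moreover have "Re d = Re (s t) - s0 - t" "Im d = Im (s t)"
      using b by (auto simp: d_def b_def)
    ultimately show "s0 + 3/4 * t \<le> Re (s t)" "\<bar>Im (s t)\<bar> \<le> 1/3 * Re (s t)"
      using s(1) by linarith+
  qed
  show ?thesis
  proof (rule that[of "norm b / 2" "\<lambda>t. \<psi> (s t)"])
    show "((\<lambda>t. \<psi> (s t)) \<longlongrightarrow> 0) at_top"
    proof (rule tendstoI)
      fix \<eta> :: real assume \<eta>: "0 < \<eta>"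
      show "\<forall>\<^sub>F t in at_top. dist (\<psi> (s t)) 0 < \<eta>"
        using eventually_gt_at_top[of "max 0 (4/3 * (1 / (real N * norm b * \<eta> ^ N)))"]
      proof eventually_elim
        case (elim t)
        then have "1 / (real N * norm b * \<eta> ^ N) < norm (s t)"
          using s_bounds(1)[of t] s(1) complex_Re_le_cmod[of "s t"] by linarith
        then show ?case using small[OF \<eta>] by simp
      qed
    qed
    show "Re (\<psi> (s t) ^ (n - 1) * \<beta> (\<psi> (s t))) \<le> - (norm b / 2) * norm (\<psi> (s t)) ^ (n - 1)"
      if t: "0 \<le> t" for t
    proof -
      have Re: "0 < Re (s t)" using s_bounds(1)[OF t] t s(1) by linarith
      then have s0: "s t \<noteq> 0" by auto
      define w where "w = \<beta> (\<psi> (s t)) / b - 1"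
      have w: "norm w \<le> 1/4"
      proof -
        have "w = (\<beta> (\<psi> (s t)) - \<beta> 0) / b" using b by (simp add: w_def b_def field_simps)
        then have "norm w * norm b = norm (\<beta> (\<psi> (s t)) - \<beta> 0)"
          using b by (simp add: norm_divide)
        then have "norm w * norm b \<le> 1/4 * norm b" using s(4)[OF t] by simp
        then show ?thesis by (rule mult_right_le_imp_le) (use b in simp)
      qed
      have "norm (s t) \<le> \<bar>Re (s t)\<bar> + \<bar>Im (s t)\<bar>" by (rule cmod_le)
      then have s34: "3/4 * norm (s t) \<le> Re (s t)" using s_bounds(2)[OF t] Re by linarith
      have r1: "3/4 * (1 / norm (s t)) \<le> Re (1 / s t)"
      proof -
        have "Re (1 / s t) = Re (s t) / norm (s t) ^ 2"
          by (simp add: Re_divide cmod_power2)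
        moreover have "3/4 * (1 / norm (s t)) = (3/4 * norm (s t)) / norm (s t) ^ 2"
          using s0 by (simp add: power2_eq_square)
        ultimately show ?thesis
          using divide_right_mono[OF s34, of "norm (s t) ^ 2"] by simp
      qed
      have "\<bar>Re (w / s t)\<bar> \<le> norm (w / s t)" by (rule abs_Re_le_cmod)
      also have "\<dots> \<le> 1/4 * (1 / norm (s t))"
        using divide_right_mono[OF w, of "norm (s t)"] by (simp add: norm_divide)
      finally have r2: "1/2 * (1 / norm (s t)) \<le> Re (1 / s t + w / s t)"
        using r1 by simp
      have "\<beta> (\<psi> (s t)) = b * (1 + w)" using b by (simp add: w_def)
      then have "\<psi> (s t) ^ N * \<beta> (\<psi> (s t)) = - (1 / real N) *\<^sub>R (1 / s t + w / s t)"
        unfolding \<psi>N[OF s0] scaleR_conv_of_real using N(1) b s0 by (simp add: divide_simps)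
      then have "Re (\<psi> (s t) ^ N * \<beta> (\<psi> (s t))) = - (1 / real N) * Re (1 / s t + w / s t)"
        by (metis scaleR_complex.sel(1))
      also have "\<dots> \<le> - (1 / real N) * (1/2 * (1 / norm (s t)))"
        using r2 N by (intro mult_left_mono_neg) auto
      also have "\<dots> = - (norm b / 2) * norm (\<psi> (s t)) ^ N"
        unfolding n\<psi>[OF s0] using N(1) b s0 by simp
      finally show ?thesis by (simp add: N_def)
    qed
  qed (use s b in auto)
qed

section \<open>Leading terms of holomorphic functions of two variables\<close>

lemma holomorphic_slices:
  fixes h :: "complex \<times> complex \<Rightarrow> complex"
  assumes "(h has_derivative (\<lambda>v. a * fst v + b * snd v)) (at (z1, z2))"
  shows "((\<lambda>w. h (w, z2)) has_field_derivative a) (at z1)"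
    and "((\<lambda>w. h (z1, w)) has_field_derivative b) (at z2)"
proof -
  have "((\<lambda>w. (w, z2)) has_derivative (\<lambda>v. (v, 0))) (at z1)"
    by (auto intro!: derivative_eq_intros)
  from has_derivative_compose[OF this, of h "\<lambda>v. a * fst v + b * snd v"] assms
  show "((\<lambda>w. h (w, z2)) has_field_derivative a) (at z1)"
    by (simp add: has_field_derivative_def)
  have "((\<lambda>w. (z1, w)) has_derivative (\<lambda>v. (0, v))) (at z2)"
    by (auto intro!: derivative_eq_intros)
  from has_derivative_compose[OF this, of h "\<lambda>v. a * fst v + b * snd v"] assms
  show "((\<lambda>w. h (z1, w)) has_field_derivative b) (at z2)"
    by (simp add: has_field_derivative_def)
qed

lemma taylor_tail_bound:
  fixes f :: "complex \<Rightarrow> complex"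
  assumes holf: "f holomorphic_on ball 0 r" and cont: "continuous_on (cball 0 r) f"
    and r: "0 < r" and M: "\<And>w. norm w = r \<Longrightarrow> norm (f w) \<le> M" and w: "norm w \<le> r / 2"
  shows "norm (f w - (\<Sum>i<j. (deriv ^^ i) f 0 / fact i * w ^ i)) \<le> 2 * M / r ^ j * norm w ^ j"
proof -
  define c where "c i = (deriv ^^ i) f 0 / fact i" for i
  have c: "norm (c i) \<le> M / r ^ i" for i
  proof -
    have "norm ((deriv ^^ i) f 0) \<le> fact i * M / r ^ i"
      by (rule Cauchy_inequality[OF holf cont r]) (use M in auto)
    then show ?thesis by (simp add: c_def norm_divide field_simps)
  qed
  have "0 \<le> norm (f (of_real r))" by simp
  also have "\<dots> \<le> M" using r by (intro M) auto
  finally have M0: "0 \<le> M" .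
  have q: "norm w / r \<le> 1/2" "0 \<le> norm w / r" using w r by (auto simp: field_simps)
  have "(\<lambda>i. c i * w ^ i) sums f w"
    using holomorphic_power_series[OF holf, of w] w r unfolding c_def by simp
  then have s1: "(\<lambda>i. c (i + j) * w ^ (i + j)) sums (f w - (\<Sum>i<j. c i * w ^ i))"
    by (rule sums_split_initial_segment)
  have s2: "(\<lambda>i. M * (norm w / r) ^ j * (1/2) ^ i) sums (M * (norm w / r) ^ j * (1 / (1 - 1/2)))"
    by (intro sums_mult geometric_sums) auto
  have "norm (f w - (\<Sum>i<j. c i * w ^ i)) \<le> M * (norm w / r) ^ j * (1 / (1 - 1/2))"
  proof (rule norm_sums_le[OF s1 s2])
    fix i
    have "norm (c (i + j) * w ^ (i + j)) \<le> M / r ^ (i + j) * norm w ^ (i + j)"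
      unfolding norm_mult norm_power by (intro mult_right_mono c) auto
    also have "\<dots> = M * (norm w / r) ^ j * (norm w / r) ^ i"
      by (simp add: power_divide power_add mult_ac)
    also have "\<dots> \<le> M * (norm w / r) ^ j * (1/2) ^ i"
      by (intro mult_left_mono power_mono q mult_nonneg_nonneg M0 zero_le_power)
    finally show "norm (c (i + j) * w ^ (i + j)) \<le> M * (norm w / r) ^ j * (1/2) ^ i" .
  qed
  also have "\<dots> = 2 * M / r ^ j * norm w ^ j" by (simp add: power_divide)
  finally show ?thesis by (simp add: c_def)
qed

text \<open>The leading term of a holomorphic function of two variables with respect to \<open>z1\<close>. Only the
  Taylor coefficients in \<open>z1\<close> have to be known to be holomorphic in \<open>z2\<close>.\<close>

lemma two_variable_expansion:
  assumes "holomorphic2_near_0 h"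
  shows "(\<forall>\<^sub>F z in nhds 0. h z = 0) \<or>
    (\<exists>j k \<beta> \<delta> C. 0 < \<delta> \<and> \<beta> holomorphic_on ball 0 \<delta> \<and> \<beta> 0 \<noteq> 0 \<and>
      (\<forall>z1 z2. norm z1 < \<delta> \<longrightarrow> norm z2 < \<delta> \<longrightarrow>
        norm (h (z1, z2) - z1 ^ j * z2 ^ k * \<beta> z2) \<le> C * norm z1 ^ Suc j))"
proof -
  obtain U where U: "open U" "0 \<in> U"
    "\<forall>z\<in>U. \<exists>a b. (h has_derivative (\<lambda>v. a * fst v + b * snd v)) (at z)"
    using assms unfolding holomorphic2_near_0_def by blast
  have "\<forall>\<^sub>F z in nhds (0 :: complex \<times> complex). z \<in> U"
    using U by (simp add: eventually_nhds_in_open)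
  then obtain e where e: "0 < e" "\<And>z. dist z (0 :: complex \<times> complex) < e \<Longrightarrow> z \<in> U"
    by (auto simp: eventually_nhds_metric)
  define r where "r = e / 3"
  have r: "0 < r" using e by (simp add: r_def)
  have inU: "(z1, z2) \<in> U" if "norm z1 \<le> r" "norm z2 \<le> r" for z1 z2
  proof (rule e(2))
    have "norm (z1, z2) \<le> norm z1 + norm z2" by (rule norm_Pair_le)
    then show "dist (z1, z2) 0 < e" using that e(1) by (simp add: r_def)
  qed
  have diff: "h differentiable (at (z1, z2))" if "norm z1 \<le> r" "norm z2 \<le> r" for z1 z2
    using U(3) inU[OF that] by (meson differentiable_def)
  have "continuous_on (cball 0 r \<times> cball 0 r) h"
    by (rule continuous_at_imp_continuous_on) (auto intro!: differentiable_imp_continuous_within diff)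
  then have "compact (h ` (cball 0 r \<times> cball 0 r))"
    by (intro compact_continuous_image compact_Times) auto
  then obtain M where "\<And>y. y \<in> h ` (cball 0 r \<times> cball 0 r) \<Longrightarrow> norm y \<le> M"
    using compact_imp_bounded bounded_iff by metis
  then have M: "norm (h (z1, z2)) \<le> M" if "norm z1 \<le> r" "norm z2 \<le> r" for z1 z2
    using that by simp
  have d1: "\<exists>a. ((\<lambda>w. h (w, z2)) has_field_derivative a) (at z1)"
    and d2: "\<exists>b. ((\<lambda>w. h (z1, w)) has_field_derivative b) (at z2)"
    if "norm z1 \<le> r" "norm z2 \<le> r" for z1 z2
    using U(3) inU[OF that] holomorphic_slices by blast+
  have hol1: "(\<lambda>w. h (w, z2)) holomorphic_on ball 0 r" if "norm z2 \<le> r" for z2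
    using d1 that by (auto simp: holomorphic_on_open)
  have hol2: "(\<lambda>w. h (z1, w)) holomorphic_on ball 0 r" if "norm z1 \<le> r" for z1
    using d2 that by (auto simp: holomorphic_on_open)
  have cont1: "continuous_on (cball 0 r) (\<lambda>w. h (w, z2))" if "norm z2 \<le> r" for z2
    using d1 that by (intro continuous_at_imp_continuous_on) (metis DERIV_isCont mem_cball_0)
  define c where "c j z2 = (deriv ^^ j) (\<lambda>w. h (w, z2)) 0 / fact j" for j z2
  have tail: "norm (h (z1, z2) - (\<Sum>i<j. c i z2 * z1 ^ i)) \<le> 2 * M / r ^ j * norm z1 ^ j"
    if "norm z1 \<le> r / 2" "norm z2 \<le> r" for z1 z2 j
    unfolding c_def using M that
    by (intro taylor_tail_bound[OF hol1 cont1 r]) auto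
  \<comment> \<open>each coefficient is the uniform limit of difference quotients holomorphic in the second variable\<close>
  have holc: "c j holomorphic_on ball 0 r" for j
  proof (induction j rule: less_induct)
    case (less j)
    define t where "t = (\<lambda>n. r / 2 * inverse (real (Suc n)))"
    have t: "0 < t n" "t n \<le> r / 2" for n
    proof -
      have "inverse (real (Suc n)) \<le> 1" by (simp add: inverse_eq_divide)
      then have "r / 2 * inverse (real (Suc n)) \<le> r / 2 * 1"
        using r by (intro mult_left_mono) auto
      then show "0 < t n" "t n \<le> r / 2" using r by (simp_all add: t_def)
    qed
    define f where "f n z = (h (of_real (t n), z) - (\<Sum>i<j. c i z * of_real (t n) ^ i)) / of_real (t n) ^ j" for n z
    have t_lim: "(\<lambda>n. 2 * M / r ^ Suc j * t n) \<longlonglongrightarrow> 0"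
    proof -
      have "(\<lambda>n. r / 2 * inverse (real (Suc n))) \<longlonglongrightarrow> r / 2 * 0"
        by (intro tendsto_intros LIMSEQ_inverse_real_of_nat)
      then have "t \<longlonglongrightarrow> 0" unfolding t_def by (simp only: mult_zero_right)
      then show ?thesis by (rule tendsto_mult_right_zero)
    qed
    have close: "norm (f n z - c j z) \<le> 2 * M / r ^ Suc j * t n" if z: "norm z \<le> r" for n z
    proof -
      have "norm (h (of_real (t n), z) - (\<Sum>i<Suc j. c i z * of_real (t n) ^ i)) \<le>
          2 * M / r ^ Suc j * t n ^ Suc j"
        using tail[of "of_real (t n)" z "Suc j"] t[of n] z by simp
      then have "norm (f n z - c j z) * t n ^ j \<le> (2 * M / r ^ Suc j * t n) * t n ^ j"
      proof -
        have "(f n z - c j z) * of_real (t n) ^ j =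
            h (of_real (t n), z) - (\<Sum>i<Suc j. c i z * of_real (t n) ^ i)"
        proof -
          have "f n z * of_real (t n) ^ j = h (of_real (t n), z) - (\<Sum>i<j. c i z * of_real (t n) ^ i)"
            unfolding f_def using t(1)[of n] by (intro nonzero_eq_divide_eq[THEN iffD1, OF _ refl]) auto
          then show ?thesis by (simp add: left_diff_distrib)
        qed
        then have "norm (f n z - c j z) * t n ^ j =
            norm (h (of_real (t n), z) - (\<Sum>i<Suc j. c i z * of_real (t n) ^ i))"
          using t(1)[of n] by (metis abs_of_pos norm_mult norm_of_real norm_power)
        then show ?thesis
          using \<open>norm (h (of_real (t n), z) - (\<Sum>i<Suc j. c i z * of_real (t n) ^ i)) \<le>
          2 * M / r ^ Suc j * t n ^ Suc j\<close> by (simp add: mult_ac)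
      qed
      then show ?thesis by (rule mult_right_le_imp_le) (use t in simp)
    qed
    show ?case
    proof (rule holomorphic_uniform_sequence[of "ball 0 r" f])
      show "f n holomorphic_on ball 0 r" for n
        unfolding f_def using t[of n] r less
        by (intro holomorphic_intros hol2) auto
      fix x :: complex assume "x \<in> ball 0 r"
      then obtain d where d: "0 < d" "cball x d \<subseteq> ball 0 r"
        using open_contains_cball_eq[OF open_ball] by blast
      have "uniform_limit (cball x d) f (c j) sequentially"
      proof (rule uniform_limitI)
        fix \<epsilon> :: real assume "0 < \<epsilon>"
        then have "\<forall>\<^sub>F n in sequentially. 2 * M / r ^ Suc j * t n < \<epsilon>"
          using order_tendstoD(2)[OF t_lim] by blast
        then show "\<forall>\<^sub>F n in sequentially. \<forall>z\<in>cball x d. dist (f n z) (c j z) < \<epsilon>"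
        proof eventually_elim
          case (elim n)
          show ?case
          proof
            fix z assume "z \<in> cball x d"
            then have "norm z \<le> r" using d(2) by fastforce
            then show "dist (f n z) (c j z) < \<epsilon>"
              using close[of z n] elim unfolding dist_norm by linarith
          qed
        qed
      qed
      then show "\<exists>d>0. cball x d \<subseteq> ball 0 r \<and> uniform_limit (cball x d) f (c j) sequentially"
        using d by blast
    qed auto
  qed
  show ?thesis
  proof (cases "\<forall>j. \<forall>z\<in>ball 0 r. c j z = 0")
    case True
    have zero: "h (z1, z2) = 0" if "norm z1 < r" "norm z2 < r" for z1 z2
    proof (rule holomorphic_fun_eq_0_on_ball[OF hol1])
      show "(deriv ^^ n) (\<lambda>w. h (w, z2)) 0 = 0" for n
        using True that by (auto simp: c_def)
    qed (use that in auto)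
    have "\<forall>\<^sub>F z in nhds (0::complex \<times> complex). z \<in> ball 0 r \<times> ball 0 r"
      using r by (intro eventually_nhds_in_open open_Times) (auto simp: zero_prod_def)
    then show ?thesis
      by (intro disjI1) (auto elim!: eventually_mono intro!: zero)
  next
    case False
    define j where "j = (LEAST j. \<exists>z\<in>ball 0 r. c j z \<noteq> 0)"
    have "\<exists>z\<in>ball 0 r. c j z \<noteq> 0"
      unfolding j_def by (rule LeastI_ex) (use False in blast)
    then obtain z0 where z0: "z0 \<in> ball 0 r" "c j z0 \<noteq> 0" by blast
    have below: "c i z = 0" if "i < j" "z \<in> ball 0 r" for i z
      using not_less_Least[OF that(1)[unfolded j_def]] that(2) by blast
    obtain k \<beta> \<delta> where \<beta>: "0 < \<delta>" "\<beta> holomorphic_on ball 0 \<delta>" "\<beta> 0 \<noteq> 0" "\<delta> \<le> r"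
      "\<And>z. norm z < \<delta> \<Longrightarrow> c j z = z ^ k * \<beta> z"
    proof (cases "c j 0 = 0")
      case False
      then show ?thesis using that[of r "c j" 0] holc r by auto
    next
      case True
      have "\<not> c j constant_on ball 0 r"
        unfolding constant_on_def using True z0 r
        by (metis centre_in_ball)
      then obtain g \<delta> n where g: "0 < \<delta>" "ball 0 \<delta> \<subseteq> ball (0::complex) r" "g holomorphic_on ball 0 \<delta>"
          "\<And>w. w \<in> ball 0 \<delta> \<Longrightarrow> c j w = (w - 0) ^ n * g w" "\<And>w. w \<in> ball 0 \<delta> \<Longrightarrow> g w \<noteq> 0"
        using holomorphic_factor_zero_nonconstant[OF holc open_ball connected_ball _ True] r
        by (metis centre_in_ball)
      have "\<delta> \<le> r" using g(1,2) by (simp add: ball_subset_ball_iff)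
      then show ?thesis using that[of \<delta> g n] g by auto
    qed
    define \<delta>' where "\<delta>' = min \<delta> (r / 2)"
    show ?thesis
    proof (intro disjI2 exI conjI allI impI)
      show "0 < \<delta>'" using \<beta>(1) r by (simp add: \<delta>'_def)
      show "\<beta> holomorphic_on ball 0 \<delta>'"
        by (rule holomorphic_on_subset[OF \<beta>(2)]) (auto simp: \<delta>'_def)
      show "\<beta> 0 \<noteq> 0" by (rule \<beta>)
      fix z1 z2 :: complex assume z: "norm z1 < \<delta>'" "norm z2 < \<delta>'"
      have "(\<Sum>i<Suc j. c i z2 * z1 ^ i) = c j z2 * z1 ^ j"
        using below z \<beta>(4) by (simp add: \<delta>'_def)
      moreover have "c j z2 = z2 ^ k * \<beta> z2" using z by (intro \<beta>(5)) (simp add: \<delta>'_def)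
      ultimately show "norm (h (z1, z2) - z1 ^ j * z2 ^ k * \<beta> z2) \<le> 2 * M / r ^ Suc j * norm z1 ^ Suc j"
        using tail[of z1 z2 "Suc j"] z r by (simp add: \<delta>'_def mult_ac)
    qed
  qed
qed

text \<open>\<open>h = z1^j (z2^k \<beta>(z2) + O(z1))\<close> with \<open>\<beta>\<close> holomorphic near 0 and \<open>\<beta>(0) \<noteq> 0\<close>. Thus \<open>j\<close> is the
  order of vanishing of \<open>h\<close> along the axis \<open>z1 = 0\<close>, and \<open>k\<close> the order at 0 of the first
  coefficient.\<close>

definition expands :: "(complex \<times> complex \<Rightarrow> complex) \<Rightarrow> nat \<Rightarrow> nat \<Rightarrow> (complex \<Rightarrow> complex) \<Rightarrow> bool"
  where "expands h j k \<beta> \<longleftrightarrow> \<beta> 0 \<noteq> 0 \<and> (\<exists>\<delta>>0. \<exists>C. \<beta> holomorphic_on ball 0 \<delta> \<and>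
      (\<forall>z1 z2. norm z1 < \<delta> \<longrightarrow> norm z2 < \<delta> \<longrightarrow>
        norm (h (z1, z2) - z1 ^ j * z2 ^ k * \<beta> z2) \<le> C * norm z1 ^ Suc j))"

lemma expands_or_zero:
  assumes "holomorphic2_near_0 h"
  shows "(\<forall>\<^sub>F z in nhds 0. h z = 0) \<or> (\<exists>j k \<beta>. expands h j k \<beta>)"
  using two_variable_expansion[OF assms] unfolding expands_def by blast

lemma expands_0_on_axis:
  assumes "expands h 0 k \<beta>"
  shows "\<forall>\<^sub>F w in nhds 0. h (0, w) = w ^ k * \<beta> w" and "\<beta> field_differentiable at 0"
proof -
  obtain \<delta> C where \<delta>: "0 < \<delta>" "\<beta> holomorphic_on ball 0 \<delta>"
      "\<And>z1 z2. norm z1 < \<delta> \<Longrightarrow> norm z2 < \<delta> \<Longrightarrow>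
        norm (h (z1, z2) - z1 ^ 0 * z2 ^ k * \<beta> z2) \<le> C * norm z1 ^ Suc 0"
    using assms unfolding expands_def by blast
  have "\<forall>\<^sub>F w in nhds (0::complex). norm w < \<delta>"
    using \<delta>(1) by (auto simp: eventually_nhds_metric dist_norm)
  then show "\<forall>\<^sub>F w in nhds 0. h (0, w) = w ^ k * \<beta> w"
    by eventually_elim (use \<delta>(3)[of 0] \<delta>(1) in simp)
  show "\<beta> field_differentiable at 0"
    using \<delta> by (auto intro: holomorphic_on_imp_differentiable_at)
qed

section \<open>Flat positive functions\<close>

text \<open>A real function on the plane, positive off 0 and flat at 0 together with its Wirtinger
  derivative \<open>P'\<close>. The real differential at \<open>z\<close> is \<open>v \<mapsto> 2 Re (P'(z) v)\<close>.\<close>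

locale flat_function =
  fixes P :: "complex \<Rightarrow> real" and P' :: "complex \<Rightarrow> complex" and r0 :: real
  assumes r0: "0 < r0"
    and P_deriv: "\<And>z. norm z < r0 \<Longrightarrow> (P has_derivative (\<lambda>v. 2 * Re (P' z * v))) (at z)"
    and P'_cont: "continuous_on (ball 0 r0) P'"
    and P_pos: "\<And>z. z \<noteq> 0 \<Longrightarrow> norm z < r0 \<Longrightarrow> 0 < P z"
    and P_flat: "\<And>n. ((\<lambda>z. P z / norm z ^ n) \<longlongrightarrow> 0) (at 0)"
    and P'_flat: "\<And>n. ((\<lambda>z. norm (P' z) / norm z ^ n) \<longlongrightarrow> 0) (at 0)"
begin

lemma eventually_in_disc: "\<forall>\<^sub>F z in at 0. z \<noteq> 0 \<and> norm z < r0"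
  using r0 by (auto simp: eventually_at dist_norm intro!: exI[of _ r0])

lemma eventually_pos: "\<forall>\<^sub>F z in at 0. 0 < P z"
  using eventually_in_disc by eventually_elim (rule P_pos, auto)

lemma P_tendsto: "(P \<longlongrightarrow> 0) (at 0)"
  using P_flat[of 0] by simp

text \<open>In logarithmic form: along a curve tending to 0, \<open>P\<close> is not bounded below by a positive
  multiple of a power of the modulus.\<close>

lemma log_lower_bound_absurd:
  assumes \<gamma>: "filterlim \<gamma> (at 0) F" and F: "F \<noteq> bot"
    and bound: "\<forall>\<^sub>F t in F. K + real N * ln (norm (\<gamma> t)) \<le> ln (P (\<gamma> t))"
  shows False
proof -
  have "((\<lambda>t. P (\<gamma> t) / norm (\<gamma> t) ^ N) \<longlongrightarrow> 0) F"
    by (rule filterlim_compose[OF P_flat \<gamma>])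
  then have "\<forall>\<^sub>F t in F. P (\<gamma> t) / norm (\<gamma> t) ^ N < exp K"
    by (rule order_tendstoD) simp
  moreover have "\<forall>\<^sub>F t in F. 0 < P (\<gamma> t)"
    using eventually_compose_filterlim[OF eventually_pos \<gamma>] .
  moreover have "\<forall>\<^sub>F t in F. \<gamma> t \<noteq> 0"
    using eventually_compose_filterlim[OF eventually_neq_at_within[of 0 0] \<gamma>] by simp
  ultimately have "\<forall>\<^sub>F t in F. False"
    using bound
  proof eventually_elim
    case (elim t)
    have "exp K * norm (\<gamma> t) ^ N = exp (K + real N * ln (norm (\<gamma> t)))"
      using elim(3) by (simp add: exp_add exp_of_nat_mult)
    also have "\<dots> \<le> exp (ln (P (\<gamma> t)))" using elim(4) by simp
    also have "\<dots> = P (\<gamma> t)" using elim(2) by simp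
    finally show False using elim(1,3) by (simp add: field_simps)
  qed
  then show False using F by simp
qed

lemma P_along_curve:
  assumes \<gamma>: "(\<gamma> has_vector_derivative v) (at t)" and t: "\<gamma> t \<noteq> 0" "norm (\<gamma> t) < r0"
  shows "((\<lambda>t. ln (P (\<gamma> t))) has_real_derivative 2 * Re (P' (\<gamma> t) * v) / P (\<gamma> t)) (at t)"
proof -
  have "((\<lambda>t. P (\<gamma> t)) has_derivative (\<lambda>h. 2 * Re (P' (\<gamma> t) * (h *\<^sub>R v)))) (at t)"
    using has_derivative_compose[OF \<gamma>[unfolded has_vector_derivative_def] P_deriv[OF t(2)]] .
  also have "(\<lambda>h. 2 * Re (P' (\<gamma> t) * (h *\<^sub>R v))) = (*) (2 * Re (P' (\<gamma> t) * v))"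
    by (auto simp: algebra_simps)
  finally have "((\<lambda>t. P (\<gamma> t)) has_real_derivative 2 * Re (P' (\<gamma> t) * v)) (at t)"
    by (simp add: has_field_derivative_def)
  from DERIV_chain2[OF DERIV_ln_divide[OF P_pos[OF t]] this] show ?thesis by simp
qed

text \<open>On every ray, the logarithmic radial derivative \<open>\<rho> (d/d\<rho>) ln P\<close> is unbounded above near 0;
  otherwise \<open>P\<close> would dominate a power of \<open>\<rho>\<close>.\<close>

lemma ray_sequence:
  assumes \<theta>: "norm \<theta> = 1"
  obtains \<rho> :: "nat \<Rightarrow> real"
  where "\<And>i. 0 < \<rho> i" "\<And>i. \<rho> i < r0" "\<rho> \<longlonglongrightarrow> 0"
    and "filterlim (\<lambda>i. \<rho> i * (2 * Re (P' (of_real (\<rho> i) * \<theta>) * \<theta>) / P (of_real (\<rho> i) * \<theta>))) at_top sequentially"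
proof -
  define G where "G \<rho> = \<rho> * (2 * Re (P' (of_real \<rho> * \<theta>) * \<theta>) / P (of_real \<rho> * \<theta>))" for \<rho> :: real
  have ex: "\<exists>\<rho>. 0 < \<rho> \<and> \<rho> < \<delta> \<and> real N < G \<rho>" if \<delta>: "0 < \<delta>" "\<delta> \<le> r0" for \<delta> N
  proof (rule ccontr)
    assume "\<not> ?thesis"
    then have G: "G \<rho> \<le> real N" if "0 < \<rho>" "\<rho> < \<delta>" for \<rho> using that by force
    define f where "f \<rho> = ln (P (of_real \<rho> * \<theta>)) - real N * ln \<rho>" for \<rho> :: real
    have f': "(f has_real_derivative (G \<rho> - real N) / \<rho>) (at \<rho>)" if \<rho>: "0 < \<rho>" "\<rho> < \<delta>" for \<rho>
    proof -
      have "((\<lambda>\<rho>. of_real \<rho> * \<theta>) has_vector_derivative \<theta>) (at \<rho>)"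
        by (auto intro!: derivative_eq_intros simp: has_vector_derivative_def scaleR_conv_of_real)
      from P_along_curve[OF this] \<rho> \<delta> \<theta>
      have "((\<lambda>\<rho>. ln (P (of_real \<rho> * \<theta>))) has_real_derivative
          2 * Re (P' (of_real \<rho> * \<theta>) * \<theta>) / P (of_real \<rho> * \<theta>)) (at \<rho>)"
        by (force simp: norm_mult)
      moreover have "((\<lambda>\<rho>. real N * ln \<rho>) has_real_derivative real N * (1 / \<rho>)) (at \<rho>)"
        by (intro DERIV_cmult DERIV_ln_divide \<rho>)
      ultimately have "(f has_real_derivative
          2 * Re (P' (of_real \<rho> * \<theta>) * \<theta>) / P (of_real \<rho> * \<theta>) - real N * (1 / \<rho>)) (at \<rho>)"
        unfolding f_def by (rule DERIV_diff)
      then show ?thesis using \<rho> by (simp add: G_def diff_divide_distrib)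
    qed
    have below: "f (\<delta> / 2) \<le> f \<rho>" if \<rho>: "0 < \<rho>" "\<rho> < \<delta> / 2" for \<rho>
    proof (rule DERIV_nonpos_imp_nonincreasing[where f = f])
      show "\<rho> \<le> \<delta> / 2" using \<rho> by simp
      fix x assume x: "\<rho> \<le> x" "x \<le> \<delta> / 2"
      then have "0 < x" "x < \<delta>" using \<rho> \<delta> by auto
      moreover from this have "(G x - real N) / x \<le> 0" using G by (simp add: divide_nonpos_pos)
      ultimately show "\<exists>y. (f has_real_derivative y) (at x) \<and> y \<le> 0" using f' by blast
    qed
    have "f (\<delta> / 2) + real N * ln (norm (of_real \<rho> * \<theta>)) \<le> ln (P (of_real \<rho> * \<theta>))"
      if "0 < \<rho>" "\<rho> < \<delta> / 2" for \<rho>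
    proof -
      have "norm (of_real \<rho> * \<theta>) = \<rho>" using that \<theta> by (simp add: norm_mult)
      then show ?thesis using below[OF that] by (simp only: f_def[of \<rho>])
    qed
    then have ev: "\<forall>\<^sub>F \<rho> in at_right 0.
        f (\<delta> / 2) + real N * ln (norm (of_real \<rho> * \<theta>)) \<le> ln (P (of_real \<rho> * \<theta>))"
      using \<delta>(1) unfolding eventually_at_right_field
      by (intro exI[of _ "\<delta> / 2"] conjI allI impI) auto
    from log_lower_bound_absurd[OF ray_filterlim[OF \<theta>] _ ev] show False by simp
  qed
  have "\<exists>\<rho>. 0 < \<rho> \<and> \<rho> < r0 / real (Suc i) \<and> real i < G \<rho>" for i
    by (rule ex) (use r0 in \<open>auto simp: field_simps\<close>)
  then obtain \<rho> where \<rho>: "\<And>i. 0 < \<rho> i" "\<And>i. \<rho> i < r0 / real (Suc i)" "\<And>i. real i < G (\<rho> i)"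
    by metis
  show ?thesis
  proof (rule that)
    show "\<rho> i < r0" for i
    proof -
      have "r0 / real (Suc i) \<le> r0" using r0 by (simp add: field_simps)
      then show ?thesis using \<rho>(2)[of i] by linarith
    qed
    have "(\<lambda>i. r0 * inverse (real (Suc i))) \<longlonglongrightarrow> r0 * 0"
      by (intro tendsto_intros LIMSEQ_inverse_real_of_nat)
    then have "(\<lambda>i. r0 / real (Suc i)) \<longlonglongrightarrow> 0" by (simp add: divide_inverse)
    then show "\<rho> \<longlonglongrightarrow> 0"
      by (rule Lim_null_comparison[rotated])
        (use \<rho>(1,2) in \<open>auto intro!: always_eventually simp: abs_of_pos less_imp_le simp del: of_nat_Suc\<close>)
    show "filterlim (\<lambda>i. \<rho> i * (2 * Re (P' (of_real (\<rho> i) * \<theta>) * \<theta>) / P (of_real (\<rho> i) * \<theta>))) at_top sequentially"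
      by (rule filterlim_at_top_mono[OF filterlim_real_sequentially])
        (use \<rho>(3) in \<open>auto intro!: always_eventually less_imp_le simp: G_def\<close>)
  qed (use \<rho> in auto)
qed

text \<open>Along the orbit of \<open>attracting_orbit\<close>, the function \<open>ln P - N ln |z|\<close> is nondecreasing for
  large \<open>N\<close>, which contradicts flatness.\<close>

lemma no_attracting_drift:
  assumes hol: "\<beta> holomorphic_on ball 0 \<delta>" and \<delta>: "0 < \<delta>" and \<beta>0: "\<beta> 0 \<noteq> 0"
    and n: "1 \<le> n" "n = 1 \<Longrightarrow> Re (\<beta> 0) < 0"
    and drift: "\<forall>\<^sub>F z in at 0. - C * norm z ^ (n - 1) * P z \<le> 2 * Re (P' z * (z ^ n * \<beta> z))"
  shows False
proof -
  obtain d where d: "0 < d"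
    "\<And>z. z \<noteq> 0 \<Longrightarrow> norm z < d \<Longrightarrow> - C * norm z ^ (n - 1) * P z \<le> 2 * Re (P' z * (z ^ n * \<beta> z))"
    using drift by (auto simp: eventually_at dist_norm)
  define \<delta>' where "\<delta>' = min \<delta> (min d r0)"
  have \<delta>': "0 < \<delta>'" using \<delta> d r0 by (simp add: \<delta>'_def)
  have hol': "\<beta> holomorphic_on ball 0 \<delta>'"
    by (rule holomorphic_on_subset[OF hol]) (auto simp: \<delta>'_def)
  obtain \<gamma> c where c: "0 < c" and \<gamma>:
    "\<And>t. 0 \<le> t \<Longrightarrow> (\<gamma> has_vector_derivative \<gamma> t ^ n * \<beta> (\<gamma> t)) (at t)"
    "\<And>t. 0 \<le> t \<Longrightarrow> \<gamma> t \<noteq> 0 \<and> norm (\<gamma> t) < \<delta>'"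
    "(\<gamma> \<longlongrightarrow> 0) at_top"
    "\<And>t. 0 \<le> t \<Longrightarrow> Re (\<gamma> t ^ (n - 1) * \<beta> (\<gamma> t)) \<le> - c * norm (\<gamma> t) ^ (n - 1)"
    using attracting_orbit[OF hol' \<delta>' \<beta>0 n] by metis
  obtain N :: nat where N: "C / c \<le> real N" using real_arch_simple by blast
  then have N: "C \<le> real N * c" using c by (simp add: field_simps)
  define U where "U t = ln (P (\<gamma> t)) - real N * ln (norm (\<gamma> t))" for t
  have U': "\<exists>y. (U has_real_derivative y) (at t) \<and> 0 \<le> y" if t: "0 \<le> t" for t
  proof -
    define B where "B = \<gamma> t ^ n * \<beta> (\<gamma> t)"
    define R where "R = norm (\<gamma> t) ^ (n - 1)"
    have nz: "\<gamma> t \<noteq> 0" "norm (\<gamma> t) < \<delta>'" using \<gamma>(2)[OF t] by auto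
    have P: "0 < P (\<gamma> t)" using nz by (intro P_pos) (auto simp: \<delta>'_def)
    have \<gamma>': "(\<gamma> has_vector_derivative B) (at t)" using \<gamma>(1)[OF t] by (simp add: B_def)
    have "((\<lambda>t. norm (\<gamma> t)) has_derivative (\<lambda>h. (h *\<^sub>R B) \<bullet> sgn (\<gamma> t))) (at t)"
      using has_derivative_compose[OF \<gamma>'[unfolded has_vector_derivative_def] has_derivative_norm[OF nz(1)]] .
    also have "(\<lambda>h. (h *\<^sub>R B) \<bullet> sgn (\<gamma> t)) = (*) (B \<bullet> sgn (\<gamma> t))" by auto
    finally have "((\<lambda>t. norm (\<gamma> t)) has_real_derivative B \<bullet> sgn (\<gamma> t)) (at t)"
      by (simp add: has_field_derivative_def)
    from DERIV_chain2[OF DERIV_ln_divide this] nz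
    have "((\<lambda>t. ln (norm (\<gamma> t))) has_real_derivative 1 / norm (\<gamma> t) * (B \<bullet> sgn (\<gamma> t))) (at t)" by simp
    moreover have "1 / norm (\<gamma> t) * (B \<bullet> sgn (\<gamma> t)) = Re (\<gamma> t ^ (n - 1) * \<beta> (\<gamma> t))"
    proof -
      have "Re (\<gamma> t ^ (n - 1) * \<beta> (\<gamma> t)) = Re (B / \<gamma> t)"
        using n(1) nz(1) by (cases n) (auto simp: B_def)
      also have "\<dots> = (B \<bullet> \<gamma> t) / norm (\<gamma> t) ^ 2"
        by (simp add: Re_divide inner_complex_def cmod_power2)
      finally show ?thesis by (simp add: sgn_div_norm power2_eq_square divide_inverse)
    qed
    ultimately have "((\<lambda>t. ln (norm (\<gamma> t))) has_real_derivative Re (\<gamma> t ^ (n - 1) * \<beta> (\<gamma> t))) (at t)" by simp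
    moreover have "((\<lambda>t. ln (P (\<gamma> t))) has_real_derivative 2 * Re (P' (\<gamma> t) * B) / P (\<gamma> t)) (at t)"
      by (rule P_along_curve[OF \<gamma>' nz(1)]) (use nz in \<open>simp add: \<delta>'_def\<close>)
    ultimately have "(U has_real_derivative 2 * Re (P' (\<gamma> t) * B) / P (\<gamma> t)
        - real N * Re (\<gamma> t ^ (n - 1) * \<beta> (\<gamma> t))) (at t)"
      unfolding U_def by (intro DERIV_diff DERIV_cmult)
    moreover have "- C * R \<le> 2 * Re (P' (\<gamma> t) * B) / P (\<gamma> t)"
      using d(2)[OF nz(1)] nz(2) P by (simp add: B_def R_def \<delta>'_def pos_le_divide_eq)
    moreover have "real N * Re (\<gamma> t ^ (n - 1) * \<beta> (\<gamma> t)) \<le> real N * (- c * R)"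
      unfolding R_def by (intro mult_left_mono \<gamma>(4) t) auto
    moreover have "C * R \<le> real N * c * R"
      using N by (intro mult_right_mono) (auto simp: R_def)
    ultimately show ?thesis by (intro exI conjI) (assumption, simp add: algebra_simps)
  qed
  have mono: "U 0 \<le> U t" if "0 \<le> t" for t
    using that by (rule DERIV_nonneg_imp_nondecreasing) (use U' in auto)
  have ev: "\<forall>\<^sub>F t in at_top. U 0 + real N * ln (norm (\<gamma> t)) \<le> ln (P (\<gamma> t))"
    using eventually_ge_at_top[of 0]
    by eventually_elim (use mono in \<open>auto simp: U_def algebra_simps\<close>)
  have "filterlim \<gamma> (at 0) at_top"
    by (rule filterlim_atI[OF \<gamma>(3)]) (use \<gamma>(2) in \<open>auto intro: eventually_mono[OF eventually_ge_at_top[of 0]]\<close>)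
  from log_lower_bound_absurd[OF this _ ev] show False by simp
qed

end

section \<open>Limits of the tangency condition\<close>

text \<open>The tangency condition along the curve of parameter \<open>\<alpha>\<close>, with only the leading terms of the
  two components of the field displayed. They are \<open>P^j z^k u\<close> and \<open>P^m z^n w\<close>, where \<open>u\<close> and \<open>w\<close>
  converge to \<open>a \<zeta>^j\<close> and \<open>b \<zeta>^m\<close> for \<open>\<zeta> = \<i> \<alpha> - 1\<close>. The bounded function \<open>q\<close> stands for the
  contribution of the derivative of \<open>Q\<close>.\<close>

definition leading_relation ::
    "(complex \<Rightarrow> real) \<Rightarrow> (complex \<Rightarrow> complex) \<Rightarrow> complex \<Rightarrow> nat \<Rightarrow> nat \<Rightarrow> complex \<Rightarrow> nat \<Rightarrow> nat \<Rightarrow> bool"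
  where "leading_relation P P' a j k b m n \<longleftrightarrow> (\<forall>\<alpha>::real. \<exists>u w q K.
    (u \<longlongrightarrow> a * (\<i> * of_real \<alpha> - 1) ^ j) (at 0) \<and> (w \<longlongrightarrow> b * (\<i> * of_real \<alpha> - 1) ^ m) (at 0) \<and>
    (\<forall>\<^sub>F z in at 0. norm (q z) \<le> K) \<and>
    (\<forall>\<^sub>F z in at 0. Re (of_real (P z) ^ j * z ^ k * u z +
        2 * (P' z + of_real (P z) * q z) * (of_real (P z) ^ m * z ^ n * w z)) = 0))"

text \<open>Bolzano-Weierstrass for the pair \<open>(X, Y)\<close> after normalization by \<open>X + |Y|\<close>.\<close>

lemma normalized_limit:
  fixes X :: "nat \<Rightarrow> real" and Y :: "nat \<Rightarrow> complex"
  assumes X: "\<And>i. 0 < X i"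
  obtains \<phi> :: "nat \<Rightarrow> nat" and x :: real and y :: complex
  where "strict_mono \<phi>"
    and "(\<lambda>i. X (\<phi> i) / (X (\<phi> i) + norm (Y (\<phi> i)))) \<longlonglongrightarrow> x"
    and "(\<lambda>i. Y (\<phi> i) / of_real (X (\<phi> i) + norm (Y (\<phi> i)))) \<longlonglongrightarrow> y"
    and "0 \<le> x" and "x + norm y = 1"
proof -
  define f where "f i = (X i / (X i + norm (Y i)), Y i / of_real (X i + norm (Y i)))" for i
  have S: "0 < X i + norm (Y i)" for i using X[of i] by (simp add: add_pos_nonneg)
  have f1: "fst (f i) + norm (snd (f i)) = 1" "0 \<le> fst (f i)" for i
    using S[of i] X[of i] unfolding f_def fst_conv snd_conv norm_divide norm_of_real
    by (simp_all add: add_divide_distrib[symmetric])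
  have "fst (f i) \<le> 1" "norm (snd (f i)) \<le> 1" for i
    using f1[of i] norm_ge_zero[of "snd (f i)"] by linarith+
  then have "f i \<in> {0..1} \<times> cball 0 1" for i
    using f1[of i] by (simp add: mem_Times_iff)
  moreover have "compact ({0..1::real} \<times> cball (0::complex) 1)"
    by (intro compact_Times) auto
  ultimately obtain l \<phi> where l: "strict_mono \<phi>" "(f \<circ> \<phi>) \<longlonglongrightarrow> l"
    unfolding compact_def by metis
  have l1: "(\<lambda>i. fst (f (\<phi> i))) \<longlonglongrightarrow> fst l" and l2: "(\<lambda>i. snd (f (\<phi> i))) \<longlonglongrightarrow> snd l"
    using tendsto_fst[OF l(2)] tendsto_snd[OF l(2)] by (simp_all add: o_def)
  have "(\<lambda>i. fst (f (\<phi> i)) + norm (snd (f (\<phi> i)))) \<longlonglongrightarrow> fst l + norm (snd l)"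
    by (intro tendsto_intros l1 l2)
  then have "fst l + norm (snd l) = 1" by (simp add: f1 LIMSEQ_const_iff)
  moreover have "0 \<le> fst l"
    by (rule LIMSEQ_le_const[OF l1]) (use f1 in auto)
  ultimately show ?thesis
    using that[OF l(1) _ _ \<open>0 \<le> fst l\<close>] l1 l2 by (simp add: f_def)
qed

context flat_function
begin

text \<open>The limit of \<open>leading_relation\<close>, after normalization, along a sequence on which the term with
  \<open>q\<close> is negligible (the assumption \<open>small\<close>). One subsequence serves all \<open>\<alpha>\<close>.\<close>

lemma limit_relation:
  fixes z :: "nat \<Rightarrow> complex" and \<theta> :: complex
  assumes rel: "leading_relation P P' a j k b m n"
    and z: "filterlim z (at 0) sequentially" and zr: "\<And>i. z i \<noteq> 0 \<and> norm (z i) < r0"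
    and \<theta>: "(\<lambda>i. sgn (z i)) \<longlonglongrightarrow> \<theta>"
  defines "X \<equiv> \<lambda>i. P (z i) ^ j * norm (z i) ^ k"
    and "Y \<equiv> \<lambda>i. 2 * P' (z i) * of_real (P (z i) ^ m * norm (z i) ^ n)"
  assumes small: "(\<lambda>i. P (z i) ^ Suc m * norm (z i) ^ n / (X i + norm (Y i))) \<longlonglongrightarrow> 0"
  obtains \<phi> :: "nat \<Rightarrow> nat" and x :: real and y :: complex
  where "strict_mono \<phi>"
    and "(\<lambda>i. X (\<phi> i) / (X (\<phi> i) + norm (Y (\<phi> i)))) \<longlonglongrightarrow> x"
    and "(\<lambda>i. Y (\<phi> i) / of_real (X (\<phi> i) + norm (Y (\<phi> i)))) \<longlonglongrightarrow> y"
    and "0 \<le> x" and "x + norm y = 1"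
    and "\<And>\<alpha>::real. Re (of_real x * \<theta> ^ k * a * (\<i> * of_real \<alpha> - 1) ^ j
      + y * \<theta> ^ n * b * (\<i> * of_real \<alpha> - 1) ^ m) = 0"
proof -
  have P0: "0 < P (z i)" for i using zr P_pos by blast
  have X0: "0 < X i" for i using P0 zr by (simp add: X_def)
  obtain \<phi> x y where \<phi>: "strict_mono \<phi>"
    "(\<lambda>i. X (\<phi> i) / (X (\<phi> i) + norm (Y (\<phi> i)))) \<longlonglongrightarrow> x"
    "(\<lambda>i. Y (\<phi> i) / of_real (X (\<phi> i) + norm (Y (\<phi> i)))) \<longlonglongrightarrow> y"
    "0 \<le> x" "x + norm y = 1"
    by (rule normalized_limit[of X Y, OF X0])
  define S where "S i = X (\<phi> i) + norm (Y (\<phi> i))" for i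
  have S: "0 < S i" for i using X0[of "\<phi> i"] by (simp add: S_def add_pos_nonneg)
  have f\<phi>: "filterlim \<phi> sequentially sequentially" by (rule filterlim_subseq[OF \<phi>(1)])
  have z\<phi>: "filterlim (\<lambda>i. z (\<phi> i)) (at 0) sequentially"
    by (rule filterlim_compose[OF z f\<phi>])
  have \<theta>\<phi>: "(\<lambda>i. sgn (z (\<phi> i))) \<longlonglongrightarrow> \<theta>"
    by (rule filterlim_compose[OF \<theta> f\<phi>])
  have small\<phi>: "(\<lambda>i. P (z (\<phi> i)) ^ Suc m * norm (z (\<phi> i)) ^ n / S i) \<longlonglongrightarrow> 0"
    unfolding S_def by (rule filterlim_compose[OF small f\<phi>])
  have "Re (of_real x * \<theta> ^ k * a * (\<i> * of_real \<alpha> - 1) ^ j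
      + y * \<theta> ^ n * b * (\<i> * of_real \<alpha> - 1) ^ m) = 0" for \<alpha> :: real
  proof -
    obtain u w q K where rel':
      "(u \<longlongrightarrow> a * (\<i> * of_real \<alpha> - 1) ^ j) (at 0)" "(w \<longlongrightarrow> b * (\<i> * of_real \<alpha> - 1) ^ m) (at 0)"
      "\<forall>\<^sub>F z in at 0. norm (q z) \<le> K"
      "\<forall>\<^sub>F z in at 0. Re (of_real (P z) ^ j * z ^ k * u z +
        2 * (P' z + of_real (P z) * q z) * (of_real (P z) ^ m * z ^ n * w z)) = 0"
      using rel unfolding leading_relation_def by blast
    define E where "E i = 2 * q (z (\<phi> i)) * of_real (P (z (\<phi> i)) ^ Suc m * norm (z (\<phi> i)) ^ n / S i)" for i
    have u: "(\<lambda>i. u (z (\<phi> i))) \<longlonglongrightarrow> a * (\<i> * of_real \<alpha> - 1) ^ j"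
      by (rule filterlim_compose[OF rel'(1) z\<phi>])
    have w: "(\<lambda>i. w (z (\<phi> i))) \<longlonglongrightarrow> b * (\<i> * of_real \<alpha> - 1) ^ m"
      by (rule filterlim_compose[OF rel'(2) z\<phi>])
    have E: "E \<longlonglongrightarrow> 0"
    proof (rule Lim_null_comparison)
      show "\<forall>\<^sub>F i in sequentially. norm (E i) \<le>
          2 * K * (P (z (\<phi> i)) ^ Suc m * norm (z (\<phi> i)) ^ n / S i)"
        using eventually_compose_filterlim[OF rel'(3) z\<phi>]
      proof eventually_elim
        case (elim i)
        define e where "e = P (z (\<phi> i)) ^ Suc m * norm (z (\<phi> i)) ^ n / S i"
        have "0 \<le> e" unfolding e_def
          using P0[of "\<phi> i"] S[of i] by (intro divide_nonneg_pos mult_nonneg_nonneg zero_le_power) auto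
        then have "norm (E i) = 2 * norm (q (z (\<phi> i))) * e"
          unfolding E_def e_def[symmetric] by (simp add: norm_mult)
        also have "\<dots> \<le> 2 * K * e"
          using elim \<open>0 \<le> e\<close> by (intro mult_right_mono) auto
        finally show ?case by (simp only: e_def)
      qed
      show "(\<lambda>i. 2 * K * (P (z (\<phi> i)) ^ Suc m * norm (z (\<phi> i)) ^ n / S i)) \<longlonglongrightarrow> 0"
        by (rule tendsto_mult_right_zero[OF small\<phi>])
    qed
    define L where "L i = of_real (X (\<phi> i) / S i) * sgn (z (\<phi> i)) ^ k * u (z (\<phi> i))
        + (Y (\<phi> i) / of_real (S i) + E i) * sgn (z (\<phi> i)) ^ n * w (z (\<phi> i))" for i
    have "L \<longlonglongrightarrow> of_real x * \<theta> ^ k * (a * (\<i> * of_real \<alpha> - 1) ^ j)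
        + (y + 0) * \<theta> ^ n * (b * (\<i> * of_real \<alpha> - 1) ^ m)"
      unfolding L_def by (intro tendsto_intros u w E \<theta>\<phi> \<phi>(2,3)[folded S_def])
    then have "(\<lambda>i. Re (L i)) \<longlonglongrightarrow> Re (of_real x * \<theta> ^ k * (a * (\<i> * of_real \<alpha> - 1) ^ j)
        + (y + 0) * \<theta> ^ n * (b * (\<i> * of_real \<alpha> - 1) ^ m))"
      by (rule tendsto_Re)
    moreover have "\<forall>\<^sub>F i in sequentially. Re (L i) = 0"
      using eventually_compose_filterlim[OF rel'(4) z\<phi>]
    proof eventually_elim
      case (elim i)
      define p where "p = P (z (\<phi> i))"
      define r where "r = norm (z (\<phi> i))"
      define s where "s = sgn (z (\<phi> i))"
      have zs: "z (\<phi> i) = of_real r * s"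
        using zr[of "\<phi> i"] by (simp add: r_def s_def sgn_div_norm scaleR_conv_of_real)
      have "of_real (S i) * L i = of_real p ^ j * z (\<phi> i) ^ k * u (z (\<phi> i)) +
        2 * (P' (z (\<phi> i)) + of_real p * q (z (\<phi> i))) * (of_real p ^ m * z (\<phi> i) ^ n * w (z (\<phi> i)))"
      proof -
        have SX: "of_real (S i) * of_real (X (\<phi> i) / S i) = (of_real p ^ j * of_real r ^ k :: complex)"
          using S[of i] by (simp add: X_def p_def r_def)
        have SY: "of_real (S i) * (Y (\<phi> i) / of_real (S i)) =
            2 * P' (z (\<phi> i)) * of_real p ^ m * of_real r ^ n"
          using S[of i] by (simp add: Y_def p_def r_def)
        have SE: "of_real (S i) * E i = 2 * q (z (\<phi> i)) * of_real p ^ Suc m * of_real r ^ n"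
          using S[of i] by (simp add: E_def p_def r_def)
        have "of_real (S i) * L i =
            of_real (S i) * of_real (X (\<phi> i) / S i) * s ^ k * u (z (\<phi> i)) +
            (of_real (S i) * (Y (\<phi> i) / of_real (S i)) + of_real (S i) * E i) * s ^ n * w (z (\<phi> i))"
          unfolding L_def s_def by (simp only: distrib_left distrib_right mult.assoc)
        also have "\<dots> = of_real p ^ j * (of_real r * s) ^ k * u (z (\<phi> i)) +
          2 * (P' (z (\<phi> i)) + of_real p * q (z (\<phi> i))) * (of_real p ^ m * (of_real r * s) ^ n * w (z (\<phi> i)))"
          unfolding SX SY SE power_mult_distrib by (simp add: algebra_simps)
        finally show ?thesis unfolding zs[symmetric] .
      qed
      then have "Re (of_real (S i) * L i) = 0" using elim by (simp only: p_def)
      then have "S i * Re (L i) = 0" by simp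
      then show ?case using S[of i] by simp
    qed
    then have "(\<lambda>i. Re (L i)) \<longlonglongrightarrow> 0" by (rule tendsto_eventually)
    ultimately have "Re (of_real x * \<theta> ^ k * (a * (\<i> * of_real \<alpha> - 1) ^ j)
        + (y + 0) * \<theta> ^ n * (b * (\<i> * of_real \<alpha> - 1) ^ m)) = 0"
      by (rule LIMSEQ_unique)
    then show ?thesis by (simp only: add_0_right mult.assoc)
  qed
  from that[OF \<phi> this] show ?thesis .
qed

text \<open>The second component of a nonzero tangent field does not vanish on the axis \<open>z1 = 0\<close>: its
  order \<open>m\<close> there is not positive. A component that is identically zero is admitted with coefficient
  0, with \<open>j\<close> large in the case of the first component and with \<open>m\<close> at least \<open>j\<close> in that of the
  second.\<close>

lemma no_transversal_order:
  assumes rel: "leading_relation P P' a j k b m n" and jm: "1 \<le> j" "1 \<le> m"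
    and ab: "a \<noteq> 0 \<or> (b \<noteq> 0 \<and> m + 2 \<le> j)" "b \<noteq> 0 \<or> (a \<noteq> 0 \<and> j \<le> m)"
  shows False
proof -
  \<comment> \<open>a direction in which the limiting radial derivative of ln P is negative\<close>
  obtain \<theta> where \<theta>: "norm \<theta> = 1"
    "j = Suc m \<Longrightarrow> k + 1 < n \<Longrightarrow> (- b / a) * \<theta> ^ (n - k - 1) = of_real (norm (b / a))"
  proof (cases "j = Suc m \<and> k + 1 < n")
    case True
    then have "a \<noteq> 0" "b \<noteq> 0" using ab by auto
    then have "- b / a \<noteq> 0" by simp
    moreover have "0 < n - k - 1" using True by simp
    ultimately obtain \<theta> where "norm \<theta> = 1" "(- b / a) * \<theta> ^ (n - k - 1) = of_real (norm (- b / a))"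
      by (rule unit_direction)
    then show ?thesis using that[of \<theta>] by simp
  next
    case False
    then show ?thesis using that[of 1] by auto
  qed
  have \<theta>0: "\<theta> \<noteq> 0" using \<theta>(1) by auto
  obtain \<rho> where \<rho>: "\<And>i. 0 < \<rho> i" "\<And>i. \<rho> i < r0" "\<rho> \<longlonglongrightarrow> 0"
    "filterlim (\<lambda>i. \<rho> i * (2 * Re (P' (of_real (\<rho> i) * \<theta>) * \<theta>) / P (of_real (\<rho> i) * \<theta>))) at_top sequentially"
    by (rule ray_sequence[OF \<theta>(1)], rule that)
  define z where "z i = of_real (\<rho> i) * \<theta>" for i
  define G where "G i = \<rho> i * (2 * Re (P' (z i) * \<theta>) / P (z i))" for i
  have G: "filterlim G at_top sequentially"
    using \<rho>(4) by (simp add: G_def[abs_def] z_def)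
  have nz: "norm (z i) = \<rho> i" for i using \<rho>(1)[of i] \<theta>(1) by (simp add: z_def norm_mult)
  have zr: "z i \<noteq> 0 \<and> norm (z i) < r0" for i
    using \<rho>(1,2)[of i] nz[of i] by auto
  have "z \<longlonglongrightarrow> of_real 0 * \<theta>" unfolding z_def by (intro tendsto_intros \<rho>(3))
  then have z: "filterlim z (at 0) sequentially"
    by (intro filterlim_atI) (use zr in auto)
  have "sgn (z i) = \<theta>" for i
    unfolding z_def by (rule sgn_ray[OF \<rho>(1) \<theta>(1)])
  then have sg: "(\<lambda>i. sgn (z i)) \<longlonglongrightarrow> \<theta>" by simp
  define p where "p i = P (z i)" for i
  define d where "d i = norm (P' (z i))" for i
  have p0: "0 < p i" for i using zr P_pos unfolding p_def by blast
  have p: "p \<longlonglongrightarrow> 0" unfolding p_def by (rule filterlim_compose[OF P_tendsto z])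
  have pflat: "(\<lambda>i. p i / \<rho> i ^ N) \<longlonglongrightarrow> 0" for N
    using filterlim_compose[OF P_flat[of N] z] by (simp add: p_def nz)
  have dflat: "(\<lambda>i. d i / \<rho> i ^ N) \<longlonglongrightarrow> 0" for N
    using filterlim_compose[OF P'_flat[of N] z] by (simp add: d_def nz)
  have evG: "\<forall>\<^sub>F i in sequentially. 0 < G i"
    using G by (simp add: filterlim_at_top_dense)
  have GD: "G i \<le> 2 * \<rho> i * d i / p i" for i
  proof -
    have "Re (P' (z i) * \<theta>) \<le> d i"
      using complex_Re_le_cmod[of "P' (z i) * \<theta>"] \<theta>(1) by (simp add: d_def norm_mult)
    then have "2 * \<rho> i * Re (P' (z i) * \<theta>) / p i \<le> 2 * \<rho> i * d i / p i"
      using \<rho>(1)[of i] p0[of i] by (intro divide_right_mono mult_left_mono) auto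
    then show ?thesis by (simp add: G_def p_def mult_ac del: times_complex.sel)
  qed
  have evd: "\<forall>\<^sub>F i in sequentially. 0 < d i"
    using evG
  proof eventually_elim
    case (elim i)
    then have "d i \<noteq> 0" using GD[of i] by auto
    then show ?case by (simp add: d_def)
  qed
  \<comment> \<open>along the sequence P is negligible against its derivative\<close>
  have pd: "(\<lambda>i. p i / d i) \<longlonglongrightarrow> 0"
  proof (rule Lim_null_comparison)
    show "\<forall>\<^sub>F i in sequentially. norm (p i / d i) \<le> 2 * \<rho> i * inverse (G i)"
      using evG evd
    proof eventually_elim
      case (elim i)
      have "G i * p i \<le> 2 * \<rho> i * d i"
        using GD[of i] p0[of i] by (simp add: pos_le_divide_eq)
      then show ?case using elim p0[of i] by (simp add: field_simps)
    qed
    have "(\<lambda>i. 2 * \<rho> i * inverse (G i)) \<longlonglongrightarrow> 2 * 0 * 0"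
      by (intro tendsto_intros \<rho>(3) filterlim_compose[OF tendsto_inverse_0_at_top G]) (simp add: filterlim_ident)
    then show "(\<lambda>i. 2 * \<rho> i * inverse (G i)) \<longlonglongrightarrow> 0" by simp
  qed
  define X where "X i = p i ^ j * \<rho> i ^ k" for i
  define Y where "Y i = 2 * P' (z i) * of_real (p i ^ m * \<rho> i ^ n)" for i
  have X0: "0 < X i" for i using p0 \<rho>(1) by (simp add: X_def)
  have nY: "norm (Y i) = 2 * d i * (p i ^ m * \<rho> i ^ n)" for i
    using p0[of i] \<rho>(1)[of i] by (simp add: Y_def d_def norm_mult norm_power)
  have S: "0 < X i + norm (Y i)" for i using X0[of i] by (simp add: add_pos_nonneg)
  have small: "(\<lambda>i. p i ^ Suc m * \<rho> i ^ n / (X i + norm (Y i))) \<longlonglongrightarrow> 0"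
  proof (rule Lim_null_comparison[OF _ pd])
    show "\<forall>\<^sub>F i in sequentially. norm (p i ^ Suc m * \<rho> i ^ n / (X i + norm (Y i))) \<le> p i / d i"
      using evd
    proof eventually_elim
      case (elim i)
      define e where "e = p i ^ m * \<rho> i ^ n"
      have e: "0 < e" using p0[of i] \<rho>(1)[of i] by (simp add: e_def)
      have "d i * e \<le> X i + norm (Y i)"
        using X0[of i] e elim unfolding nY e_def[symmetric] by (simp add: add_nonneg_nonneg less_imp_le)
      then have "p i * (d i * e) \<le> p i * (X i + norm (Y i))"
        using p0[of i] by (intro mult_left_mono) auto
      then have "p i * e / (X i + norm (Y i)) \<le> p i / d i"
        using S[of i] elim by (simp add: field_simps)
      then show ?case using S[of i] p0[of i] \<rho>(1)[of i] by (simp add: e_def mult.assoc)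
    qed
  qed
  have small': "(\<lambda>i. P (z i) ^ Suc m * norm (z i) ^ n / (P (z i) ^ j * norm (z i) ^ k
      + norm (2 * P' (z i) * of_real (P (z i) ^ m * norm (z i) ^ n)))) \<longlonglongrightarrow> 0"
    using small by (simp only: X_def Y_def p_def nz)
  obtain \<phi> x y where \<phi>: "strict_mono \<phi>"
    "(\<lambda>i. X (\<phi> i) / (X (\<phi> i) + norm (Y (\<phi> i)))) \<longlonglongrightarrow> x"
    "(\<lambda>i. Y (\<phi> i) / of_real (X (\<phi> i) + norm (Y (\<phi> i)))) \<longlonglongrightarrow> y"
    "0 \<le> x" "x + norm y = 1"
    and lim: "\<And>\<alpha>::real. Re (of_real x * \<theta> ^ k * a * (\<i> * of_real \<alpha> - 1) ^ j
      + y * \<theta> ^ n * b * (\<i> * of_real \<alpha> - 1) ^ m) = 0"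
    by ((rule limit_relation[OF rel z zr sg small'], rule that);
        (unfold X_def Y_def p_def nz[symmetric])?; assumption)
  have f\<phi>: "filterlim \<phi> sequentially sequentially" by (rule filterlim_subseq[OF \<phi>(1)])
  have y0: "y = 0" if YX: "(\<lambda>i. norm (Y i) / X i) \<longlonglongrightarrow> 0"
  proof -
    have "(\<lambda>i. Y (\<phi> i) / of_real (X (\<phi> i) + norm (Y (\<phi> i)))) \<longlonglongrightarrow> 0"
    proof (rule Lim_null_comparison[OF _ filterlim_compose[OF YX f\<phi>]])
      have "norm (Y (\<phi> i) / of_real (X (\<phi> i) + norm (Y (\<phi> i)))) \<le> norm (Y (\<phi> i)) / X (\<phi> i)" for i
        using X0[of "\<phi> i"] S[of "\<phi> i"] unfolding norm_divide norm_of_real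
        by (intro divide_left_mono) (auto simp: mult_pos_pos)
      then show "\<forall>\<^sub>F i in sequentially. norm (Y (\<phi> i) / of_real (X (\<phi> i) + norm (Y (\<phi> i)))) \<le>
          norm (Y (\<phi> i)) / X (\<phi> i)" by simp
    qed
    then show ?thesis using \<phi>(3) LIMSEQ_unique by blast
  qed
  have x0: "x = 0" if XY: "(\<lambda>i. X i / norm (Y i)) \<longlonglongrightarrow> 0"
  proof -
    have "(\<lambda>i. X (\<phi> i) / (X (\<phi> i) + norm (Y (\<phi> i)))) \<longlonglongrightarrow> 0"
    proof (rule Lim_null_comparison[OF _ filterlim_compose[OF XY f\<phi>]])
      show "\<forall>\<^sub>F i in sequentially. norm (X (\<phi> i) / (X (\<phi> i) + norm (Y (\<phi> i)))) \<le>
          X (\<phi> i) / norm (Y (\<phi> i))"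
        using eventually_compose_filterlim[OF evd f\<phi>]
      proof eventually_elim
        case (elim i)
        then have "0 < norm (Y (\<phi> i))" unfolding nY using p0[of "\<phi> i"] \<rho>(1)[of "\<phi> i"] by simp
        moreover have "norm (X (\<phi> i) / (X (\<phi> i) + norm (Y (\<phi> i)))) = X (\<phi> i) / (X (\<phi> i) + norm (Y (\<phi> i)))"
          using X0[of "\<phi> i"] S[of "\<phi> i"] by simp
        ultimately show ?case
          using X0[of "\<phi> i"] S[of "\<phi> i"] by (auto intro!: divide_left_mono)
      qed
    qed
    then show ?thesis using \<phi>(2) LIMSEQ_unique by blast
  qed
  \<comment> \<open>either term may dominate; they balance only for j = m + 1 and k < n\<close>
  consider "j \<le> m" | "m + 2 \<le> j \<or> (j = Suc m \<and> n \<le> k)" | "j = Suc m" "k < n" by linarith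
  then show False
  proof cases
    case 1
    then have a: "a \<noteq> 0" using ab by auto
    have "(\<lambda>i. 2 * (d i / \<rho> i ^ k) * (p i ^ (m - j) * \<rho> i ^ n)) \<longlonglongrightarrow> 2 * 0 * (0 ^ (m - j) * 0 ^ n)"
      by (intro tendsto_intros dflat p \<rho>(3))
    moreover have "norm (Y i) / X i = 2 * (d i / \<rho> i ^ k) * (p i ^ (m - j) * \<rho> i ^ n)" for i
    proof -
      have "p i ^ m = p i ^ j * p i ^ (m - j)" using 1 by (simp add: power_add[symmetric])
      then show ?thesis unfolding nY X_def using p0[of i] \<rho>(1)[of i] by simp
    qed
    ultimately have "(\<lambda>i. norm (Y i) / X i) \<longlonglongrightarrow> 0" by simp
    then have "y = 0" "x = 1" using y0 \<phi>(5) by auto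
    then have "\<theta> ^ k * a = 0"
      by (intro power_line_single[OF _ jm(1)]) (use lim in simp)
    then show False using a \<theta>0 by simp
  next
    case 2
    then have b: "b \<noteq> 0" using ab by auto
    have "(\<lambda>i. X i / norm (Y i)) \<longlonglongrightarrow> 0"
    proof (cases "m + 2 \<le> j")
      case True
      have "(\<lambda>i. (p i / d i) * (p i / \<rho> i ^ n) * (p i ^ (j - m - 2) * \<rho> i ^ k) / 2) \<longlonglongrightarrow>
          0 * 0 * (0 ^ (j - m - 2) * 0 ^ k) / 2"
        by (intro tendsto_intros pd pflat p \<rho>(3)) simp
      moreover have "X i / norm (Y i) = (p i / d i) * (p i / \<rho> i ^ n) * (p i ^ (j - m - 2) * \<rho> i ^ k) / 2" for i
      proof -
        obtain l where l: "j = m + 2 + l" using True le_Suc_ex by blast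
        show ?thesis unfolding nY X_def l using p0[of i] \<rho>(1)[of i]
          by (simp add: power_add power2_eq_square)
      qed
      ultimately show ?thesis by simp
    next
      case False
      then have j: "j = Suc m" "n \<le> k" using 2 by auto
      have "(\<lambda>i. (p i / d i) * \<rho> i ^ (k - n) / 2) \<longlonglongrightarrow> 0 * 0 ^ (k - n) / 2"
        by (intro tendsto_intros pd \<rho>(3)) simp
      moreover have "X i / norm (Y i) = (p i / d i) * \<rho> i ^ (k - n) / 2" for i
      proof -
        obtain l where l: "k = n + l" using j le_Suc_ex by blast
        show ?thesis unfolding nY X_def l j using p0[of i] \<rho>(1)[of i]
          by (simp add: power_add)
      qed
      ultimately show ?thesis by simp
    qed
    then have x: "x = 0" "norm y = 1" using x0 \<phi>(5) by auto
    then have "y * \<theta> ^ n * b = 0"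
      by (intro power_line_single[OF _ jm(2)]) (use lim in simp)
    then show False using b \<theta>0 x by auto
  next
    case 3
    then have a: "a \<noteq> 0" and b: "b \<noteq> 0" using ab by auto
    have yx: "y * \<theta> ^ n * b = 2 * (of_real x * \<theta> ^ k * a)"
      by (rule power_line_pair[OF _ jm(2)]) (use lim 3 in simp)
    have x: "x \<noteq> 0"
    proof
      assume "x = 0"
      then have "y = 0" using yx \<theta>0 b by simp
      then show False using \<open>x = 0\<close> \<phi>(5) by simp
    qed
    have "(\<lambda>i. (Y (\<phi> i) / of_real (X (\<phi> i) + norm (Y (\<phi> i)))) /
        of_real (X (\<phi> i) / (X (\<phi> i) + norm (Y (\<phi> i))))) \<longlonglongrightarrow> y / of_real x"
      by (intro tendsto_intros \<phi>(2,3)) (use x in simp)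
    moreover have "(Y (\<phi> i) / of_real (X (\<phi> i) + norm (Y (\<phi> i)))) /
        of_real (X (\<phi> i) / (X (\<phi> i) + norm (Y (\<phi> i)))) = Y (\<phi> i) / of_real (X (\<phi> i))" for i
      using S[of "\<phi> i"] X0[of "\<phi> i"]
      by (simp del: of_real_add)
    ultimately have YX: "(\<lambda>i. Re (\<theta> * (Y (\<phi> i) / of_real (X (\<phi> i))))) \<longlonglongrightarrow> Re (\<theta> * (y / of_real x))"
      by (simp only: tendsto_Re tendsto_mult_left)
    obtain N where N: "n = Suc (k + N)" using 3 less_iff_Suc_add by auto
    have GY: "G i * \<rho> i ^ N = Re (\<theta> * (Y i / of_real (X i)))" for i
    proof -
      have "Y i / of_real (X i) = of_real (2 * \<rho> i ^ Suc N / p i) * P' (z i)"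
        unfolding Y_def X_def N 3 using p0[of i] \<rho>(1)[of i] by (simp add: power_add)
      then have "\<theta> * (Y i / of_real (X i)) = of_real (2 * \<rho> i ^ Suc N / p i) * (P' (z i) * \<theta>)"
        by (simp add: mult_ac)
      then have "Re (\<theta> * (Y i / of_real (X i))) = 2 * \<rho> i ^ Suc N / p i * Re (P' (z i) * \<theta>)"
        by (metis scaleR_conv_of_real scaleR_complex.sel(1))
      then show ?thesis by (simp add: G_def p_def)
    qed
    have G\<phi>: "filterlim (\<lambda>i. G (\<phi> i)) at_top sequentially"
      by (rule filterlim_compose[OF G f\<phi>])
    have lim_val: "\<theta> * (y / of_real x) = 2 * a / (b * \<theta> ^ N)"
    proof -
      have "y * (\<theta> ^ k * (\<theta> * \<theta> ^ N)) * b = 2 * of_real x * \<theta> ^ k * a"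
        using yx by (simp add: N power_add mult_ac)
      then have "\<theta> ^ k * (y * \<theta> * (b * \<theta> ^ N)) = \<theta> ^ k * (2 * a * of_real x)" by (simp add: mult_ac)
      then have "y * \<theta> * (b * \<theta> ^ N) = 2 * a * of_real x" using \<theta>0 by simp
      then show ?thesis using x b \<theta>0 by (simp add: divide_simps mult_ac)
    qed
    show False
    proof (cases "N = 0")
      case True
      then have "(\<lambda>i. G (\<phi> i)) \<longlonglongrightarrow> Re (\<theta> * (y / of_real x))" using YX GY by simp
      then show False
        using G\<phi> not_tendsto_and_filterlim_at_infinity filterlim_at_top_imp_at_infinity
        by (metis sequentially_bot)
    next
      case False
      have "(- b / a) * \<theta> ^ N = of_real (norm (b / a))" using \<theta>(2) 3 False N by simp
      then have "- (b * \<theta> ^ N) = a * of_real (norm (b / a))"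
        using a by (simp add: field_simps)
      then have "b * \<theta> ^ N = - a * of_real (norm (b / a))"
        by (metis minus_minus minus_mult_left)
      then have "\<theta> * (y / of_real x) = of_real (- 2 / norm (b / a))"
        unfolding lim_val using a by simp
      then have "Re (\<theta> * (y / of_real x)) < 0" using a b by simp
      then have "\<forall>\<^sub>F i in sequentially. Re (\<theta> * (Y (\<phi> i) / of_real (X (\<phi> i)))) < 0"
        by (rule order_tendstoD(2)[OF YX])
      moreover have "\<forall>\<^sub>F i in sequentially. 0 < G (\<phi> i)"
        using G\<phi> by (simp add: filterlim_at_top_dense)
      ultimately have "\<forall>\<^sub>F i in sequentially. False"
      proof eventually_elim
        case (elim i)
        then show ?case using GY[of "\<phi> i"] \<rho>(1)[of "\<phi> i"]
          by (metis mult_pos_pos not_less_iff_gr_or_eq zero_less_power)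
      qed
      then show False by simp
    qed
  qed
qed

section \<open>Sectors\<close>

text \<open>With \<open>m = 0\<close> and \<open>j = 1\<close>, comparing the parameters \<open>\<alpha> = 0\<close> and \<open>\<alpha> = 1\<close> in directions where
  \<open>a z^k\<close> is not real shows that \<open>P'\<close> dominates all other terms, and that \<open>b z^n P'\<close> is
  asymptotically imaginary.\<close>

lemma sector_limit:
  fixes z :: "nat \<Rightarrow> complex"
  assumes rel: "leading_relation P P' a 1 k b 0 n" and kn: "k < n"
    and z: "filterlim z (at 0) sequentially" and zr: "\<And>i. z i \<noteq> 0 \<and> norm (z i) < r0"
    and \<theta>: "(\<lambda>i. sgn (z i)) \<longlonglongrightarrow> \<theta>" "Im (a * \<theta> ^ k) \<noteq> 0"
  obtains \<phi> :: "nat \<Rightarrow> nat" and c :: "nat \<Rightarrow> real" and y :: complex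
  where "strict_mono \<phi>" and "\<And>i. 0 < c i"
    and "(\<lambda>i. of_real (c i) * P' (z (\<phi> i))) \<longlonglongrightarrow> y"
    and "norm y = 1" and "Re (b * \<theta> ^ n * y) = 0"
proof -
  define X where "X i = P (z i) ^ 1 * norm (z i) ^ k" for i
  define Y where "Y i = 2 * P' (z i) * of_real (P (z i) ^ 0 * norm (z i) ^ n)" for i
  have P0: "0 < P (z i)" for i using zr P_pos by blast
  have X0: "0 < X i" for i using P0 zr by (simp add: X_def)
  have S: "0 < X i + norm (Y i)" for i using X0[of i] by (simp add: add_pos_nonneg)
  have "(\<lambda>i. norm (z i)) \<longlonglongrightarrow> 0"
    using z tendsto_norm_zero unfolding filterlim_at by blast
  then have "(\<lambda>i. norm (z i) ^ (n - k)) \<longlonglongrightarrow> 0 ^ (n - k)" by (rule tendsto_power)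
  then have nk: "(\<lambda>i. norm (z i) ^ (n - k)) \<longlonglongrightarrow> 0" using kn by (simp add: power_0_left)
  have small: "(\<lambda>i. P (z i) ^ Suc 0 * norm (z i) ^ n / (X i + norm (Y i))) \<longlonglongrightarrow> 0"
  proof (rule Lim_null_comparison[OF _ nk])
    have "norm (P (z i) ^ Suc 0 * norm (z i) ^ n / (X i + norm (Y i))) \<le> norm (z i) ^ (n - k)" for i
    proof -
      have "P (z i) * norm (z i) ^ n = X i * norm (z i) ^ (n - k)"
        using kn by (simp add: X_def power_add[symmetric])
      also have "\<dots> \<le> (X i + norm (Y i)) * norm (z i) ^ (n - k)"
        by (intro mult_right_mono) auto
      finally have "P (z i) * norm (z i) ^ n / (X i + norm (Y i)) \<le> norm (z i) ^ (n - k)"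
        using S[of i] by (simp add: pos_divide_le_eq mult.commute)
      then show ?thesis using S[of i] P0[of i] by simp
    qed
    then show "\<forall>\<^sub>F i in sequentially. norm (P (z i) ^ Suc 0 * norm (z i) ^ n / (X i + norm (Y i)))
        \<le> norm (z i) ^ (n - k)" by simp
  qed
  obtain \<phi> x y where \<phi>: "strict_mono \<phi>"
    "(\<lambda>i. X (\<phi> i) / (X (\<phi> i) + norm (Y (\<phi> i)))) \<longlonglongrightarrow> x"
    "(\<lambda>i. Y (\<phi> i) / of_real (X (\<phi> i) + norm (Y (\<phi> i)))) \<longlonglongrightarrow> y"
    "0 \<le> x" "x + norm y = 1"
    and lim: "\<And>\<alpha>::real. Re (of_real x * \<theta> ^ k * a * (\<i> * of_real \<alpha> - 1) ^ 1
      + y * \<theta> ^ n * b * (\<i> * of_real \<alpha> - 1) ^ 0) = 0"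
    by ((rule limit_relation[OF rel z zr \<theta>(1) small[unfolded X_def Y_def]], rule that);
        (unfold X_def Y_def)?; assumption)
  have "Re (of_real x * \<theta> ^ k * a * (\<i> - 1) + y * \<theta> ^ n * b) = 0"
    using lim[of 1] by simp
  moreover have "Re (of_real x * \<theta> ^ k * a * (- 1) + y * \<theta> ^ n * b) = 0"
    using lim[of 0] by simp
  moreover have "(of_real x * \<theta> ^ k * a * (\<i> - 1) + y * \<theta> ^ n * b) -
      (of_real x * \<theta> ^ k * a * (- 1) + y * \<theta> ^ n * b) = of_real x * (a * \<theta> ^ k) * \<i>"
    by (simp add: algebra_simps)
  ultimately have "Re (of_real x * (a * \<theta> ^ k) * \<i>) = 0"
    by (metis minus_complex.sel(1) diff_zero)
  moreover have "Re (of_real x * w * \<i>) = - (x * Im w)" for w by simp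
  ultimately have "x * Im (a * \<theta> ^ k) = 0" by (simp only: neg_equal_0_iff_equal)
  then have x: "x = 0" using \<theta>(2) by simp
  then have "Re (b * \<theta> ^ n * y) = 0" using lim[of 0] by (simp add: mult_ac)
  moreover have "norm y = 1" using x \<phi>(5) by simp
  moreover define c where "c i = 2 * norm (z (\<phi> i)) ^ n / (X (\<phi> i) + norm (Y (\<phi> i)))" for i
  have "0 < c i" for i using zr[of "\<phi> i"] S[of "\<phi> i"] by (simp add: c_def)
  moreover have "Y (\<phi> i) / of_real (X (\<phi> i) + norm (Y (\<phi> i))) = of_real (c i) * P' (z (\<phi> i))" for i
    by (simp add: c_def Y_def)
  ultimately show ?thesis
    using \<phi>(1,3) by (intro that) auto
qed

text \<open>Near a direction in which \<open>b z^(n-1)\<close> is real but \<open>a z^k\<close> is not, \<open>b z^n P'\<close> is nearly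
  imaginary and of constant sign, so the sign of the radial derivative of \<open>P\<close> changes with the sign
  of \<open>Im (b z^(n-1))\<close>. Thus \<open>P\<close> would decrease along rays on one side of that direction.\<close>

lemma sector_contradiction:
  assumes rel: "leading_relation P P' a 1 k b 0 n" and kn: "k + 1 < n" and b: "b \<noteq> 0"
    and \<theta>0: "norm \<theta>0 = 1" "b * \<theta>0 ^ (n - 1) \<in> \<real>" "Im (a * \<theta>0 ^ k) \<noteq> 0"
  shows False
proof -
  define N where "N = n - 1"
  have N: "n = Suc N" "0 < N" "k < n" using kn by (auto simp: N_def)
  obtain g where g: "b * \<theta>0 ^ N = of_real g" using \<theta>0(2) by (auto simp: N_def elim: Reals_cases)
  have \<theta>00: "\<theta>0 \<noteq> 0" using \<theta>0(1) by auto
  have g0: "g \<noteq> 0" using g b \<theta>00 by auto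
  define dir where "dir t = \<theta>0 * cis t" for t
  have dir: "norm (dir t) = 1" for t using \<theta>0(1) by (simp add: dir_def norm_mult)
  have cont_dir: "continuous_on A dir" for A
    unfolding dir_def by (intro continuous_intros)
  obtain \<tau> where \<tau>: "0 < \<tau>" "real N * \<tau> < pi" "\<And>t. \<bar>t\<bar> \<le> \<tau> \<Longrightarrow> Im (a * dir t ^ k) \<noteq> 0"
  proof -
    have "((\<lambda>t. Im (a * dir t ^ k)) \<longlongrightarrow> Im (a * (\<theta>0 * cis 0) ^ k)) (nhds 0)"
      unfolding dir_def by (intro tendsto_intros tendsto_cis filterlim_ident)
    then have "((\<lambda>t. Im (a * dir t ^ k)) \<longlongrightarrow> Im (a * \<theta>0 ^ k)) (nhds 0)" by simp
    then have "\<forall>\<^sub>F t in nhds 0. Im (a * dir t ^ k) \<noteq> 0"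
      by (rule tendsto_imp_eventually_ne) (use \<theta>0 in auto)
    then obtain e where e: "0 < e" "\<And>t. \<bar>t\<bar> < e \<Longrightarrow> Im (a * dir t ^ k) \<noteq> 0"
      by (auto simp: eventually_nhds_metric dist_real_def)
    have pN: "0 < pi / real N" using N by simp
    define \<tau> where "\<tau> = min (e / 2) (pi / real N / 2)"
    have "0 < \<tau>" "\<tau> < e" "\<tau> < pi / real N" using e pN by (auto simp: \<tau>_def)
    then show ?thesis using that[of \<tau>] e N(2) by (simp add: field_simps)
  qed
  define W where "W z = Im (b * z ^ n * P' z)" for z
  \<comment> \<open>the imaginary part of B P' does not vanish near 0 in the sector\<close>
  have "\<exists>\<delta>>0. \<forall>\<rho> t. 0 < \<rho> \<longrightarrow> \<rho> < \<delta> \<longrightarrow> \<bar>t\<bar> \<le> \<tau> \<longrightarrow> W (of_real \<rho> * dir t) \<noteq> 0"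
  proof (rule ccontr)
    assume *: "\<not> ?thesis"
    have "\<exists>\<rho> t. 0 < \<rho> \<and> \<rho> < r0 / real (Suc i) \<and> \<bar>t\<bar> \<le> \<tau> \<and> W (of_real \<rho> * dir t) = 0" for i
    proof -
      have "0 < r0 / real (Suc i)" using r0 by simp
      then show ?thesis using * by blast
    qed
    then obtain \<rho> t where \<rho>: "\<And>i. 0 < \<rho> i" "\<And>i. \<rho> i < r0 / real (Suc i)" "\<And>i. \<bar>t i\<bar> \<le> \<tau>"
      "\<And>i::nat. W (of_real (\<rho> i) * dir (t i)) = 0"
      by metis
    have "(\<lambda>i. r0 * inverse (real (Suc i))) \<longlonglongrightarrow> r0 * 0"
      by (intro tendsto_intros LIMSEQ_inverse_real_of_nat)
    then have "(\<lambda>i. r0 / real (Suc i)) \<longlonglongrightarrow> 0" by (simp add: divide_inverse)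
    then have \<rho>lim: "\<rho> \<longlonglongrightarrow> 0"
      by (rule Lim_null_comparison[rotated])
        (use \<rho>(1,2) in \<open>auto intro!: always_eventually simp: abs_of_pos less_imp_le simp del: of_nat_Suc\<close>)
    have \<rho>r: "\<rho> i < r0" for i
    proof -
      have "r0 / real (Suc i) \<le> r0" using r0 by (simp add: field_simps)
      then show ?thesis using \<rho>(2)[of i] by linarith
    qed
    have "t i \<in> {-\<tau>..\<tau>}" for i using \<rho>(3)[of i] by (simp add: abs_le_iff)
    then obtain s \<psi> where \<psi>: "s \<in> {-\<tau>..\<tau>}" "strict_mono \<psi>" "(t \<circ> \<psi>) \<longlonglongrightarrow> s"
      using compact_Icc[of "-\<tau>" \<tau>] unfolding compact_def by metis
    define z where "z i = of_real (\<rho> (\<psi> i)) * dir (t (\<psi> i))" for i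
    have nz: "norm (z i) = \<rho> (\<psi> i)" for i using \<rho>(1)[of "\<psi> i"] by (simp add: z_def norm_mult dir)
    have sg: "sgn (z i) = dir (t (\<psi> i))" for i
      unfolding z_def by (rule sgn_ray[OF \<rho>(1) dir])
    have zr: "z i \<noteq> 0 \<and> norm (z i) < r0" for i
      using nz[of i] \<rho>(1)[of "\<psi> i"] \<rho>r[of "\<psi> i"] by auto
    have "(\<lambda>i. \<rho> (\<psi> i)) \<longlonglongrightarrow> 0"
      by (rule filterlim_compose[OF \<rho>lim filterlim_subseq[OF \<psi>(2)]])
    then have "(\<lambda>i. norm (z i)) \<longlonglongrightarrow> 0" by (simp add: nz)
    then have z: "filterlim z (at 0) sequentially"
      by (intro filterlim_atI) (use zr in \<open>auto simp: tendsto_norm_zero_iff\<close>)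
    have "(\<lambda>i. dir (t (\<psi> i))) \<longlonglongrightarrow> dir s"
      using \<psi>(3) unfolding dir_def o_def by (intro tendsto_intros)
    then have sgl: "(\<lambda>i. sgn (z i)) \<longlonglongrightarrow> dir s" by (simp add: sg)
    have Im: "Im (a * dir s ^ k) \<noteq> 0" using \<psi>(1) by (intro \<tau>(3)) auto
    obtain \<phi> c y where \<phi>: "strict_mono \<phi>" "\<And>i. 0 < c i"
      "(\<lambda>i. of_real (c i) * P' (z (\<phi> i))) \<longlonglongrightarrow> y" "norm y = 1" "Re (b * dir s ^ n * y) = 0"
      by (rule sector_limit[OF rel N(3) z zr sgl Im], rule that)
    have "(\<lambda>i. sgn (z (\<phi> i))) \<longlonglongrightarrow> dir s"
      by (rule filterlim_compose[OF sgl filterlim_subseq[OF \<phi>(1)]])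
    then have "(\<lambda>i. Im (b * sgn (z (\<phi> i)) ^ n * (of_real (c i) * P' (z (\<phi> i))))) \<longlonglongrightarrow> Im (b * dir s ^ n * y)"
      by (intro tendsto_intros \<phi>(3))
    moreover have "Im (b * sgn (z (\<phi> i)) ^ n * (of_real (c i) * P' (z (\<phi> i)))) = 0" for i
    proof -
      define w where "w = z (\<phi> i)"
      have "b * sgn w ^ n * (of_real (c i) * P' w) = of_real (c i / norm w ^ n) * (b * w ^ n * P' w)"
        using zr[of "\<phi> i"] by (simp add: w_def[symmetric] sgn_eq power_divide)
      moreover have "W w = 0" using \<rho>(4) by (simp add: w_def z_def)
      ultimately show ?thesis
        unfolding w_def[symmetric] W_def by (metis mult_zero_right scaleR_complex.sel(2) scaleR_conv_of_real)
    qed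
    ultimately have "Im (b * dir s ^ n * y) = 0" by (simp add: LIMSEQ_const_iff)
    then have "b * dir s ^ n * y = 0" using \<phi>(5) by (simp only: complex_eq_iff zero_complex.sel)
    then have "y = 0" using b dir[of s] by auto
    then show False using \<phi>(4) by simp
  qed
  then obtain \<delta> where \<delta>: "0 < \<delta>" "\<And>\<rho> t. 0 < \<rho> \<Longrightarrow> \<rho> < \<delta> \<Longrightarrow> \<bar>t\<bar> \<le> \<tau> \<Longrightarrow> W (of_real \<rho> * dir t) \<noteq> 0"
    by blast
  \<comment> \<open>hence it has constant sign there\<close>
  define D where "D = {0<..<min \<delta> r0} \<times> {-\<tau>..\<tau>}"
  define f where "f q = W (of_real (fst q) * dir (snd q))" for q :: "real \<times> real"
  have Dnz: "f q \<noteq> 0" if "q \<in> D" for q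
    using that unfolding f_def by (intro \<delta>(2)) (auto simp: D_def)
  have "continuous_on D f"
  proof -
    have c1: "continuous_on D (\<lambda>q. of_real (fst q) * dir (snd q))"
      unfolding dir_def by (intro continuous_intros)
    have "(\<lambda>q. of_real (fst q) * dir (snd q)) ` D \<subseteq> ball 0 r0"
      by (auto simp: D_def norm_mult dir)
    then have "continuous_on D (\<lambda>q. P' (of_real (fst q) * dir (snd q)))"
      using continuous_on_compose2[OF P'_cont c1] by blast
    then show ?thesis unfolding f_def W_def by (intro continuous_intros c1)
  qed
  moreover have "connected D"
    unfolding D_def by (intro connected_Times) auto
  ultimately have "connected (f ` D)" by (rule connected_continuous_image)
  then have "(\<forall>q\<in>D. 0 < f q) \<or> (\<forall>q\<in>D. f q < 0)"
  proof -
    assume con: "connected (f ` D)"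
    show ?thesis
    proof (rule ccontr)
      assume "\<not> ?thesis"
      then obtain p q where pq: "p \<in> D" "q \<in> D" "f p \<le> 0" "0 \<le> f q" by (auto simp: not_less)
      then have "0 \<in> f ` D"
        using connectedD_interval[OF con, of "f p" "f q" 0] by auto
      then show False using Dnz by auto
    qed
  qed
  then obtain \<sigma> :: real where \<sigma>: "\<sigma> \<noteq> 0" "\<And>q. q \<in> D \<Longrightarrow> 0 < \<sigma> * f q"
  proof
    assume "\<forall>q\<in>D. 0 < f q" then show ?thesis using that[of 1] by simp
  next
    assume "\<forall>q\<in>D. f q < 0" then show ?thesis using that[of "-1"] by simp
  qed
  \<comment> \<open>on each ray of the sector P increases infinitely often, which forces a sign on its direction\<close>
  have ray: "0 < \<sigma> * (g * sin (real N * s))" if s: "\<bar>s\<bar> \<le> \<tau>" "sin (real N * s) \<noteq> 0" for s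
  proof -
    define \<theta> where "\<theta> = dir s"
    have n\<theta>: "norm \<theta> = 1" by (simp add: \<theta>_def dir)
    then have \<theta>nz: "\<theta> \<noteq> 0" by auto
    obtain \<rho> where \<rho>: "\<And>i. 0 < \<rho> i" "\<And>i. \<rho> i < r0" "\<rho> \<longlonglongrightarrow> 0"
      "filterlim (\<lambda>i. \<rho> i * (2 * Re (P' (of_real (\<rho> i) * \<theta>) * \<theta>) / P (of_real (\<rho> i) * \<theta>))) at_top sequentially"
      by (rule ray_sequence[OF n\<theta>], rule that)
    define z where "z i = of_real (\<rho> i) * \<theta>" for i
    have nz: "norm (z i) = \<rho> i" for i using \<rho>(1)[of i] by (simp add: z_def norm_mult n\<theta>)
    have zr: "z i \<noteq> 0 \<and> norm (z i) < r0" for i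
      using nz[of i] \<rho>(1,2)[of i] by auto
    have "(\<lambda>i. norm (z i)) \<longlonglongrightarrow> 0" using \<rho>(3) by (simp add: nz)
    then have z: "filterlim z (at 0) sequentially"
      by (intro filterlim_atI) (use zr in \<open>auto simp: tendsto_norm_zero_iff\<close>)
    have "sgn (z i) = \<theta>" for i
      unfolding z_def by (rule sgn_ray[OF \<rho>(1) n\<theta>])
    then have sg: "(\<lambda>i. sgn (z i)) \<longlonglongrightarrow> \<theta>" by simp
    have Im: "Im (a * \<theta> ^ k) \<noteq> 0" unfolding \<theta>_def by (rule \<tau>(3)[OF s(1)])
    obtain \<phi> c y where \<phi>: "strict_mono \<phi>" "\<And>i. 0 < c i"
      "(\<lambda>i. of_real (c i) * P' (z (\<phi> i))) \<longlonglongrightarrow> y" "norm y = 1" "Re (b * \<theta> ^ n * y) = 0"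
      by (rule sector_limit[OF rel N(3) z zr sg Im], rule that)
    have f\<phi>: "filterlim \<phi> sequentially sequentially" by (rule filterlim_subseq[OF \<phi>(1)])
    have z\<phi>: "filterlim (\<lambda>i. \<rho> (\<phi> i)) (nhds 0) sequentially"
      by (rule filterlim_compose[OF \<rho>(3) f\<phi>])
    define \<kappa> where "\<kappa> = Im (b * \<theta> ^ n * y)"
    have \<kappa>: "b * \<theta> ^ n * y = \<i> * of_real \<kappa>"
      using \<phi>(5) by (simp only: complex_eq_iff \<kappa>_def) simp
    have ynz: "y \<noteq> 0" using \<phi>(4) by auto
    have \<kappa>0: "\<kappa> \<noteq> 0"
      using \<kappa> b \<theta>nz ynz by auto
    have "0 \<le> \<sigma> * \<kappa>"
    proof (rule tendsto_lowerbound)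
      show "(\<lambda>i. \<sigma> * Im (b * \<theta> ^ n * (of_real (c i) * P' (z (\<phi> i))))) \<longlonglongrightarrow> \<sigma> * \<kappa>"
        unfolding \<kappa>_def by (intro tendsto_intros \<phi>(3))
      have "\<forall>\<^sub>F i in sequentially. \<rho> (\<phi> i) < min \<delta> r0"
        by (rule order_tendstoD(2)[OF z\<phi>]) (use \<delta>(1) r0 in simp)
      then show "\<forall>\<^sub>F i in sequentially. 0 \<le> \<sigma> * Im (b * \<theta> ^ n * (of_real (c i) * P' (z (\<phi> i))))"
      proof eventually_elim
        case (elim i)
        define r where "r = \<rho> (\<phi> i)"
        have r: "0 < r" using \<rho>(1) by (simp add: r_def)
        have "(r, s) \<in> D" using elim r s by (auto simp: D_def r_def abs_le_iff)
        then have "0 < \<sigma> * W (of_real r * \<theta>)" using \<sigma>(2)[of "(r, s)"] by (simp add: f_def \<theta>_def)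
        then have p: "0 < (c i / r ^ n) * (\<sigma> * W (of_real r * \<theta>))"
          using r \<phi>(2)[of i] by simp
        have "b * \<theta> ^ n * (of_real (c i) * P' (z (\<phi> i))) =
            of_real (c i / r ^ n) * (b * (of_real r * \<theta>) ^ n * P' (of_real r * \<theta>))"
          using r by (simp add: z_def r_def[symmetric] power_mult_distrib)
        then have "Im (b * \<theta> ^ n * (of_real (c i) * P' (z (\<phi> i)))) = c i / r ^ n * W (of_real r * \<theta>)"
          unfolding W_def by (metis scaleR_complex.sel(2) scaleR_conv_of_real)
        then show ?case using p by (simp only: mult.left_commute less_imp_le)
      qed
    qed simp
    then have \<sigma>\<kappa>: "0 < \<sigma> * \<kappa>" using \<sigma>(1) \<kappa>0 by (simp add: less_le)
    have "0 \<le> Re (y * \<theta>)"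
    proof (rule tendsto_lowerbound)
      show "(\<lambda>i. Re (of_real (c i) * P' (z (\<phi> i)) * \<theta>)) \<longlonglongrightarrow> Re (y * \<theta>)"
        by (intro tendsto_intros \<phi>(3))
      have "\<forall>\<^sub>F i in sequentially. 0 < \<rho> (\<phi> i) * (2 * Re (P' (z (\<phi> i)) * \<theta>) / P (z (\<phi> i)))"
        using filterlim_compose[OF \<rho>(4) f\<phi>] by (simp add: filterlim_at_top_dense z_def)
      then show "\<forall>\<^sub>F i in sequentially. 0 \<le> Re (of_real (c i) * P' (z (\<phi> i)) * \<theta>)"
      proof eventually_elim
        case (elim i)
        have "0 < P (z (\<phi> i))" using zr P_pos by blast
        then have "0 < Re (P' (z (\<phi> i)) * \<theta>)"
          using elim \<rho>(1)[of "\<phi> i"] by (simp add: zero_less_mult_iff zero_less_divide_iff del: times_complex.sel)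
        then have "0 < c i * Re (P' (z (\<phi> i)) * \<theta>)" using \<phi>(2)[of i] by simp
        moreover have "Re (of_real (c i) * P' (z (\<phi> i)) * \<theta>) = c i * Re (P' (z (\<phi> i)) * \<theta>)"
          by (metis mult.assoc scaleR_complex.sel(1) scaleR_conv_of_real)
        ultimately show ?case by linarith
      qed
    qed simp
    moreover have "g * Re (y * \<theta>) = \<kappa> * sin (real N * s) * 1"
    proof -
      have gs: "b * \<theta> ^ N = of_real g * cis (real N * s)"
        using g by (simp add: \<theta>_def dir_def power_mult_distrib Complex.DeMoivre mult.assoc[symmetric])
      have "(of_real g * cis (real N * s)) * (y * \<theta>) = \<i> * of_real \<kappa>"
        using \<kappa> unfolding gs[symmetric] N(1) by (simp add: mult_ac)
      then have "cis (- (real N * s)) * ((of_real g * cis (real N * s)) * (y * \<theta>)) = cis (- (real N * s)) * (\<i> * of_real \<kappa>)"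
        by simp
      moreover have "cis (- (real N * s)) * ((of_real g * cis (real N * s)) * (y * \<theta>)) = of_real g * (y * \<theta>)"
      proof -
        have "cis (- (real N * s)) * cis (real N * s) = 1" by (simp add: cis_mult)
        then show ?thesis by (metis mult.assoc mult.left_commute mult.left_neutral)
      qed
      ultimately have "of_real g * (y * \<theta>) = cis (- (real N * s)) * (\<i> * of_real \<kappa>)" by simp
      then have "Re (of_real g * (y * \<theta>)) = Re (cis (- (real N * s)) * (\<i> * of_real \<kappa>))" by simp
      moreover have "Re (of_real g * (y * \<theta>)) = g * Re (y * \<theta>)"
        by (metis scaleR_complex.sel(1) scaleR_conv_of_real)
      ultimately show ?thesis by simp
    qed
    ultimately have "0 \<le> g * (\<kappa> * sin (real N * s))"
      by (metis mult.right_neutral mult.left_commute zero_le_mult_iff zero_le_square mult.assoc mult_nonneg_nonneg)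
    then have "0 \<le> (g * (\<kappa> * sin (real N * s))) * \<sigma>\<^sup>2" by simp
    then have "0 \<le> (\<sigma> * \<kappa>) * (\<sigma> * (g * sin (real N * s)))" by (simp add: power2_eq_square mult_ac)
    then have "0 \<le> \<sigma> * (g * sin (real N * s))" using \<sigma>\<kappa> by (simp add: zero_le_mult_iff)
    moreover have "\<sigma> * (g * sin (real N * s)) \<noteq> 0" using \<sigma>(1) g0 s(2) by simp
    ultimately show ?thesis by linarith
  qed
  have "0 < sin (real N * \<tau>)" using \<tau> N(2) by (intro sin_gt_zero) auto
  then have "0 < \<sigma> * (g * sin (real N * \<tau>))" "0 < \<sigma> * (g * sin (real N * (-\<tau>)))"
    using \<tau>(1) by (intro ray; simp)+
  then show False by simp
qed

section \<open>Vector fields tangent along slices\<close>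

text \<open>\<open>h\<close> has the leading term \<open>a z1^j z2^k\<close> along every curve \<open>z1 = P(z) \<zeta>(z), z2 = z\<close> with
  convergent \<open>\<zeta>\<close>. The value \<open>a = 0\<close> is allowed, and covers the zero germ with any orders.\<close>

definition has_leading :: "(complex \<times> complex \<Rightarrow> complex) \<Rightarrow> complex \<Rightarrow> nat \<Rightarrow> nat \<Rightarrow> bool"
  where "has_leading h a j k \<longleftrightarrow> (\<forall>\<zeta> L. (\<zeta> \<longlongrightarrow> L) (at 0) \<longrightarrow>
    (\<exists>u. (u \<longlongrightarrow> a * L ^ j) (at 0) \<and>
      (\<forall>\<^sub>F z in at 0. h (of_real (P z) * \<zeta> z, z) = of_real (P z) ^ j * z ^ k * u z)))"

text \<open>Tangency of the field \<open>(h1, h2)\<close>, with the hypersurface parametrized by \<open>z\<close> along the slices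
  \<open>Im z1 = \<alpha> P(z)\<close>. On such a slice \<open>z1 = P \<zeta>\<close> with \<open>\<zeta>\<close> close to \<open>\<i> \<alpha> - 1\<close>; for \<open>\<alpha> = 0\<close> this is
  exact.\<close>

definition tangential :: "(complex \<times> complex \<Rightarrow> complex) \<Rightarrow> (complex \<times> complex \<Rightarrow> complex) \<Rightarrow> bool"
  where "tangential h1 h2 \<longleftrightarrow> (\<forall>\<alpha>::real. \<exists>\<zeta> e q K.
    (\<zeta> \<longlongrightarrow> \<i> * of_real \<alpha> - 1) (at 0) \<and> (e \<longlongrightarrow> 1) (at 0) \<and> (\<forall>\<^sub>F z in at 0. norm (q z) \<le> K) \<and>
    (\<alpha> = 0 \<longrightarrow> (\<forall>z. \<zeta> z = - 1 \<and> q z = 0)) \<and>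
    (\<forall>\<^sub>F z in at 0. Re (e z * h1 (of_real (P z) * \<zeta> z, z) +
        2 * (P' z + of_real (P z) * q z) * h2 (of_real (P z) * \<zeta> z, z)) = 0))"

lemma scaled_tendsto:
  fixes \<zeta> :: "complex \<Rightarrow> complex"
  assumes "(\<zeta> \<longlongrightarrow> L) (at 0)"
  shows "((\<lambda>z. of_real (P z) * \<zeta> z) \<longlongrightarrow> 0) (at 0)"
proof -
  have "((\<lambda>z. of_real (P z) * \<zeta> z) \<longlongrightarrow> of_real 0 * L) (at 0)"
    by (intro tendsto_intros P_tendsto assms)
  then show ?thesis by simp
qed

lemma has_leading_zero:
  assumes "\<forall>\<^sub>F z in nhds 0. h z = 0"
  shows "has_leading h 0 j k"
  unfolding has_leading_def
proof (intro allI impI)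
  fix \<zeta> :: "complex \<Rightarrow> complex" and L assume "(\<zeta> \<longlongrightarrow> L) (at (0::complex))"
  then have "((\<lambda>z. (of_real (P z) * \<zeta> z, z)) \<longlongrightarrow> (0, 0)) (at 0)"
    by (intro tendsto_Pair scaled_tendsto tendsto_ident_at)
  moreover have "\<forall>\<^sub>F z in nhds (0, 0). h z = 0" using assms by (simp add: zero_prod_def)
  ultimately have "\<forall>\<^sub>F z in at 0. h (of_real (P z) * \<zeta> z, z) = 0"
    by (rule eventually_compose_filterlim[rotated])
  then show "\<exists>u. (u \<longlongrightarrow> 0 * L ^ j) (at 0) \<and>
      (\<forall>\<^sub>F z in at 0. h (of_real (P z) * \<zeta> z, z) = of_real (P z) ^ j * z ^ k * u z)"
    by (intro exI[of _ "\<lambda>_. 0"]) simp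
qed

lemma has_leading_expands:
  assumes "expands h j k \<beta>"
  shows "has_leading h (\<beta> 0) j k"
  unfolding has_leading_def
proof (intro allI impI)
  fix \<zeta> :: "complex \<Rightarrow> complex" and L assume \<zeta>: "(\<zeta> \<longlongrightarrow> L) (at (0::complex))"
  obtain \<delta> C where \<delta>: "0 < \<delta>" "\<beta> holomorphic_on ball 0 \<delta>"
      "\<And>z1 z2. norm z1 < \<delta> \<Longrightarrow> norm z2 < \<delta> \<Longrightarrow>
        norm (h (z1, z2) - z1 ^ j * z2 ^ k * \<beta> z2) \<le> C * norm z1 ^ Suc j"
    using assms unfolding expands_def by blast
  have "isCont \<beta> 0"
    using holomorphic_on_imp_continuous_on[OF \<delta>(2)] \<delta>(1) continuous_on_eq_continuous_at[OF open_ball]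
    by (metis centre_in_ball)
  then have \<beta>: "(\<beta> \<longlongrightarrow> \<beta> 0) (at 0)" by (simp add: continuous_at)
  define u where "u z = h (of_real (P z) * \<zeta> z, z) / (of_real (P z) ^ j * z ^ k)" for z
  have small: "\<forall>\<^sub>F z in at 0. norm (of_real (P z) * \<zeta> z) < \<delta>"
    using tendstoD[OF scaled_tendsto[OF \<zeta>] \<delta>(1)] by (simp add: dist_norm)
  have small2: "\<forall>\<^sub>F z in at (0::complex). norm z < \<delta>"
    using \<delta>(1) by (auto simp: eventually_at dist_norm)
  have "((\<lambda>z. u z - \<zeta> z ^ j * \<beta> z) \<longlongrightarrow> 0) (at 0)"
  proof (rule Lim_null_comparison)
    show "\<forall>\<^sub>F z in at 0. norm (u z - \<zeta> z ^ j * \<beta> z) \<le> C * (P z / norm z ^ k) * norm (\<zeta> z) ^ Suc j"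
      using small small2 eventually_in_disc
    proof eventually_elim
      case (elim z)
      have P: "0 < P z" using elim P_pos by blast
      have "norm (h (of_real (P z) * \<zeta> z, z) - (of_real (P z) * \<zeta> z) ^ j * z ^ k * \<beta> z)
          \<le> C * norm (of_real (P z) * \<zeta> z) ^ Suc j"
        using \<delta>(3) elim by blast
      moreover have "h (of_real (P z) * \<zeta> z, z) - (of_real (P z) * \<zeta> z) ^ j * z ^ k * \<beta> z =
          (of_real (P z) ^ j * z ^ k) * (u z - \<zeta> z ^ j * \<beta> z)"
        using P elim by (simp add: u_def right_diff_distrib power_mult_distrib mult_ac)
      ultimately have "(P z ^ j * norm z ^ k) * norm (u z - \<zeta> z ^ j * \<beta> z)
          \<le> C * norm (of_real (P z) * \<zeta> z) ^ Suc j"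
        using P by (simp add: norm_mult norm_power)
      also have "\<dots> = (P z ^ j * norm z ^ k) * (C * (P z / norm z ^ k) * norm (\<zeta> z) ^ Suc j)"
        using P elim by (simp add: norm_mult power_mult_distrib)
      finally show ?case
        by (rule mult_left_le_imp_le) (use P elim in simp)
    qed
    have "((\<lambda>z. C * (P z / norm z ^ k) * norm (\<zeta> z) ^ Suc j) \<longlongrightarrow> C * 0 * norm L ^ Suc j) (at 0)"
      by (intro tendsto_intros P_flat \<zeta>)
    then show "((\<lambda>z. C * (P z / norm z ^ k) * norm (\<zeta> z) ^ Suc j) \<longlongrightarrow> 0) (at 0)" by simp
  qed
  moreover have "((\<lambda>z. \<zeta> z ^ j * \<beta> z) \<longlongrightarrow> L ^ j * \<beta> 0) (at 0)"
    by (intro tendsto_intros \<zeta> \<beta>)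
  ultimately have "(u \<longlongrightarrow> L ^ j * \<beta> 0) (at 0)" using Lim_transform by blast
  moreover have "\<forall>\<^sub>F z in at 0. h (of_real (P z) * \<zeta> z, z) = of_real (P z) ^ j * z ^ k * u z"
    using eventually_in_disc
  proof eventually_elim
    case (elim z)
    have P: "0 < P z" using elim P_pos by blast
    show ?case using P elim by (simp add: u_def)
  qed
  ultimately show "\<exists>u. (u \<longlongrightarrow> \<beta> 0 * L ^ j) (at 0) \<and>
      (\<forall>\<^sub>F z in at 0. h (of_real (P z) * \<zeta> z, z) = of_real (P z) ^ j * z ^ k * u z)"
    by (intro exI[of _ u]) (simp add: mult.commute)
qed

lemma tangential_leading_relation:
  assumes "tangential h1 h2" "has_leading h1 a j k" "has_leading h2 b m n"
  shows "leading_relation P P' a j k b m n"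
  unfolding leading_relation_def
proof
  fix \<alpha> :: real
  obtain \<zeta> e q K where t: "(\<zeta> \<longlongrightarrow> \<i> * of_real \<alpha> - 1) (at 0)" "(e \<longlongrightarrow> 1) (at 0)"
    "\<forall>\<^sub>F z in at 0. norm (q z) \<le> K"
    "\<forall>\<^sub>F z in at 0. Re (e z * h1 (of_real (P z) * \<zeta> z, z) +
        2 * (P' z + of_real (P z) * q z) * h2 (of_real (P z) * \<zeta> z, z)) = 0"
    using assms(1) unfolding tangential_def by blast
  obtain u where u: "(u \<longlongrightarrow> a * (\<i> * of_real \<alpha> - 1) ^ j) (at 0)"
      "\<forall>\<^sub>F z in at 0. h1 (of_real (P z) * \<zeta> z, z) = of_real (P z) ^ j * z ^ k * u z"
    using assms(2) t(1) unfolding has_leading_def by blast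
  obtain w where w: "(w \<longlongrightarrow> b * (\<i> * of_real \<alpha> - 1) ^ m) (at 0)"
      "\<forall>\<^sub>F z in at 0. h2 (of_real (P z) * \<zeta> z, z) = of_real (P z) ^ m * z ^ n * w z"
    using assms(3) t(1) unfolding has_leading_def by blast
  have "((\<lambda>z. e z * u z) \<longlongrightarrow> 1 * (a * (\<i> * of_real \<alpha> - 1) ^ j)) (at 0)"
    by (intro tendsto_intros t u)
  moreover have "\<forall>\<^sub>F z in at 0. Re (of_real (P z) ^ j * z ^ k * (e z * u z) +
        2 * (P' z + of_real (P z) * q z) * (of_real (P z) ^ m * z ^ n * w z)) = 0"
    using t(4) u(2) w(2)
  proof eventually_elim
    case (elim z)
    have "of_real (P z) ^ j * z ^ k * (e z * u z) = e z * (of_real (P z) ^ j * z ^ k * u z)"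
      by (simp only: mult_ac)
    then show ?case using elim by (simp only:)
  qed
  ultimately show "\<exists>u w q K. (u \<longlongrightarrow> a * (\<i> * of_real \<alpha> - 1) ^ j) (at 0) \<and>
    (w \<longlongrightarrow> b * (\<i> * of_real \<alpha> - 1) ^ m) (at 0) \<and> (\<forall>\<^sub>F z in at 0. norm (q z) \<le> K) \<and>
    (\<forall>\<^sub>F z in at 0. Re (of_real (P z) ^ j * z ^ k * u z +
        2 * (P' z + of_real (P z) * q z) * (of_real (P z) ^ m * z ^ n * w z)) = 0)"
    using w(1) t(3) by (intro exI[of _ "\<lambda>z. e z * u z"] exI[of _ w] exI[of _ q] exI[of _ K]) simp
qed

text \<open>The first component vanishes on the axis \<open>z1 = 0\<close>: for \<open>\<alpha> = 0\<close> the real part of \<open>a z^k\<close> would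
  have to be flat.\<close>

lemma leading_relation_order_zero:
  assumes rel: "leading_relation P P' a 0 k b m n" and k: "1 \<le> k"
  shows "a = 0"
proof (rule ccontr)
  assume a: "a \<noteq> 0"
  then obtain \<theta> where \<theta>: "norm \<theta> = 1" "a * \<theta> ^ k = of_real (norm a)"
    using unit_direction[of a k] k by auto
  obtain u w q K where rel':
      "(u \<longlongrightarrow> a * (\<i> * of_real 0 - 1) ^ 0) (at 0)" "(w \<longlongrightarrow> b * (\<i> * of_real 0 - 1) ^ m) (at 0)"
      "\<forall>\<^sub>F z in at 0. norm (q z) \<le> K"
      "\<forall>\<^sub>F z in at 0. Re (of_real (P z) ^ 0 * z ^ k * u z +
        2 * (P' z + of_real (P z) * q z) * (of_real (P z) ^ m * z ^ n * w z)) = 0"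
    using rel unfolding leading_relation_def by blast
  define E where "E z = 2 * (P' z + of_real (P z) * q z) * (of_real (P z) ^ m * z ^ n * w z)" for z
  have E: "((\<lambda>z. norm (E z) / norm z ^ k) \<longlongrightarrow> 0) (at 0)"
  proof (rule Lim_null_comparison)
    show "\<forall>\<^sub>F z in at 0. norm (norm (E z) / norm z ^ k) \<le>
        2 * (norm (P' z) / norm z ^ k + P z / norm z ^ k * K) * norm (of_real (P z) ^ m * z ^ n * w z)"
      using rel'(3) eventually_pos
    proof eventually_elim
      case (elim z)
      have "norm (P' z + of_real (P z) * q z) \<le> norm (P' z) + P z * norm (q z)"
        using norm_triangle_ineq[of "P' z" "of_real (P z) * q z"] elim(2) by (simp add: norm_mult)
      also have "\<dots> \<le> norm (P' z) + P z * K"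
        using elim by (simp add: mult_left_mono)
      finally have "norm (E z) \<le> 2 * (norm (P' z) + P z * K) * norm (of_real (P z) ^ m * z ^ n * w z)"
        unfolding E_def norm_mult by (intro mult_right_mono mult_left_mono) (auto simp: norm_mult)
      then have "norm (E z) / norm z ^ k \<le>
          2 * (norm (P' z) + P z * K) * norm (of_real (P z) ^ m * z ^ n * w z) / norm z ^ k"
        by (intro divide_right_mono) auto
      then show ?case by (simp add: add_divide_distrib distrib_left distrib_right mult_ac)
    qed
    have "((\<lambda>z. 2 * (norm (P' z) / norm z ^ k + P z / norm z ^ k * K) * norm (of_real (P z) ^ m * z ^ n * w z))
        \<longlongrightarrow> 2 * (0 + 0 * K) * norm (of_real 0 ^ m * 0 ^ n * (b * (\<i> * of_real 0 - 1) ^ m))) (at 0)"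
      by (intro tendsto_intros P'_flat P_flat P_tendsto rel')
    then show "((\<lambda>z. 2 * (norm (P' z) / norm z ^ k + P z / norm z ^ k * K) *
        norm (of_real (P z) ^ m * z ^ n * w z)) \<longlongrightarrow> 0) (at 0)" by simp
  qed
  note ray = ray_filterlim[OF \<theta>(1)]
  have pos: "\<forall>\<^sub>F \<rho>::real in at_right 0. 0 < \<rho>"
    by (simp add: eventually_at_right_less)
  have "((\<lambda>\<rho>. Re (\<theta> ^ k * u (of_real \<rho> * \<theta>))) \<longlongrightarrow> Re (\<theta> ^ k * (a * (\<i> * of_real 0 - 1) ^ 0))) (at_right 0)"
    by (intro tendsto_intros filterlim_compose[OF rel'(1) ray])
  moreover have "Re (\<theta> ^ k * (a * (\<i> * of_real 0 - 1) ^ 0)) = norm a"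
    using \<theta>(2) by (simp add: mult.commute)
  moreover have "((\<lambda>\<rho>. Re (\<theta> ^ k * u (of_real \<rho> * \<theta>))) \<longlongrightarrow> 0) (at_right 0)"
  proof (rule Lim_null_comparison[OF _ filterlim_compose[OF E ray]])
    show "\<forall>\<^sub>F \<rho> in at_right 0. norm (Re (\<theta> ^ k * u (of_real \<rho> * \<theta>))) \<le>
        norm (E (of_real \<rho> * \<theta>)) / norm (of_real \<rho> * \<theta>) ^ k"
      using eventually_compose_filterlim[OF rel'(4) ray] pos
    proof eventually_elim
      case (elim \<rho>)
      define z where "z = of_real \<rho> * \<theta>"
      have nz: "norm z = \<rho>" using elim \<theta>(1) by (simp add: z_def norm_mult)
      have "Re (z ^ k * u z) + Re (E z) = 0"
        using elim(1) unfolding E_def z_def[symmetric] by (simp only: power_0 mult_1 plus_complex.sel)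
      moreover have "Re (z ^ k * u z) = \<rho> ^ k * Re (\<theta> ^ k * u z)"
      proof -
        have "z ^ k * u z = of_real (\<rho> ^ k) * (\<theta> ^ k * u z)"
          by (simp add: z_def power_mult_distrib mult_ac)
        then show ?thesis by (metis scaleR_complex.sel(1) scaleR_conv_of_real)
      qed
      ultimately have "\<rho> ^ k * \<bar>Re (\<theta> ^ k * u z)\<bar> = \<bar>Re (E z)\<bar>"
        using elim(2) by (metis abs_minus_cancel abs_mult abs_of_pos add_eq_0_iff zero_less_power)
      also have "\<dots> \<le> norm (E z)" by (rule abs_Re_le_cmod)
      finally have "\<bar>Re (\<theta> ^ k * u z)\<bar> \<le> norm (E z) / \<rho> ^ k"
        using elim(2) by (simp add: pos_le_divide_eq mult.commute)
      then show ?case unfolding z_def[symmetric] nz by simp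
    qed
  qed
  ultimately have "norm a = 0"
    by (metis tendsto_unique trivial_limit_at_right_real)
  then show False using a by simp
qed

text \<open>Tangency on the slice \<open>Im z1 = 0\<close>: it gives the derivative of \<open>P\<close> along the holomorphic vector
  field \<open>B(z) = z^n \<beta>(z)\<close> which the second component induces on the axis \<open>z1 = 0\<close>.\<close>

lemma drift_equation:
  assumes tan: "tangential h1 h2" and lead: "has_leading h1 a j k" and h2: "expands h2 0 n \<beta>"
  obtains u C where "(u \<longlongrightarrow> a * (- 1) ^ j) (at 0)" and "0 \<le> C"
    and "\<forall>\<^sub>F z in at 0. \<bar>2 * Re (P' z * (z ^ n * \<beta> z)) + P z ^ j * Re (z ^ k * u z)\<bar>
      \<le> C * P z * norm (P' z)"
proof -
  obtain \<zeta> e q K where t: "(\<zeta> \<longlongrightarrow> \<i> * of_real 0 - 1) (at 0)" "(e \<longlongrightarrow> 1) (at 0)"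
    "\<And>z. \<zeta> z = - 1" "\<And>z. q z = 0"
    "\<forall>\<^sub>F z in at 0. Re (e z * h1 (of_real (P z) * \<zeta> z, z) +
        2 * (P' z + of_real (P z) * q z) * h2 (of_real (P z) * \<zeta> z, z)) = 0"
    using tan unfolding tangential_def by blast
  obtain u where u: "(u \<longlongrightarrow> a * (\<i> * of_real 0 - 1) ^ j) (at 0)"
      "\<forall>\<^sub>F z in at 0. h1 (of_real (P z) * \<zeta> z, z) = of_real (P z) ^ j * z ^ k * u z"
    using lead t(1) unfolding has_leading_def by blast
  obtain \<delta> C where \<delta>: "0 < \<delta>" "\<beta> holomorphic_on ball 0 \<delta>"
      "\<And>z1 z2. norm z1 < \<delta> \<Longrightarrow> norm z2 < \<delta> \<Longrightarrow>
        norm (h2 (z1, z2) - z1 ^ 0 * z2 ^ n * \<beta> z2) \<le> C * norm z1 ^ Suc 0"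
    using h2 unfolding expands_def by blast
  have small: "\<forall>\<^sub>F z in at 0. P z < \<delta>"
    using order_tendstoD(2)[OF P_tendsto \<delta>(1)] .
  have small2: "\<forall>\<^sub>F z in at (0::complex). norm z < \<delta>"
    using \<delta>(1) by (auto simp: eventually_at dist_norm)
  have "((\<lambda>z. e z * u z) \<longlongrightarrow> 1 * (a * (\<i> * of_real 0 - 1) ^ j)) (at 0)"
    by (intro tendsto_intros t u)
  then have eu: "((\<lambda>z. e z * u z) \<longlongrightarrow> a * (- 1) ^ j) (at 0)" by simp
  have "\<forall>\<^sub>F z in at 0. \<bar>2 * Re (P' z * (z ^ n * \<beta> z)) + P z ^ j * Re (z ^ k * (e z * u z))\<bar>
      \<le> (2 * \<bar>C\<bar>) * P z * norm (P' z)"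
    using t(5) u(2) small small2 eventually_pos
  proof eventually_elim
    case (elim z)
    define r where "r = h2 (- of_real (P z), z) - z ^ n * \<beta> z"
    have "norm r \<le> C * P z"
      using \<delta>(3)[of "- of_real (P z)" z] elim by (simp add: r_def)
    also have "\<dots> \<le> \<bar>C\<bar> * P z" using elim by (intro mult_right_mono) auto
    finally have r: "norm r \<le> \<bar>C\<bar> * P z" .
    have e1: "e z * (of_real (P z) ^ j * z ^ k * u z) = of_real (P z ^ j) * (z ^ k * (e z * u z))"
      by (simp add: mult_ac)
    have "Re (e z * h1 (of_real (P z) * \<zeta> z, z)) + Re (2 * P' z * h2 (- of_real (P z), z)) = 0"
      using elim(1) unfolding t(3,4) by simp
    then have "P z ^ j * Re (z ^ k * (e z * u z)) + Re (2 * P' z * h2 (- of_real (P z), z)) = 0"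
      unfolding elim(2) e1 by (metis scaleR_complex.sel(1) scaleR_conv_of_real)
    moreover have "Re (2 * P' z * h2 (- of_real (P z), z)) =
        2 * Re (P' z * (z ^ n * \<beta> z)) + 2 * Re (P' z * r)"
    proof -
      have "2 * P' z * h2 (- of_real (P z), z) = 2 *\<^sub>R (P' z * (z ^ n * \<beta> z)) + 2 *\<^sub>R (P' z * r)"
        by (simp add: r_def scaleR_conv_of_real algebra_simps)
      then show ?thesis by (metis plus_complex.sel(1) scaleR_complex.sel(1))
    qed
    ultimately have "\<bar>2 * Re (P' z * (z ^ n * \<beta> z)) + P z ^ j * Re (z ^ k * (e z * u z))\<bar> = 2 * \<bar>Re (P' z * r)\<bar>"
      by linarith
    also have "\<bar>Re (P' z * r)\<bar> \<le> norm (P' z) * norm r"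
      using abs_Re_le_cmod[of "P' z * r"] by (simp only: norm_mult)
    also have "\<dots> \<le> norm (P' z) * (\<bar>C\<bar> * P z)" using r by (intro mult_left_mono) auto
    finally show ?case by (simp add: mult_ac)
  qed
  then show ?thesis using eu by (intro that[of "\<lambda>z. e z * u z" "2 * \<bar>C\<bar>"]) auto
qed


text \<open>Here the derivative of \<open>ln P\<close> along \<open>B\<close> is of the size of \<open>|B| / |z|\<close>, so that \<open>P\<close> decays at
  most like a power along an orbit of \<open>B\<close> or of \<open>- B\<close> that tends to 0.\<close>

lemma drift_dominated:
  assumes tan: "tangential h1 h2" and lead: "has_leading h1 a j k" and h2: "expands h2 0 n \<beta>"
    and n: "1 \<le> n" "n = 1 \<Longrightarrow> Re (\<beta> 0) \<noteq> 0" and jk: "2 \<le> j \<or> (j = 1 \<and> n \<le> Suc k)"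
  shows False
proof -
  obtain u C where u: "(u \<longlongrightarrow> a * (- 1) ^ j) (at 0)" and C: "0 \<le> C"
    and eq: "\<forall>\<^sub>F z in at 0. \<bar>2 * Re (P' z * (z ^ n * \<beta> z)) + P z ^ j * Re (z ^ k * u z)\<bar>
      \<le> C * P z * norm (P' z)"
    by (rule drift_equation[OF tan lead h2], rule that)
  define M where "M = norm (a * (- 1) ^ j) + 1"
  have uM: "\<forall>\<^sub>F z in at 0. norm (u z) < M"
    using order_tendstoD(2)[OF tendsto_norm[OF u], of M] by (simp add: M_def)
  have P1: "\<forall>\<^sub>F z in at 0. P z < 1" by (rule order_tendstoD(2)[OF P_tendsto]) simp
  have Pn: "\<forall>\<^sub>F z in at 0. P z / norm z ^ (n - 1) < 1"
    by (rule order_tendstoD(2)[OF P_flat]) simp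
  have P'n: "\<forall>\<^sub>F z in at 0. norm (P' z) / norm z ^ (n - 1) < 1"
    by (rule order_tendstoD(2)[OF P'_flat]) simp
  have z1: "\<forall>\<^sub>F z in at (0::complex). norm z < 1"
    by (auto simp: eventually_at dist_norm intro!: exI[of _ 1])
  have bound: "\<forall>\<^sub>F z in at 0. \<bar>2 * Re (P' z * (z ^ n * \<beta> z))\<bar> \<le> (C + M) * norm z ^ (n - 1) * P z"
    using eq uM P1 Pn P'n z1 eventually_in_disc
  proof eventually_elim
    case (elim z)
    have P: "0 < P z" using elim P_pos by blast
    have zn: "0 < norm z ^ (n - 1)" using elim by simp
    have Pn: "P z \<le> norm z ^ (n - 1)" and P'n: "norm (P' z) \<le> norm z ^ (n - 1)"
      using elim(4,5) zn by (simp_all add: divide_less_eq)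
    have "P z ^ j * norm z ^ k \<le> norm z ^ (n - 1) * P z"
    proof (cases "2 \<le> j")
      case True
      then obtain l where l: "j = l + 2" using le_Suc_ex add.commute by metis
      have "P z ^ j * norm z ^ k = (P z ^ l * norm z ^ k) * (P z * P z)"
        by (simp add: l power_add power2_eq_square mult_ac)
      also have "\<dots> \<le> 1 * (norm z ^ (n - 1) * P z)"
        using P Pn elim by (intro mult_mono mult_le_one power_le_one) auto
      finally show ?thesis by simp
    next
      case False
      then have "j = 1" "n - 1 \<le> k" using jk by auto
      moreover have "norm z ^ k \<le> norm z ^ (n - 1)"
        using \<open>n - 1 \<le> k\<close> elim by (intro power_decreasing) auto
      ultimately show ?thesis using P by (simp add: mult.commute mult_right_mono)
    qed
    from mult_mono[OF this, of "norm (u z)" M]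
    have "P z ^ j * norm z ^ k * norm (u z) \<le> norm z ^ (n - 1) * P z * M"
      using elim(2) P zn by simp
    moreover have "\<bar>P z ^ j * Re (z ^ k * u z)\<bar> \<le> P z ^ j * norm z ^ k * norm (u z)"
    proof -
      have "\<bar>Re (z ^ k * u z)\<bar> \<le> norm z ^ k * norm (u z)"
        using abs_Re_le_cmod[of "z ^ k * u z"] by (simp only: norm_mult norm_power)
      then show ?thesis using P by (simp add: abs_mult mult.assoc mult_left_mono del: times_complex.sel)
    qed
    moreover have "C * P z * norm (P' z) \<le> C * P z * norm z ^ (n - 1)"
      using P C P'n by (intro mult_left_mono) auto
    ultimately show ?case using elim(1) by (simp add: algebra_simps del: times_complex.sel)
  qed
  \<comment> \<open>reverse the field if needed, so that 0 is attracting in the case n = 1\<close>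
  define \<sigma> :: real where "\<sigma> = (if Re (\<beta> 0) < 0 then 1 else - 1)"
  have \<sigma>: "\<bar>\<sigma>\<bar> = 1" "\<sigma> \<noteq> 0" by (auto simp: \<sigma>_def)
  obtain \<delta> where \<delta>: "0 < \<delta>" "\<beta> holomorphic_on ball 0 \<delta>" "\<beta> 0 \<noteq> 0"
    using h2 unfolding expands_def by blast
  show False
  proof (rule no_attracting_drift)
    show "(\<lambda>z. of_real \<sigma> * \<beta> z) holomorphic_on ball 0 \<delta>"
      by (intro holomorphic_intros \<delta>)
    show "of_real \<sigma> * \<beta> 0 \<noteq> 0" using \<delta> \<sigma> by simp
    show "Re (of_real \<sigma> * \<beta> 0) < 0" if "n = 1"
      using n(2)[OF that] by (auto simp: \<sigma>_def)
    show "\<forall>\<^sub>F z in at 0. - (C + M) * norm z ^ (n - 1) * P z \<le> 2 * Re (P' z * (z ^ n * (of_real \<sigma> * \<beta> z)))"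
      using bound
    proof eventually_elim
      case (elim z)
      have "P' z * (z ^ n * (of_real \<sigma> * \<beta> z)) = of_real \<sigma> * (P' z * (z ^ n * \<beta> z))"
        by (simp only: mult_ac)
      then have "2 * Re (P' z * (z ^ n * (of_real \<sigma> * \<beta> z))) = \<sigma> * (2 * Re (P' z * (z ^ n * \<beta> z)))"
        by (metis mult.left_commute scaleR_complex.sel(1) scaleR_conv_of_real)
      moreover have "\<bar>\<sigma> * (2 * Re (P' z * (z ^ n * \<beta> z)))\<bar> \<le> (C + M) * norm z ^ (n - 1) * P z"
        using elim \<sigma>(1) by (simp only: abs_mult mult_1)
      ultimately show ?case by linarith
    qed
  qed (use \<delta> n in auto)
qed

text \<open>Here the derivative of \<open>ln P\<close> along \<open>B\<close> has the sign of \<open>Re a\<close>. As \<open>n > 1\<close>, both \<open>B\<close> and \<open>- B\<close>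
  have orbits tending to 0, and \<open>P\<close> would increase along one of them.\<close>

lemma drift_linear:
  assumes tan: "tangential h1 h2" and lead: "has_leading h1 a 1 0" and h2: "expands h2 0 n \<beta>"
    and n: "2 \<le> n" and a: "Re a \<noteq> 0"
  shows False
proof -
  obtain u C where u: "(u \<longlongrightarrow> a * (- 1) ^ 1) (at 0)"
    and eq: "\<forall>\<^sub>F z in at 0. \<bar>2 * Re (P' z * (z ^ n * \<beta> z)) + P z ^ 1 * Re (z ^ 0 * u z)\<bar>
      \<le> C * P z * norm (P' z)"
    by (rule drift_equation[OF tan lead h2], rule that)
  define \<sigma> where "\<sigma> = sgn (Re a)"
  have \<sigma>: "\<bar>\<sigma>\<bar> = 1" "\<sigma> \<noteq> 0" "\<sigma> * Re a = \<bar>Re a\<bar>" using a by (auto simp: \<sigma>_def sgn_if)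
  have "((\<lambda>z. \<sigma> * Re (u z) + C * (norm (P' z) / norm z ^ 0)) \<longlongrightarrow> \<sigma> * Re (a * (- 1) ^ 1) + C * 0) (at 0)"
    by (intro tendsto_intros u P'_flat)
  then have "\<forall>\<^sub>F z in at 0. \<sigma> * Re (u z) + C * (norm (P' z) / norm z ^ 0) < 0"
    by (rule order_tendstoD(2)) (use \<sigma> a in simp)
  then have ge: "\<forall>\<^sub>F z in at 0. 0 \<le> \<sigma> * (2 * Re (P' z * (z ^ n * \<beta> z)))"
    using eq eventually_pos
  proof eventually_elim
    case (elim z)
    define D where "D = 2 * Re (P' z * (z ^ n * \<beta> z))"
    have "\<bar>D + P z * Re (u z)\<bar> \<le> C * P z * norm (P' z)" using elim(2) by (simp add: D_def)
    then have "\<bar>\<sigma> * (D + P z * Re (u z))\<bar> \<le> C * P z * norm (P' z)"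
      using \<sigma>(1) by (simp only: abs_mult) simp
    then have "- (C * P z * norm (P' z)) \<le> \<sigma> * D + P z * (\<sigma> * Re (u z))"
      by (simp add: algebra_simps abs_le_iff)
    moreover have "P z * (\<sigma> * Re (u z) + C * norm (P' z)) \<le> 0"
      using elim by (intro mult_nonneg_nonpos) auto
    ultimately show ?case unfolding D_def[symmetric] by (simp add: algebra_simps)
  qed
  obtain \<delta> where \<delta>: "0 < \<delta>" "\<beta> holomorphic_on ball 0 \<delta>" "\<beta> 0 \<noteq> 0"
    using h2 unfolding expands_def by blast
  show False
  proof (rule no_attracting_drift)
    show "(\<lambda>z. of_real \<sigma> * \<beta> z) holomorphic_on ball 0 \<delta>"
      by (intro holomorphic_intros \<delta>)
    show "of_real \<sigma> * \<beta> 0 \<noteq> 0" using \<delta> \<sigma> by simp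
    show "\<forall>\<^sub>F z in at 0. - 0 * norm z ^ (n - 1) * P z \<le> 2 * Re (P' z * (z ^ n * (of_real \<sigma> * \<beta> z)))"
      using ge
    proof eventually_elim
      case (elim z)
      have "P' z * (z ^ n * (of_real \<sigma> * \<beta> z)) = of_real \<sigma> * (P' z * (z ^ n * \<beta> z))"
        by (simp only: mult_ac)
      then have "2 * Re (P' z * (z ^ n * (of_real \<sigma> * \<beta> z))) = \<sigma> * (2 * Re (P' z * (z ^ n * \<beta> z)))"
        by (metis mult.left_commute scaleR_complex.sel(1) scaleR_conv_of_real)
      then show ?case using elim by linarith
    qed
  qed (use \<delta> n in auto)
qed

text \<open>If the second component does not vanish on the axis \<open>z1 = 0\<close>, it is \<open>\<i> c z2 + O(z2^2)\<close> there
  with real \<open>c \<noteq> 0\<close>.\<close>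

lemma order_zero_component:
  assumes tan: "tangential h1 h2" and h1: "(\<forall>\<^sub>F z in nhds 0. h1 z = 0) \<or> (\<exists>j k \<beta>. 1 \<le> j \<and> expands h1 j k \<beta>)"
    and h2: "expands h2 0 n \<beta>" and n: "1 \<le> n" "n = 1 \<Longrightarrow> Re (\<beta> 0) \<noteq> 0"
  shows False
proof -
  have b: "\<beta> 0 \<noteq> 0" using h2 by (simp add: expands_def)
  consider "\<forall>\<^sub>F z in nhds 0. h1 z = 0" | j k \<beta>1 where "1 \<le> j" "expands h1 j k \<beta>1" using h1 by blast
  then show False
  proof cases
    case 1
    show False by (rule drift_dominated[OF tan has_leading_zero[OF 1, of 2 0] h2 n]) auto
  next
    case 2
    define a where "a = \<beta>1 0"
    have a: "a \<noteq> 0" using 2 by (simp add: expands_def a_def)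
    have lead: "has_leading h1 a j k" unfolding a_def by (rule has_leading_expands[OF 2(2)])
    show False
    proof (cases "2 \<le> j \<or> n \<le> Suc k")
      case True
      then show False using drift_dominated[OF tan lead h2 n] 2(1) by linarith
    next
      case False
      then have j: "j = 1" and kn: "k + 1 < n" using 2(1) by auto
      show False
      proof (cases "k = 0 \<and> Im a = 0")
        case True
        then have "Re a \<noteq> 0" using a by (simp add: complex_eq_iff)
        then show False
          using drift_linear[OF tan _ h2] lead j True kn by auto
      next
        case False
        obtain \<theta> where \<theta>: "norm \<theta> = 1" "\<beta> 0 * \<theta> ^ (n - 1) \<in> \<real>" "Im (a * \<theta> ^ k) \<noteq> 0"
        proof (rule nonreal_direction[OF a b])
          show "k < n - 1" using kn by simp
          show "Im a \<noteq> 0" if "k = 0" using False that by blast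
        qed
        have "leading_relation P P' a 1 k (\<beta> 0) 0 n"
          using tangential_leading_relation[OF tan lead has_leading_expands[OF h2]] j by simp
        from sector_contradiction[OF this kn b \<theta>] show False .
      qed
    qed
  qed
qed

text \<open>A tangent field vanishing at 0 is determined by the derivative of its second component with
  respect to \<open>z2\<close> at 0, and that derivative is imaginary.\<close>

theorem tangential_rigidity:
  assumes tan: "tangential h1 h2"
    and hol: "holomorphic2_near_0 h1" "holomorphic2_near_0 h2"
    and zero: "h1 0 = 0" "h2 0 = 0"
  shows "Re (deriv (\<lambda>w. h2 (0, w)) 0) = 0"
    and "deriv (\<lambda>w. h2 (0, w)) 0 = 0 \<Longrightarrow>
      (\<forall>\<^sub>F z in nhds 0. h1 z = 0) \<and> (\<forall>\<^sub>F z in nhds 0. h2 z = 0)"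
proof -
  have h2_lead: "\<exists>b m n. has_leading h2 b m n"
    using expands_or_zero[OF hol(2)] has_leading_zero has_leading_expands by blast
  have axis: "1 \<le> k" if "expands h 0 k \<beta>" "h 0 = 0" for h k \<beta>
  proof (rule ccontr)
    assume "\<not> 1 \<le> k"
    then have "k = 0" by simp
    then have "h (0, 0) = \<beta> 0"
      using eventually_nhds_x_imp_x[OF expands_0_on_axis(1)[OF that(1)]] by simp
    then show False using that by (simp add: zero_prod_def expands_def)
  qed
  have h1: "(\<forall>\<^sub>F z in nhds 0. h1 z = 0) \<or> (\<exists>j k \<beta>. 1 \<le> j \<and> expands h1 j k \<beta>)"
  proof -
    have "1 \<le> j" if e: "expands h1 j k \<beta>" for j k \<beta>
    proof (rule ccontr)
      assume "\<not> 1 \<le> j"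
      then have j: "j = 0" by simp
      obtain b m n where "has_leading h2 b m n" using h2_lead by blast
      then have "leading_relation P P' (\<beta> 0) 0 k b m n"
        using tangential_leading_relation[OF tan has_leading_expands[OF e]] j by simp
      then have "\<beta> 0 = 0"
        by (rule leading_relation_order_zero) (use axis e j zero in auto)
      then show False using e by (simp add: expands_def)
    qed
    then show ?thesis using expands_or_zero[OF hol(1)] by blast
  qed
  have "(deriv (\<lambda>w. h2 (0, w)) 0 = 0 \<and> (\<forall>\<^sub>F z in nhds 0. h1 z = 0) \<and> (\<forall>\<^sub>F z in nhds 0. h2 z = 0)) \<or>
      (deriv (\<lambda>w. h2 (0, w)) 0 \<noteq> 0 \<and> Re (deriv (\<lambda>w. h2 (0, w)) 0) = 0)"
  proof -
    consider (zero) "\<forall>\<^sub>F z in nhds 0. h2 z = 0" | (pos) m n \<beta> where "expands h2 m n \<beta>" "1 \<le> m"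
      | (axis) n \<beta> where "expands h2 0 n \<beta>"
      using expands_or_zero[OF hol(2)] by (metis less_one not_less)
    then show ?thesis
    proof cases
      case zero
      have "\<forall>\<^sub>F w in nhds 0. h2 (0, w) = 0"
      proof (rule eventually_compose_filterlim[OF zero])
        show "filterlim (\<lambda>w. (0, w)) (nhds 0) (nhds 0)"
          unfolding zero_prod_def by (intro tendsto_Pair tendsto_const filterlim_ident)
      qed
      then have "deriv (\<lambda>w. h2 (0, w)) 0 = deriv (\<lambda>w. 0) 0"
        by (intro deriv_cong_ev) auto
      moreover have "\<forall>\<^sub>F z in nhds 0. h1 z = 0"
      proof (rule ccontr)
        assume "\<not> ?thesis"
        then obtain j k \<beta> where e: "1 \<le> j" "expands h1 j k \<beta>" using h1 by blast
        \<comment> \<open>the orders of the vanishing component may be chosen freely\<close>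
        have "leading_relation P P' (\<beta> 0) j k 0 j 0"
          by (rule tangential_leading_relation[OF tan has_leading_expands[OF e(2)] has_leading_zero[OF zero]])
        from no_transversal_order[OF this e(1) e(1)] e(2) show False by (simp add: expands_def)
      qed
      ultimately show ?thesis using zero by simp
    next
      case pos
      have b: "\<beta> 0 \<noteq> 0" using pos by (simp add: expands_def)
      have False using h1
      proof (elim disjE exE conjE)
        assume 0: "\<forall>\<^sub>F z in nhds 0. h1 z = 0"
        have "leading_relation P P' 0 (m + 2) 0 (\<beta> 0) m n"
          by (rule tangential_leading_relation[OF tan has_leading_zero[OF 0] has_leading_expands[OF pos(1)]])
        from no_transversal_order[OF this] pos(2) b show False by simp
      next
        fix j k \<beta>1 assume e: "1 \<le> j" "expands h1 j k \<beta>1"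
        have "leading_relation P P' (\<beta>1 0) j k (\<beta> 0) m n"
          by (rule tangential_leading_relation[OF tan has_leading_expands[OF e(2)] has_leading_expands[OF pos(1)]])
        from no_transversal_order[OF this e(1) pos(2)] e(2) b show False by (simp add: expands_def)
      qed
      then show ?thesis ..
    next
      case axis
      have n: "1 \<le> n" by (rule \<open>\<And>h k \<beta>. expands h 0 k \<beta> \<Longrightarrow> h 0 = 0 \<Longrightarrow> 1 \<le> k\<close>[OF axis zero(2)])
      have n1: "n = 1" "Re (\<beta> 0) = 0"
        using order_zero_component[OF tan h1 axis n] by blast+
      obtain \<beta>' where "(\<beta> has_field_derivative \<beta>') (at 0)"
        using expands_0_on_axis(2)[OF axis] by (auto simp: field_differentiable_def)
      then have "((\<lambda>w. w * \<beta> w) has_field_derivative (1 * \<beta> 0 + \<beta>' * 0)) (at 0)"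
        by (intro DERIV_mult DERIV_ident)
      then have "deriv (\<lambda>w. w * \<beta> w) 0 = \<beta> 0" by (simp add: DERIV_imp_deriv)
      moreover have "deriv (\<lambda>w. h2 (0, w)) 0 = deriv (\<lambda>w. w * \<beta> w) 0"
        using expands_0_on_axis(1)[OF axis] n1 by (intro deriv_cong_ev) auto
      ultimately show ?thesis using n1 axis by (simp add: expands_def)
    qed
  qed
  then show "Re (deriv (\<lambda>w. h2 (0, w)) 0) = 0"
    "deriv (\<lambda>w. h2 (0, w)) 0 = 0 \<Longrightarrow>
      (\<forall>\<^sub>F z in nhds 0. h1 z = 0) \<and> (\<forall>\<^sub>F z in nhds 0. h2 z = 0)"
    by auto
qed

end

section \<open>Tangent fields of the hypersurface\<close>

lemma wirtinger_of_real:
  assumes "(g has_derivative D) (at z)"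
  shows "wirtinger (\<lambda>w. of_real (g w)) z = (of_real (D 1) - \<i> * of_real (D \<i>)) / 2"
    and "D v = 2 * Re (wirtinger (\<lambda>w. of_real (g w)) z * v)"
proof -
  have "((\<lambda>w. complex_of_real (g w)) has_derivative (\<lambda>v. of_real (D v))) (at z)"
    by (rule has_derivative_of_real[OF assms])
  then have "frechet_derivative (\<lambda>w. complex_of_real (g w)) (at z) = (\<lambda>v. of_real (D v))"
    by (rule frechet_derivative_at[symmetric])
  then show 1: "wirtinger (\<lambda>w. of_real (g w)) z = (of_real (D 1) - \<i> * of_real (D \<i>)) / 2"
    by (simp add: wirtinger_def)
  have lin: "linear D" using assms by (simp add: has_derivative_def bounded_linear.linear)
  have "v = Re v *\<^sub>R 1 + Im v *\<^sub>R \<i>" by (simp add: complex_eq_iff)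
  then have "D v = D (Re v *\<^sub>R 1 + Im v *\<^sub>R \<i>)" by simp
  also have "\<dots> = Re v * D 1 + Im v * D \<i>"
    by (simp add: linear_add[OF lin] linear_cmul[OF lin])
  also have "\<dots> = 2 * Re (wirtinger (\<lambda>w. of_real (g w)) z * v)"
    unfolding 1 by (simp add: field_simps)
  finally show "D v = 2 * Re (wirtinger (\<lambda>w. of_real (g w)) z * v)" .
qed

lemma flat_at_0_tendsto:
  assumes "flat_at_0 f"
  shows "((\<lambda>z. norm (f z) / norm z ^ n) \<longlongrightarrow> 0) (at 0)"
proof -
  obtain C \<epsilon> where C: "0 < \<epsilon>" "\<And>z. norm z < \<epsilon> \<Longrightarrow> norm (f z) \<le> C * norm z ^ Suc n"
    using assms unfolding flat_at_0_def by blast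
  show ?thesis
  proof (rule Lim_null_comparison)
    have "\<forall>\<^sub>F z in at (0::complex). z \<noteq> 0 \<and> norm z < \<epsilon>"
      using C(1) by (auto simp: eventually_at dist_norm)
    then show "\<forall>\<^sub>F z in at 0. norm (norm (f z) / norm z ^ n) \<le> C * norm z"
    proof eventually_elim
      case (elim z)
      then have "norm (f z) \<le> (C * norm z) * norm z ^ n" using C(2)[of z] by (simp add: mult_ac)
      then show ?case using elim by (simp add: pos_divide_le_eq)
    qed
    have "((\<lambda>z::complex. C * norm z) \<longlongrightarrow> C * norm (0::complex)) (at 0)" by (intro tendsto_intros)
    then show "((\<lambda>z::complex. C * norm z) \<longlongrightarrow> 0) (at 0)" by simp
  qed
qed

lemma flat_function_wirtinger:
  assumes C1: "C1_near P 0" and pos: "\<forall>\<^sub>F z in at 0. P z > 0"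
    and P_flat: "flat_at_0 (\<lambda>z. of_real (P z))"
    and P'_flat: "flat_at_0 (wirtinger (\<lambda>z. of_real (P z)))"
  obtains r0 where "flat_function P (wirtinger (\<lambda>z. of_real (P z))) r0"
proof -
  obtain U f' where U: "open U" "0 \<in> U" "continuous_on U f'"
    "\<And>z. z \<in> U \<Longrightarrow> (P has_derivative blinfun_apply (f' z)) (at z)"
    using C1 unfolding C1_near_def by blast
  obtain r1 where r1: "0 < r1" "ball 0 r1 \<subseteq> U"
    using U(1,2) open_contains_ball by blast
  obtain r2 where r2: "0 < r2" "\<And>z. z \<noteq> 0 \<Longrightarrow> norm z < r2 \<Longrightarrow> 0 < P z"
    using pos by (auto simp: eventually_at dist_norm)
  define r0 where "r0 = min r1 r2"
  have inU: "z \<in> U" if "norm z < r0" for z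
    using that r1(2) by (auto simp: r0_def)
  have "flat_function P (wirtinger (\<lambda>z. of_real (P z))) r0"
  proof
    show "0 < r0" using r1 r2 by (simp add: r0_def)
    show "(P has_derivative (\<lambda>v. 2 * Re (wirtinger (\<lambda>z. of_real (P z)) z * v))) (at z)"
      if "norm z < r0" for z
    proof -
      note d = U(4)[OF inU[OF that]]
      have "blinfun_apply (f' z) = (\<lambda>v. 2 * Re (wirtinger (\<lambda>z. of_real (P z)) z * v))"
        using wirtinger_of_real(2)[OF d] by blast
      then show ?thesis using d by simp
    qed
    have cont: "continuous_on (ball 0 r0)
        (\<lambda>z. (of_real (blinfun_apply (f' z) 1) - \<i> * of_real (blinfun_apply (f' z) \<i>)) / 2)"
    proof -
      have c: "continuous_on (ball 0 r0) f'"
        by (rule continuous_on_subset[OF U(3)]) (use inU in auto)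
      show ?thesis by (intro continuous_intros c) auto
    qed
    show "continuous_on (ball 0 r0) (wirtinger (\<lambda>z. of_real (P z)))"
      by (rule continuous_on_eq[OF cont], rule wirtinger_of_real(1)[symmetric], rule U(4), rule inU) simp
    show "0 < P z" if "z \<noteq> 0" "norm z < r0" for z
      using that r2(2) by (simp add: r0_def)
    show "((\<lambda>z. P z / norm z ^ n) \<longlongrightarrow> 0) (at 0)" for n
    proof (rule Lim_null_comparison)
      show "((\<lambda>z. norm (complex_of_real (P z)) / norm z ^ n) \<longlongrightarrow> 0) (at 0)"
        by (rule flat_at_0_tendsto[OF P_flat])
    qed auto
    show "((\<lambda>z. norm (wirtinger (\<lambda>z. of_real (P z)) z) / norm z ^ n) \<longlongrightarrow> 0) (at 0)" for n
      by (rule flat_at_0_tendsto[OF P'_flat])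
  qed
  then show ?thesis by (rule that)
qed

text \<open>On the curve \<open>z1 = P \<zeta>\<close> chosen in the proof, \<open>Im z1 = \<alpha> P\<close> and \<open>\<rho> = 0\<close> hold exactly.\<close>

lemma tangential_of_tangent:
  fixes P :: "complex \<Rightarrow> real" and Q :: "complex \<times> real \<Rightarrow> real" and \<rho> :: "complex \<times> complex \<Rightarrow> real"
    and H :: "complex \<times> complex \<Rightarrow> complex \<times> complex"
  assumes rho: "\<And>z1 z2. \<rho> (z1, z2) = Re z1 + P z2 + Im z1 * Q (z2, Im z1)"
    and Q_C1: "C1_near Q (0, 0)" and Q0: "Q (0, 0) = 0"
    and flat: "flat_function P (wirtinger (\<lambda>z. of_real (P z))) r0"
    and tan: "tangent_near_0 H \<rho>"
  shows "flat_function.tangential P (wirtinger (\<lambda>z. of_real (P z))) (\<lambda>z. fst (H z)) (\<lambda>z. snd (H z))"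
proof -
  define P' where "P' = wirtinger (\<lambda>z. of_real (P z))"
  interpret flat_function P P' r0 using flat by (simp add: P'_def)
  obtain V g' where V: "open V" "(0, 0) \<in> V" "continuous_on V g'"
    "\<And>x. x \<in> V \<Longrightarrow> (Q has_derivative blinfun_apply (g' x)) (at x)"
    using Q_C1 unfolding C1_near_def by blast
  define Qt where "Qt x = blinfun_apply (g' x) (0, 1)" for x
  define Qz where "Qz x = (of_real (blinfun_apply (g' x) (1, 0)) - \<i> * of_real (blinfun_apply (g' x) (\<i>, 0))) / 2" for x
  have Qcont: "(Q \<longlongrightarrow> 0) (nhds (0, 0))"
  proof -
    have "isCont Q (0, 0)" by (rule has_derivative_continuous[OF V(4)[OF V(2)]])
    then have "(Q \<longlongrightarrow> Q (0, 0)) (nhds (0, 0))"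
      by (simp add: continuous_at tendsto_at_iff_tendsto_nhds)
    then show ?thesis by (simp only: Q0)
  qed
  have g'cont: "(g' \<longlongrightarrow> g' (0, 0)) (nhds (0, 0))"
  proof -
    have "isCont g' (0, 0)" using V(2,3) continuous_on_eq_continuous_at[OF V(1)] by blast
    then show ?thesis by (simp add: continuous_at tendsto_at_iff_tendsto_nhds)
  qed
  have Qtcont: "(Qt \<longlongrightarrow> Qt (0, 0)) (nhds (0, 0))"
    unfolding Qt_def by (intro tendsto_intros g'cont)
  have Qzcont: "(Qz \<longlongrightarrow> Qz (0, 0)) (nhds (0, 0))"
    unfolding Qz_def by (intro tendsto_intros g'cont) auto
  have w1: "wirtinger1 \<rho> (z1, z2) =
      (1 - \<i> * of_real (Q (z2, Im z1) + Im z1 * Qt (z2, Im z1))) / 2"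
    if "(z2, Im z1) \<in> V" for z1 z2
  proof -
    define D where "D v = Re v + (Im z1 * blinfun_apply (g' (z2, Im z1)) (0, Im v) + Im v * Q (z2, Im z1))" for v
    have "((\<lambda>w. (z2, Im w)) has_derivative (\<lambda>v. (0, Im v))) (at z1)"
      by (auto intro!: derivative_eq_intros)
    from has_derivative_compose[OF this V(4)[OF that]]
    have "((\<lambda>w. Q (z2, Im w)) has_derivative (\<lambda>v. blinfun_apply (g' (z2, Im z1)) (0, Im v))) (at z1)" .
    then have "((\<lambda>w. Re w + P z2 + Im w * Q (z2, Im w)) has_derivative D) (at z1)"
      unfolding D_def by (auto intro!: derivative_eq_intros)
    then have "((\<lambda>w. \<rho> (w, z2)) has_derivative D) (at z1)" by (simp add: rho)
    from wirtinger_of_real(1)[OF this] show ?thesis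
      by (simp add: wirtinger1_def D_def Qt_def zero_prod_def[symmetric] blinfun.zero_right add.commute)
  qed
  have w2: "wirtinger2 \<rho> (z1, z2) = P' z2 + of_real (Im z1) * Qz (z2, Im z1)"
    if "(z2, Im z1) \<in> V" "norm z2 < r0" for z1 z2
  proof -
    define D where "D v = 2 * Re (P' z2 * v) + Im z1 * blinfun_apply (g' (z2, Im z1)) (v, 0)" for v
    have "((\<lambda>w. (w, Im z1)) has_derivative (\<lambda>v. (v, 0))) (at z2)"
      by (auto intro!: derivative_eq_intros)
    from has_derivative_compose[OF this V(4)[OF that(1)]]
    have "((\<lambda>w. Q (w, Im z1)) has_derivative (\<lambda>v. blinfun_apply (g' (z2, Im z1)) (v, 0))) (at z2)" .
    then have "((\<lambda>w. Re z1 + P w + Im z1 * Q (w, Im z1)) has_derivative D) (at z2)"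
      unfolding D_def using P_deriv[OF that(2)] by (auto intro!: derivative_eq_intros)
    then have "((\<lambda>w. \<rho> (z1, w)) has_derivative D) (at z2)" by (simp add: rho)
    from wirtinger_of_real(1)[OF this] show ?thesis
      by (simp add: wirtinger2_def D_def Qz_def complex_eq_iff field_simps)
  qed
  have "tangential (\<lambda>z. fst (H z)) (\<lambda>z. snd (H z))"
    unfolding tangential_def
  proof
    fix \<alpha> :: real
    define x where "x z = (z, \<alpha> * P z)" for z
    define \<zeta> where "\<zeta> z = \<i> * of_real \<alpha> - 1 - of_real (\<alpha> * Q (x z))" for z
    define e where "e z = 1 - \<i> * of_real (Q (x z) + \<alpha> * P z * Qt (x z))" for z
    define q where "q z = of_real \<alpha> * Qz (x z)" for z
    have "((\<lambda>z. \<alpha> * P z) \<longlongrightarrow> \<alpha> * 0) (at 0)" by (intro tendsto_intros P_tendsto)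
    then have x: "(x \<longlongrightarrow> (0, 0)) (at 0)" unfolding x_def by (intro tendsto_Pair tendsto_ident_at) simp
    have Qx: "((\<lambda>z. Q (x z)) \<longlongrightarrow> 0) (at 0)" by (rule filterlim_compose[OF Qcont x])
    have "(\<zeta> \<longlongrightarrow> \<i> * of_real \<alpha> - 1 - of_real (\<alpha> * 0)) (at 0)"
      unfolding \<zeta>_def by (intro tendsto_intros Qx)
    then have \<zeta>: "(\<zeta> \<longlongrightarrow> \<i> * of_real \<alpha> - 1) (at 0)" by simp
    have "(e \<longlongrightarrow> 1 - \<i> * of_real (0 + \<alpha> * 0 * Qt (0, 0))) (at 0)"
      unfolding e_def by (intro tendsto_intros Qx P_tendsto filterlim_compose[OF Qtcont x])
    then have e: "(e \<longlongrightarrow> 1) (at 0)" by simp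
    have "((\<lambda>z. norm (q z)) \<longlongrightarrow> norm (of_real \<alpha> * Qz (0, 0))) (at 0)"
      unfolding q_def by (intro tendsto_intros filterlim_compose[OF Qzcont x])
    then have "\<forall>\<^sub>F z in at 0. norm (q z) < norm (of_real \<alpha> * Qz (0, 0)) + 1"
      by (rule order_tendstoD(2)) simp
    then have q: "\<forall>\<^sub>F z in at 0. norm (q z) \<le> norm (of_real \<alpha> * Qz (0, 0)) + 1"
      by eventually_elim simp
    have "((\<lambda>z. (of_real (P z) * \<zeta> z, z)) \<longlongrightarrow> (0, 0)) (at 0)"
      by (intro tendsto_Pair scaled_tendsto[OF \<zeta>] tendsto_ident_at)
    then have "filterlim (\<lambda>z. (of_real (P z) * \<zeta> z, z)) (nhds 0) (at 0)"
      by (simp add: zero_prod_def)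
    from eventually_compose_filterlim[OF tan[unfolded tangent_near_0_def] this]
    have tan': "\<forall>\<^sub>F z in at 0. \<rho> (of_real (P z) * \<zeta> z, z) = 0 \<longrightarrow>
        Re (fst (H (of_real (P z) * \<zeta> z, z)) * wirtinger1 \<rho> (of_real (P z) * \<zeta> z, z) +
          snd (H (of_real (P z) * \<zeta> z, z)) * wirtinger2 \<rho> (of_real (P z) * \<zeta> z, z)) = 0" .
    have xV: "\<forall>\<^sub>F z in at 0. x z \<in> V"
      using topological_tendstoD[OF x V(1,2)] .
    have "\<forall>\<^sub>F z in at 0. Re (e z * fst (H (of_real (P z) * \<zeta> z, z)) +
        2 * (P' z + of_real (P z) * q z) * snd (H (of_real (P z) * \<zeta> z, z))) = 0"
      using tan' xV eventually_in_disc
    proof eventually_elim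
      case (elim z)
      define z1 where "z1 = of_real (P z) * \<zeta> z"
      define h1 where "h1 = fst (H (z1, z))"
      define h2 where "h2 = snd (H (z1, z))"
      have Im: "Im z1 = \<alpha> * P z" by (simp add: z1_def \<zeta>_def)
      have Re: "Re z1 = - P z - \<alpha> * P z * Q (x z)" by (simp add: z1_def \<zeta>_def algebra_simps)
      have "\<rho> (z1, z) = 0" by (simp add: rho Re Im x_def)
      then have "Re (h1 * wirtinger1 \<rho> (z1, z) + h2 * wirtinger2 \<rho> (z1, z)) = 0"
        using elim(1) by (simp only: h1_def h2_def z1_def)
      moreover have "wirtinger1 \<rho> (z1, z) = e z / 2"
        using w1[of z z1] elim(2) by (simp add: x_def Im e_def)
      moreover have "wirtinger2 \<rho> (z1, z) = P' z + of_real (P z) * q z"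
        using w2[of z z1] elim(2,3) by (simp add: x_def Im q_def)
      ultimately have "Re (h1 * (e z / 2) + h2 * (P' z + of_real (P z) * q z)) = 0" by simp
      moreover have "e z * h1 + 2 * (P' z + of_real (P z) * q z) * h2 =
          2 *\<^sub>R (h1 * (e z / 2) + h2 * (P' z + of_real (P z) * q z))"
        by (simp add: scaleR_conv_of_real algebra_simps)
      ultimately have "Re (e z * h1 + 2 * (P' z + of_real (P z) * q z) * h2) = 0"
        by (metis mult_zero_right scaleR_complex.sel(1))
      then show ?case by (simp only: h1_def h2_def z1_def)
    qed
    then show "\<exists>\<zeta> e q K.
      (\<zeta> \<longlongrightarrow> \<i> * of_real \<alpha> - 1) (at 0) \<and> (e \<longlongrightarrow> 1) (at 0) \<and> (\<forall>\<^sub>F z in at 0. norm (q z) \<le> K) \<and>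
      (\<alpha> = 0 \<longrightarrow> (\<forall>z. \<zeta> z = - 1 \<and> q z = 0)) \<and>
      (\<forall>\<^sub>F z in at 0. Re (e z * fst (H (of_real (P z) * \<zeta> z, z)) +
        2 * (P' z + of_real (P z) * q z) * snd (H (of_real (P z) * \<zeta> z, z))) = 0)"
      using \<zeta> e q by (intro exI[of _ \<zeta>] exI[of _ e] exI[of _ q]
        exI[of _ "norm (of_real \<alpha> * Qz (0, 0)) + 1"]) (auto simp: \<zeta>_def q_def)
  qed
  then show ?thesis by (simp add: P'_def)
qed

lemma holomorphic2_slice_differentiable:
  assumes "holomorphic2_near_0 h"
  shows "(\<lambda>w. h (0, w)) field_differentiable at 0"
proof -
  obtain a b where "(h has_derivative (\<lambda>v. a * fst v + b * snd v)) (at 0)"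
    using assms unfolding holomorphic2_near_0_def by blast
  then have "((\<lambda>w. h (0, w)) has_field_derivative b) (at 0)"
    by (intro holomorphic_slices(2)) (simp add: zero_prod_def)
  then show ?thesis by (auto simp: field_differentiable_def)
qed

theorem theorem1:
  fixes P :: "complex \<Rightarrow> real"
    and Q :: "complex \<times> real \<Rightarrow> real"
    and \<rho> :: "complex \<times> complex \<Rightarrow> real"
  assumes rho: "\<And>z1 z2. \<rho> (z1, z2) = Re z1 + P z2 + Im z1 * Q (z2, Im z1)"
    and P_C1: "C1_near P 0" and Q_C1: "C1_near Q (0, 0)"
    and P0: "P 0 = 0" and Q0: "Q (0, 0) = 0"
    and P_pos: "\<forall>\<^sub>F z in at 0. P z > 0"
    and P_flat: "flat_at_0 (\<lambda>z. of_real (P z))"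
    and P'_flat: "flat_at_0 (wirtinger (\<lambda>z. of_real (P z)))"
  shows "(\<exists>B. finite B \<and> hol0 \<rho> \<subseteq> span B) \<and> dim (hol0 \<rho>) \<le> 1"
proof -
  obtain r0 where flat: "flat_function P (wirtinger (\<lambda>z. of_real (P z))) r0"
    by (rule flat_function_wirtinger[OF P_C1 P_pos P_flat P'_flat])
  then interpret flat_function P "wirtinger (\<lambda>z. of_real (P z))" r0 .
  define d where "d H = deriv (\<lambda>w. snd (H (0, w))) 0" for H :: "complex \<times> complex \<Rightarrow> complex \<times> complex"
  have rigid: "Re (d H) = 0" "d H = 0 \<Longrightarrow> germ0_of H = 0" if H: "germ0_of H \<in> hol0 \<rho>" for H
  proof -
    have H': "holomorphic2_near_0 (\<lambda>z. fst (H z))" "holomorphic2_near_0 (\<lambda>z. snd (H z))"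
      "H 0 = 0" "tangent_near_0 H \<rho>"
      using H by (auto simp: germ0_of_in_hol0_iff)
    have tan: "tangential (\<lambda>z. fst (H z)) (\<lambda>z. snd (H z))"
      by (rule tangential_of_tangent[OF rho Q_C1 Q0 flat H'(4)])
    show "Re (d H) = 0"
      unfolding d_def by (rule tangential_rigidity(1)[OF tan H'(1,2)]) (use H'(3) in auto)
    assume "d H = 0"
    then have "(\<forall>\<^sub>F z in nhds 0. fst (H z) = 0) \<and> (\<forall>\<^sub>F z in nhds 0. snd (H z) = 0)"
      unfolding d_def by (intro tangential_rigidity(2)[OF tan H'(1,2)]) (use H'(3) in auto)
    then have "\<forall>\<^sub>F z in nhds 0. fst (H z) = 0 \<and> snd (H z) = 0"
      by (simp only: eventually_conj_iff)
    then have "\<forall>\<^sub>F z in nhds 0. H z = 0"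
      by eventually_elim (simp add: prod_eq_iff)
    then show "germ0_of H = 0" by (simp add: zero_germ0_def germ0.abs_eq_iff)
  qed
  have "\<exists>v. hol0 \<rho> \<subseteq> span {v}"
  proof (cases "hol0 \<rho> \<subseteq> {0}")
    case True
    then show ?thesis by (auto intro!: exI[of _ 0] simp: span_zero)
  next
    case False
    then obtain H where H: "germ0_of H \<in> hol0 \<rho>" "germ0_of H \<noteq> 0"
      unfolding hol0_def by blast
    have dH: "Im (d H) \<noteq> 0" using rigid[OF H(1)] H(2) by (auto simp: complex_eq_iff)
    have "hol0 \<rho> \<subseteq> span {germ0_of H}"
    proof
      fix y assume y: "y \<in> hol0 \<rho>"
      then obtain K where K: "y = germ0_of K" unfolding hol0_def by blast
      \<comment> \<open>both derivatives are imaginary, so this combination has vanishing derivative\<close>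
      define c where "c = Im (d K) / Im (d H)"
      define L where "L z = K z - c *\<^sub>R H z" for z
      have L: "germ0_of L = y - c *\<^sub>R germ0_of H"
        by (simp add: L_def[abs_def] K minus_germ0.abs_eq scaleR_germ0.abs_eq)
      have Lhol: "germ0_of L \<in> hol0 \<rho>"
        unfolding L using y H(1) subspace_hol0
        by (intro subspace_diff subspace_scale) auto
      have fd: "(\<lambda>w. snd (K (0, w))) field_differentiable at 0"
        "(\<lambda>w. snd (H (0, w))) field_differentiable at 0"
        using y H(1) unfolding K germ0_of_in_hol0_iff
        by (auto intro: holomorphic2_slice_differentiable)
      have "d L = d K - of_real c * d H"
      proof -
        have "((\<lambda>w. snd (K (0, w)) - of_real c * snd (H (0, w))) has_field_derivative
            d K - of_real c * d H) (at 0)"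
          using fd unfolding d_def
          by (intro DERIV_diff DERIV_cmult) (auto simp: DERIV_deriv_iff_field_differentiable)
        then show ?thesis by (simp add: d_def L_def scaleR_conv_of_real DERIV_imp_deriv)
      qed
      moreover have "Re (d K) = 0" "Re (d H) = 0"
        using rigid(1) y H(1) by (auto simp: K)
      ultimately have "d L = 0" using dH by (simp add: complex_eq_iff c_def)
      then have "y = c *\<^sub>R germ0_of H" using rigid(2)[OF Lhol] L by simp
      then show "y \<in> span {germ0_of H}" by (simp add: span_base span_scale)
    qed
    then show ?thesis by blast
  qed
  then obtain v where v: "hol0 \<rho> \<subseteq> span {v}" by blast
  have "dim (hol0 \<rho>) \<le> card {v}" by (rule dim_le_card[OF v]) simp
  then show ?thesis using v by (auto intro!: exI[of _ "{v}"])
qed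

end
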